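(* Let $a\in L_1(0,2\pi)$ be real-valued with flux $\alpha=\frac1{2\pi}\int_0^{2\pi}a\,dx\notin\mathbb Z$, and let $V\ge0$ be an $M\times M$ Hermitian matrix-valued function on $\mathbb S^1$ with $\operatorname{Tr}V^{3/2}\in L_1(0,2\pi)$. Then the spectrum of the operator $H=\bigl(i\frac d{dx}-a(x)\bigr)^2-V$ in $L_2(\mathbb S^1;\mathbb C^M)$ is discrete and its negative eigenvalues $-\lambda_n\le0$ satisfy $$\sum_n\lambda_n\le\frac2{3\sqrt3}K(\alpha)\int_0^{2\pi}\operatorname{Tr}[V(x)^{3/2}]dx,$$ where $K(\alpha)=|\sin(2\pi\alpha)|^{-1}$ if $\alpha\bmod1\in(0,1/4)\cup(3/4,1)$ and $K(\alpha)=1$ if $\alpha\bmod1\in[1/4,3/4]$. *)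

theory Defs
  imports "HOL-Analysis.Analysis"
begin

text \<open>The circle S^1 is represented by the interval [0, 2 pi] with periodic boundary
conditions. Vectors in C^M are elements of complex^'m for a finite index type 'm
(M = CARD('m)), M x M matrices are complex^'m^'m.\<close>

abbreviation circ :: "real set" where "circ \<equiv> {0..2*pi}"

definition herm :: "complex^'m^'m \<Rightarrow> bool" where
  "herm A \<longleftrightarrow> (\<forall>i j. A$i$j = cnj (A$j$i))"

definition psd :: "complex^'m^'m \<Rightarrow> bool" where
  "psd A \<longleftrightarrow> (\<forall>z::complex^'m. 0 \<le> Re (\<Sum>i\<in>UNIV. \<Sum>j\<in>UNIV. cnj (z$i) * A$i$j * z$j))"

definition msqrt :: "complex^'m^'m \<Rightarrow> complex^'m^'m" where
  "msqrt A = (THE S. herm S \<and> psd S \<and> S ** S = A)"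

definition mtrace :: "complex^'m^'m \<Rightarrow> complex" where
  "mtrace A = (\<Sum>i\<in>UNIV. A$i$i)"

text \<open>Tr (V^(3/2)) = Tr (V V^(1/2)) (a real number for V >= 0).\<close>
definition tr32 :: "complex^'m^'m \<Rightarrow> real" where
  "tr32 A = Re (mtrace (A ** msqrt A))"

definition ac_deriv :: "(real \<Rightarrow> 'a::euclidean_space) \<Rightarrow> (real \<Rightarrow> 'a) \<Rightarrow> bool" where
  "ac_deriv u u' \<longleftrightarrow> u' absolutely_integrable_on circ \<and>
     (\<forall>x\<in>circ. u x = u 0 + integral {0..x} u')"

definition applyH :: "(real \<Rightarrow> real) \<Rightarrow> (real \<Rightarrow> complex^'m^'m) \<Rightarrow>
     (real \<Rightarrow> complex^'m) \<Rightarrow> (real \<Rightarrow> complex^'m) \<Rightarrow> bool" where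
  "applyH a V u f \<longleftrightarrow> (\<exists>u' w w'. ac_deriv u u' \<and> ac_deriv w w' \<and>
       u 0 = u (2*pi) \<and> w 0 = w (2*pi) \<and>
       (AE x in lebesgue_on circ. w x = \<i> *s u' x - a x *\<^sub>R u x) \<and>
       (AE x in lebesgue_on circ. f x = \<i> *s w' x - a x *\<^sub>R w x - V x *v u x))"

definition sq_int :: "(real \<Rightarrow> complex^'m) \<Rightarrow> bool" where
  "sq_int f \<longleftrightarrow> f \<in> borel_measurable (lebesgue_on circ) \<and>
      integrable (lebesgue_on circ) (\<lambda>x. (norm (f x))\<^sup>2)"

definition eigenfun :: "(real \<Rightarrow> real) \<Rightarrow> (real \<Rightarrow> complex^'m^'m) \<Rightarrow> complex \<Rightarrow>
     (real \<Rightarrow> complex^'m) \<Rightarrow> bool" where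
  "eigenfun a V \<mu> u \<longleftrightarrow> applyH a V u (\<lambda>x. \<mu> *s u x) \<and> (\<exists>x\<in>circ. u x \<noteq> 0)"

text \<open>mu is in the resolvent set: H - mu is a bijection from the domain onto L2
  (functions are normalised to vanish outside [0,2pi]; domain elements are continuous
  there, so a.e.-equality is pointwise equality).\<close>
definition in_resolvent :: "(real \<Rightarrow> real) \<Rightarrow> (real \<Rightarrow> complex^'m^'m) \<Rightarrow> complex \<Rightarrow> bool" where
  "in_resolvent a V \<mu> \<longleftrightarrow> (\<forall>f. sq_int f \<longrightarrow>
      (\<exists>!u. (\<forall>x. x \<notin> circ \<longrightarrow> u x = 0) \<and> applyH a V u (\<lambda>x. f x + \<mu> *s u x)))"

definition spectrumH :: "(real \<Rightarrow> real) \<Rightarrow> (real \<Rightarrow> complex^'m^'m) \<Rightarrow> complex set" where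
  "spectrumH a V = {\<mu>. \<not> in_resolvent a V \<mu>}"

text \<open>Linear independence over C of n functions in L2(0,2pi) (they are continuous, so
  vanishing a.e. is vanishing on [0,2pi]).\<close>
definition lin_indep :: "nat \<Rightarrow> (nat \<Rightarrow> real \<Rightarrow> complex^'m) \<Rightarrow> bool" where
  "lin_indep n u \<longleftrightarrow> (\<forall>c::nat \<Rightarrow> complex.
      (\<forall>x\<in>circ. (\<Sum>k<n. c k *s u k x) = 0) \<longrightarrow> (\<forall>k<n. c k = 0))"

definition discrete_spectrum :: "(real \<Rightarrow> real) \<Rightarrow> (real \<Rightarrow> complex^'m^'m) \<Rightarrow> bool" where
  "discrete_spectrum a V \<longleftrightarrow> (\<forall>\<mu>\<in>spectrumH a V.
      (\<exists>e>0. \<forall>\<nu>\<in>spectrumH a V. \<nu> \<noteq> \<mu> \<longrightarrow> e \<le> cmod (\<nu> - \<mu>)) \<and>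
      (\<exists>u. eigenfun a V \<mu> u) \<and>
      (\<exists>N. \<forall>n u. (\<forall>k<n. eigenfun a V \<mu> (u k)) \<and> lin_indep n u \<longrightarrow> n \<le> N))"

definition Kconst :: "real \<Rightarrow> real" where
  "Kconst \<alpha> = (if frac \<alpha> \<in> {1/4..3/4} then 1 else 1 / \<bar>sin (2*pi*\<alpha>)\<bar>)"

end

theory Submission
  imports Defs
begin

text \<open>Write A = i d/dx - a. Multiplying by exp(lambda x + i int_0^x a) and integrating over one period
gives the sharp interpolation inequality |u(x)|^2 \<le> K(alpha) |Au| |u| in the L2 norm. Applied to
combinations of orthonormal eigenfunctions phi_k with coefficients taken from an eigenbasis of V(x)
(the Eden-Foias argument), it bounds the sum of <phi_k, V phi_k> by the kinetic energy plus
2/(3 sqrt 3) K(alpha) int Tr V^(3/2); the form identity then gives the Lieb-Thirring bound. The same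
interpolation inequality bounds the number of orthonormal eigenfunctions below any energy, so the
eigenvalues are isolated and of finite multiplicity. Off the eigenvalues, H u - mu u = f is a linear
first-order system with L1 coefficients, and the Fredholm alternative for its period map shows that
mu lies in the resolvent set.\<close>

section \<open>Hermitian matrices\<close>

text \<open>K(alpha) is the supremum over y > 1 of (y^2 - 1) / (y^2 - 2 y cos(2 pi alpha) + 1) with
  y = exp(2 pi lambda). The numerator comes from Cauchy-Schwarz with the weight exp(2 lambda t) over
  one period; the denominator is |exp(2 pi (lambda + i alpha)) - 1|^2. A flux outside the integers
  keeps the quotient bounded as lambda tends to 0. If the cosine is positive the supremum is
  attained and equals 1 / |sin(2 pi alpha)|; otherwise it is the limit 1 as y grows. The constant
  2/(3 sqrt 3) K s^3 is the maximum over r >= 0 of s^2 r - r^3 / K^2, where s^2 is an eigenvalue of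
  V(x) and r the squared norm of the test combination. The coefficients a and V are merely
  integrable, so u need not have a second derivative. The equation is therefore carried by the pair
  u, w = Au of absolutely continuous functions, and the calculus needed for it (products,
  exponentials) is derived from local error estimates that are quadratic in an integral, not from
  differentiation almost everywhere.\<close>

definition cip :: "complex^'m::finite \<Rightarrow> complex^'m \<Rightarrow> complex" where
  "cip x y = (\<Sum>i\<in>UNIV. cnj (x$i) * y$i)"

lemma cip_add_left: "cip (x + y) z = cip x z + cip y z"
  by (simp add: cip_def sum.distrib algebra_simps)

lemma cip_add_right: "cip x (y + z) = cip x y + cip x z"
  by (simp add: cip_def sum.distrib algebra_simps)

lemma cip_diff_left: "cip (x - y) z = cip x z - cip y z"
  by (simp add: cip_def sum_subtractf algebra_simps)

lemma cip_diff_right: "cip x (y - z) = cip x y - cip x z"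
  by (simp add: cip_def sum_subtractf algebra_simps)

lemma cip_smult_left: "cip (c *s x) y = cnj c * cip x y"
  by (simp add: cip_def sum_distrib_left algebra_simps)

lemma cip_smult_right: "cip x (c *s y) = c * cip x y"
  by (simp add: cip_def sum_distrib_left algebra_simps)

lemma cip_zero_left [simp]: "cip 0 y = 0" by (simp add: cip_def)

lemma cip_zero_right [simp]: "cip x 0 = 0" by (simp add: cip_def)

lemma cip_sum_right: "cip x (\<Sum>k\<in>S. f k) = (\<Sum>k\<in>S. cip x (f k))"
  by (induction S rule: infinite_finite_induct) (auto simp: cip_add_right)

lemma cnj_cip: "cnj (cip x y) = cip y x"
  by (simp add: cip_def mult.commute)

lemma scaleR_eq_smult: "r *\<^sub>R x = complex_of_real r *s x" for x :: "complex^'m::finite"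
  by (simp add: vec_eq_iff) (simp add: scaleR_conv_of_real)

lemma Re_cip: "Re (cip x y) = x \<bullet> y"
  by (simp add: cip_def inner_vec_def inner_complex_def)

lemma cip_self: "cip x x = complex_of_real ((norm x)\<^sup>2)"
proof (rule complex_eqI)
  show "Im (cip x x) = Im (complex_of_real ((norm x)\<^sup>2))"
    by (simp add: cip_def)
qed (simp add: Re_cip power2_norm_eq_inner)

lemma norm_smult: "norm (c *s x) = cmod c * norm x" for x :: "complex^'m::finite"
proof -
  have "complex_of_real ((norm (c *s x))\<^sup>2) = complex_of_real ((cmod c * norm x)\<^sup>2)"
    unfolding cip_self[symmetric] cip_smult_left cip_smult_right
    by (simp add: cip_self power_mult_distrib) (metis complex_norm_square of_real_power)
  then have "(norm (c *s x))\<^sup>2 = (cmod c * norm x)\<^sup>2"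
    using of_real_eq_iff by blast
  then show ?thesis by simp
qed

text \<open>A phase factor on \<open>y\<close> makes the product real and nonnegative; there it is
  the real inner product, and the real Cauchy-Schwarz inequality applies.\<close>

lemma norm_cip_le: "cmod (cip x y) \<le> norm x * norm y"
proof (cases "cip x y = 0")
  case False
  define c where "c = cnj (cip x y) / cmod (cip x y)"
  have c: "cmod c = 1" using False by (simp add: c_def norm_divide)
  have "cip x (c *s y) = complex_of_real (cmod (cip x y))"
    using False unfolding cip_smult_right c_def
    by (simp add: mult.commute complex_norm_square[symmetric] field_simps power2_eq_square)
  then have "cmod (cip x y) = x \<bullet> (c *s y)" by (metis Re_cip Re_complex_of_real)
  also have "\<dots> \<le> norm x * norm (c *s y)" by (rule norm_cauchy_schwarz)
  finally show ?thesis by (simp add: norm_smult c)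
qed auto

lemma bounded_bilinear_cip: "bounded_bilinear cip"
proof
  show "\<exists>K. \<forall>a b. norm (cip a b) \<le> norm a * norm b * K"
    using norm_cip_le by (intro exI[of _ 1]) auto
qed (auto simp: cip_add_left cip_add_right scaleR_eq_smult cip_smult_left cip_smult_right scaleR_conv_of_real)

lemma cip_axis: "cip (axis i 1) x = x $ i"
  by (simp add: cip_def axis_def if_distrib if_distribR cong: if_cong)

lemma matvec_smult: "A *v (c *s x) = c *s (A *v x)" for x :: "complex^'m::finite"
  by (simp add: matrix_vector_mult_def vec_eq_iff sum_distrib_left algebra_simps)

lemma herm_cip: "herm A \<Longrightarrow> cip x (A *v y) = cip (A *v x) y"
proof -
  assume h: "herm A"
  have "cip x (A *v y) = (\<Sum>i\<in>UNIV. \<Sum>j\<in>UNIV. cnj (x$i) * (A$i$j * y$j))"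
    by (simp add: cip_def matrix_vector_mult_def sum_distrib_left)
  also have "\<dots> = (\<Sum>j\<in>UNIV. \<Sum>i\<in>UNIV. cnj (x$i) * (A$i$j * y$j))" by (rule sum.swap)
  also have "\<dots> = (\<Sum>j\<in>UNIV. \<Sum>i\<in>UNIV. cnj (A$j$i * x$i) * y$j)"
    using h unfolding herm_def by (intro sum.cong refl) (metis complex_cnj_mult mult.assoc mult.commute)
  also have "\<dots> = cip (A *v x) y"
    by (simp add: cip_def matrix_vector_mult_def sum_distrib_right)
  finally show ?thesis .
qed

lemma herm_iff_cip: "herm A \<longleftrightarrow> (\<forall>x y. cip x (A *v y) = cip (A *v x) y)"
proof
  assume *: "\<forall>x y. cip x (A *v y) = cip (A *v x) y"
  show "herm A" unfolding herm_def
  proof (intro allI)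
    fix i j
    have ax: "A *v axis j 1 = (\<chi> k. A$k$j)" for j
      by (simp add: matrix_vector_mult_def axis_def vec_eq_iff if_distrib cong: if_cong)
    have "cip (axis i 1) (A *v axis j 1) = cip (A *v axis i 1) (axis j 1)" using * by blast
    then show "A$i$j = cnj (A$j$i)"
      by (metis ax cip_axis cnj_cip vec_lambda_beta)
  qed
qed (simp add: herm_cip)

lemma psd_iff_cip: "psd A \<longleftrightarrow> (\<forall>z. 0 \<le> Re (cip z (A *v z)))"
  by (simp add: psd_def cip_def matrix_vector_mult_def sum_distrib_left mult.assoc)

lemma matrix_eqI_cip: "(\<And>x. A *v x = B *v x) \<Longrightarrow> A = B" for A B :: "complex^'m::finite^'m"
  by (simp add: matrix_eq)

section \<open>Orthonormal eigenbases of Hermitian matrices and the square root\<close>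

definition orthonormal :: "('i \<Rightarrow> complex^'m::finite) \<Rightarrow> 'i set \<Rightarrow> bool" where
  "orthonormal e I \<longleftrightarrow> (\<forall>i\<in>I. \<forall>j\<in>I. cip (e i) (e j) = (if i = j then 1 else 0))"

lemma orthonormal_norm:
  assumes "orthonormal e I" "i \<in> I"
  shows "norm (e i) = 1"
proof -
  have "complex_of_real ((norm (e i))\<^sup>2) = complex_of_real 1"
    unfolding cip_self[symmetric] using assms by (simp add: orthonormal_def)
  then have "(norm (e i))\<^sup>2 = 1" by (simp only: of_real_eq_iff)
  then show ?thesis using norm_ge_zero[of "e i"] by (simp add: power2_eq_1_iff)
qed

text \<open>Each new eigenvector maximises the Rayleigh quotient on the unit sphere of
  \<open>W\<close>, the orthogonal complement of those already found, which the Hermitian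
  \<open>A\<close> maps to itself.\<close>

lemma orthonormal_eigenvectors_aux:
  fixes A :: "complex^'m::finite^'m"
  assumes h: "herm A"
  shows "k \<le> CARD('m) \<Longrightarrow> \<exists>(e::nat \<Rightarrow> complex^'m) (d::nat \<Rightarrow> real).
     orthonormal e {..<k} \<and> (\<forall>i<k. A *v e i = complex_of_real (d i) *s e i)"
proof (induction k)
  case 0 then show ?case by (auto simp: orthonormal_def)
next
  case (Suc k)
  then obtain e :: "nat \<Rightarrow> complex^'m" and d :: "nat \<Rightarrow> real" where
    on: "orthonormal e {..<k}" and ev: "\<forall>i<k. A *v e i = complex_of_real (d i) *s e i" by auto
  define W where "W = {z. \<forall>i<k. cip (e i) z = 0}"
  have Wadd: "x + y \<in> W" "c *s x \<in> W" "x - y \<in> W" "A *v x \<in> W" if "x \<in> W" "y \<in> W" for x y c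
    using that ev by (auto simp: W_def cip_add_right cip_smult_right cip_diff_right herm_cip[OF h] cip_smult_left)
  \<comment> \<open>\<open>dim\<close> is the real dimension, 2 M for C^M. Complex orthogonality to
    \<open>k\<close> vectors is real orthogonality to the 2 k vectors \<open>e i\<close> and
    \<open>\<i> *s e i\<close>, so \<open>W\<close> contains a nonzero vector as long as k <
    M.\<close>
  have "dim (e ` {..<k} \<union> (\<lambda>i. \<i> *s e i) ` {..<k}) \<le> card (e ` {..<k} \<union> (\<lambda>i. \<i> *s e i) ` {..<k})"
    by (rule dim_le_card') auto
  also have "\<dots> \<le> k + k"
    by (rule order_trans[OF card_Un_le] add_mono)+ (metis card_image_le card_lessThan finite_lessThan)+
  also have "\<dots> < DIM(complex^'m)" using Suc.prems by simp
  finally obtain z0 where z0: "z0 \<noteq> 0"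
      "\<And>y. y \<in> span (e ` {..<k} \<union> (\<lambda>i. \<i> *s e i) ` {..<k}) \<Longrightarrow> orthogonal z0 y"
    using orthogonal_to_subspace_exists by blast
  have z0W: "z0 \<in> W" unfolding W_def
  proof clarify
    fix i assume "i < k"
    then have "orthogonal z0 (e i)" "orthogonal z0 (\<i> *s e i)" by (auto intro!: z0 span_base)
    then have "Re (cip (e i) z0) = 0" "Re (cip (\<i> *s e i) z0) = 0"
      unfolding Re_cip orthogonal_def by (auto simp: inner_commute)
    then show "cip (e i) z0 = 0" by (simp add: cip_smult_left complex_eq_iff)
  qed
  interpret cip: bounded_bilinear cip by (rule bounded_bilinear_cip)
  have cA: "continuous_on UNIV (\<lambda>z. A *v z)" by (intro linear_continuous_on matrix_vector_mul_bounded_linear)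
  have cW: "closed W"
  proof -
    have "W = (\<Inter>i\<in>{..<k}. {z. cip (e i) z = 0})" by (auto simp: W_def)
    moreover have "closed {z. cip (e i) z = 0}" for i
      by (intro closed_Collect_eq cip.continuous_on continuous_intros)
    ultimately show ?thesis by (metis closed_INT)
  qed
  have "compact (W \<inter> sphere 0 1)" using cW by (intro closed_Int_compact) auto
  moreover have "(1 / norm z0) *\<^sub>R z0 \<in> W \<inter> sphere 0 1"
    using z0 z0W Wadd(2) by (auto simp: scaleR_eq_smult) (simp add: norm_smult norm_divide)
  moreover have "continuous_on (W \<inter> sphere 0 1) (\<lambda>z. Re (cip z (A *v z)))"
    by (intro continuous_intros cip.continuous_on continuous_on_subset[OF cA]) auto
  ultimately have "\<exists>z\<in>W \<inter> sphere 0 1. \<forall>y\<in>W \<inter> sphere 0 1. Re (cip y (A *v y)) \<le> Re (cip z (A *v z))"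
    by (intro continuous_attains_sup) auto
  then obtain z where z: "z \<in> W" "norm z = 1"
      and mx: "\<And>y. y \<in> W \<Longrightarrow> norm y = 1 \<Longrightarrow> Re (cip y (A *v y)) \<le> Re (cip z (A *v z))"
    by auto
  define m where "m = Re (cip z (A *v z))"
  \<comment> \<open>The form of \<open>B = m - A\<close> is nonnegative on \<open>W\<close> and
    vanishes at the maximiser \<open>z\<close>. Such a point lies in the kernel of \<open>B\<close>,
    which is the eigenvalue equation.\<close>
  define B where "B y = complex_of_real m *s y - A *v y" for y
  have Bsym: "cip x (B y) = cip (B x) y" for x y
    by (simp add: B_def cip_diff_left cip_diff_right cip_smult_left cip_smult_right herm_cip[OF h])
  have Badd: "B (x + y) = B x + B y" "B (c *s x) = c *s B x" for x y c
    by (auto simp: B_def matrix_vector_right_distrib matvec_smult vec_eq_iff algebra_simps)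
  have Bpos: "0 \<le> Re (cip y (B y))" if "y \<in> W" for y
  proof (cases "y = 0")
    case False
    define y' where "y' = complex_of_real (1 / norm y) *s y"
    have "norm y' = 1" "y' \<in> W" using False Wadd(2)[OF that that] by (auto simp: y'_def norm_smult norm_divide)
    from mx[OF this(2,1)] have "0 \<le> Re (cip y' (B y'))"
      using \<open>norm y' = 1\<close> by (simp add: B_def cip_diff_right cip_smult_right cip_self m_def)
    also have "Re (cip y' (B y')) = (1 / norm y)\<^sup>2 * Re (cip y (B y))"
      by (simp add: y'_def Badd cip_smult_left cip_smult_right power2_eq_square)
    finally show ?thesis using False by (simp add: zero_le_mult_iff)
  qed (simp add: B_def)
  have Bz0: "Re (cip z (B z)) = 0"
    using z by (simp add: B_def cip_diff_right cip_smult_right cip_self m_def)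
  have "B z = 0"
  proof (rule ccontr)
    assume nz: "B z \<noteq> 0"
    define h where "h = B z"
    have hW: "h \<in> W" using z Wadd by (simp add: h_def B_def)
    define N where "N = (norm h)\<^sup>2"
    have N: "N > 0" using nz by (simp add: N_def h_def)
    define q where "q = Re (cip h (B h))"
    have q: "0 \<le> q" using Bpos[OF hW] by (simp add: q_def)
    \<comment> \<open>the nonnegative form vanishes at z, so moving from z in direction -h must not decrease it\<close>
    have "0 \<le> - 2 * t * N + t\<^sup>2 * q" for t
    proof -
      have "0 \<le> Re (cip (z + complex_of_real (-t) *s h) (B (z + complex_of_real (-t) *s h)))"
        using Wadd z hW by (intro Bpos) auto
      also have "\<dots> = Re (cip z (B z)) - t * Re (cip h (B z)) - t * Re (cip z (B h)) + t\<^sup>2 * q"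
        by (simp add: Badd cip_add_left cip_add_right cip_smult_left cip_smult_right power2_eq_square
            q_def algebra_simps del: of_real_minus)
      also have "\<dots> = - 2 * t * N + t\<^sup>2 * q"
        using Bz0 by (simp add: Bsym[of z] h_def[symmetric] cip_self N_def)
      finally show ?thesis .
    qed
    \<comment> \<open>A step this small makes the linear gain 2 t N exceed the quadratic cost t^2 q;
      the denominator q + 1 covers q = 0.\<close>
    from this[of "N / (q + 1)"] have "2 * N * N / (q+1) \<le> N * N * q / (q+1)^2"
      by (simp add: power2_eq_square)
    then have "2 * N * N / (q+1) * (q+1)^2 \<le> N * N * q / (q+1)^2 * (q+1)^2"
      by (intro mult_right_mono) auto
    then have "2 * N * N * (q+1) \<le> N * N * q" using q by (simp add: power2_eq_square)
    then have "2 * (q + 1) \<le> q" using N by simp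
    then show False using q by simp
  qed
  then have Az: "A *v z = complex_of_real m *s z" by (simp add: B_def)
  have zc: "cip (e i) z = 0" "cip z (e i) = 0" if "i < k" for i
    using z that cnj_cip[of "e i" z] by (auto simp: W_def)
  show ?case
  proof (intro exI conjI)
    show "orthonormal (e(k := z)) {..<Suc k}"
      using on zc z by (auto simp: orthonormal_def) (simp add: cip_self)
    show "\<forall>i<Suc k. A *v (e(k := z)) i = complex_of_real ((d(k := m)) i) *s (e(k := z)) i"
      using ev Az by (auto simp: less_Suc_eq)
  qed
qed

lemma spectral_theorem_herm:
  fixes A :: "complex^'m::finite^'m"
  assumes h: "herm A"
  obtains e :: "'m \<Rightarrow> complex^'m" and d :: "'m \<Rightarrow> real" where
    "orthonormal e UNIV" "\<And>i. A *v e i = complex_of_real (d i) *s e i"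
proof -
  obtain e :: "nat \<Rightarrow> complex^'m" and d :: "nat \<Rightarrow> real" where
     *: "orthonormal e {..<CARD('m)}" "\<forall>i<CARD('m). A *v e i = complex_of_real (d i) *s e i"
    using orthonormal_eigenvectors_aux[OF h order_refl] by blast
  obtain f :: "'m \<Rightarrow> nat" where f: "bij_betw f UNIV {..<CARD('m)}"
    by (metis bij_betw_iff_card card_lessThan finite_lessThan finite)
  then have fl: "f i < CARD('m)" and fi: "f i = f j \<longleftrightarrow> i = j" for i j
    using bij_betwE bij_betw_imp_inj_on by (fastforce simp: inj_on_def)+
  show ?thesis
    by (rule that[of "e \<circ> f" "d \<circ> f"]) (use * fl fi in \<open>auto simp: orthonormal_def\<close>)
qed

text \<open>The matrix \<open>P\<close> with columns \<open>e j\<close> has its adjoint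
  \<open>Q\<close> as left inverse. For square matrices this is also a right inverse, and
  \<open>P *v (Q *v x)\<close> is the expansion.\<close>

lemma orthonormal_expand:
  fixes e :: "'m \<Rightarrow> complex^'m::finite"
  assumes "orthonormal e UNIV"
  shows "x = (\<Sum>i\<in>UNIV. cip (e i) x *s e i)"
proof -
  define P Q :: "complex^'m^'m" where "P = (\<chi> i j. e j $ i)" and "Q = (\<chi> i j. cnj (e i $ j))"
  have "Q ** P = mat 1"
    using assms by (simp add: vec_eq_iff matrix_matrix_mult_def P_def Q_def mat_def orthonormal_def cip_def)
  then have "P ** Q = mat 1" by (simp add: matrix_left_right_inverse)
  then have "x = P *v (Q *v x)" by (simp add: matrix_vector_mul_assoc)
  also have "Q *v x = (\<chi> i. cip (e i) x)"
    by (simp add: Q_def matrix_vector_mult_def cip_def)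
  also have "P *v \<dots> = (\<Sum>i\<in>UNIV. cip (e i) x *s e i)"
    by (simp add: vec_eq_iff P_def matrix_vector_mult_def sum_component mult.commute)
  finally show ?thesis .
qed

lemma parseval:
  fixes e :: "'m \<Rightarrow> complex^'m::finite"
  assumes "orthonormal e UNIV"
  shows "(\<Sum>i\<in>UNIV. cip x (e i) * cip (e i) y) = cip x y"
  using arg_cong[OF orthonormal_expand[OF assms, of y], of "cip x"]
  by (simp add: cip_sum_right cip_smult_right mult.commute)

text \<open>Diagonal entries are values of the form on the standard basis. After
  \<open>A *v axis i 1\<close> is expanded in \<open>e\<close>, summing over \<open>i\<close> first
  is Parseval for the standard basis.\<close>

lemma mtrace_onb:
  fixes e :: "'m \<Rightarrow> complex^'m::finite"
  assumes e: "orthonormal e UNIV"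
  shows "mtrace A = (\<Sum>i\<in>UNIV. cip (e i) (A *v e i))"
proof -
  have ax: "A $ i $ i = cip (axis i 1) (A *v axis i 1)" for i
    by (simp add: cip_axis) (simp add: matrix_vector_mult_def axis_def if_distrib cong: if_cong)
  have "mtrace A = (\<Sum>i\<in>UNIV. cip (axis i 1) (A *v axis i 1))"
    by (simp add: mtrace_def ax)
  also have "\<dots> = (\<Sum>i\<in>UNIV. \<Sum>j\<in>UNIV. cip (axis i 1) (A *v e j) * cip (e j) (axis i 1))"
  proof (intro sum.cong refl)
    fix i
    have "A *v axis i 1 = (\<Sum>j\<in>UNIV. cip (e j) (axis i 1) *s (A *v e j))"
      by (subst orthonormal_expand[OF e, of "axis i 1"])
         (simp add: matvec_smult linear_sum[OF matrix_vector_mul_linear])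
    then show "cip (axis i 1) (A *v axis i 1) = (\<Sum>j\<in>UNIV. cip (axis i 1) (A *v e j) * cip (e j) (axis i 1))"
      by (simp add: cip_sum_right cip_smult_right mult.commute)
  qed
  also have "\<dots> = (\<Sum>j\<in>UNIV. \<Sum>i\<in>UNIV. cip (e j) (axis i 1) * cip (axis i 1) (A *v e j))"
    by (subst sum.swap) (simp add: mult.commute)
  also have "\<dots> = (\<Sum>j\<in>UNIV. cip (e j) (A *v e j))"
  proof -
    have "orthonormal (\<lambda>i::'m. axis i 1 :: complex^'m) UNIV"
      by (auto simp: orthonormal_def cip_axis) (auto simp: axis_def)
    then show ?thesis by (intro sum.cong refl parseval)
  qed
  finally show ?thesis .
qed

text \<open>The eigenvector equation factors as (S + s)(S - s) e = 0.\<close>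
lemma psd_sqrt_eigenvector:
  fixes S :: "complex^'m::finite^'m"
  assumes "herm S" "psd S" "S ** S = A" "0 \<le> s" "A *v e = complex_of_real (s\<^sup>2) *s e"
  shows "S *v e = complex_of_real s *s e"
proof -
  define y where "y = S *v e - complex_of_real s *s e"
  have SS: "S *v (S *v e) = complex_of_real (s\<^sup>2) *s e" using assms by (simp add: matrix_vector_mul_assoc)
  have Sy: "S *v y = complex_of_real (- s) *s y"
    by (simp add: y_def matrix_vector_mult_diff_distrib SS matvec_smult)
       (simp add: vec_eq_iff power2_eq_square algebra_simps)
  have "0 \<le> Re (cip y (S *v y))" using assms(2) psd_iff_cip by blast
  also have "\<dots> = - s * (norm y)\<^sup>2" unfolding Sy cip_smult_right cip_self by simp
  finally have *: "s * (norm y)\<^sup>2 \<le> 0" by simp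
  have "y = 0"
  proof (cases "s = 0")
    case True
    then have "cip (S *v e) (S *v e) = 0" using SS herm_cip[OF assms(1), of e "S *v e"] by simp
    then show ?thesis using True by (simp add: cip_self y_def)
  next
    case False
    then show ?thesis using * assms(4) by (simp add: mult_le_0_iff)
  qed
  then show ?thesis by (simp add: y_def)
qed

text \<open>\<open>msqrt\<close> is a definite description, so existence and uniqueness are both
  due. \<open>T\<close>, diagonal in the basis \<open>e\<close>, is one root; by
  \<open>psd_sqrt_eigenvector\<close> any other root acts on every \<open>e i\<close> as
  \<open>T\<close> does.\<close>

lemma msqrt_eigenvector:
  fixes A :: "complex^'m::finite^'m" and e :: "'m \<Rightarrow> complex^'m"
  assumes e: "orthonormal e UNIV" and s: "\<And>i. 0 \<le> s i"
    and A: "\<And>i. A *v e i = complex_of_real ((s i)\<^sup>2) *s e i"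
  shows "msqrt A *v e i = complex_of_real (s i) *s e i"
proof -
  define T :: "complex^'m^'m" where "T = matrix (\<lambda>x. \<Sum>i\<in>UNIV. (complex_of_real (s i) * cip (e i) x) *s e i)"
  have "Vector_Spaces.linear (*s) (*s) (\<lambda>x. \<Sum>i\<in>UNIV. (complex_of_real (s i) * cip (e i) x) *s e i)"
    by unfold_locales (auto simp: cip_add_right cip_smult_right sum.distrib[symmetric] vec.scale_sum_right
        vec_eq_iff algebra_simps)
  then have T: "T *v x = (\<Sum>i\<in>UNIV. (complex_of_real (s i) * cip (e i) x) *s e i)" for x
    unfolding T_def by (rule matrix_works)
  have T2: "cip x (T *v y) = (\<Sum>i\<in>UNIV. s i * (cip x (e i) * cip (e i) y))" for x y
    by (simp add: T cip_sum_right cip_smult_right algebra_simps)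
  have Te: "T *v e i = complex_of_real (s i) *s e i" for i
  proof -
    have "T *v e i = (\<Sum>j\<in>UNIV. if j = i then complex_of_real (s i) *s e i else 0)"
      unfolding T using e by (intro sum.cong refl) (auto simp: orthonormal_def)
    then show ?thesis by simp
  qed
  have herm: "herm T"
    unfolding herm_iff_cip
  proof (intro allI)
    fix x y
    have "cip (T *v x) y = cnj (cip y (T *v x))" by (simp add: cnj_cip)
    also have "\<dots> = (\<Sum>i\<in>UNIV. s i * (cip x (e i) * cip (e i) y))"
      unfolding T2 cnj_sum complex_cnj_mult complex_cnj_complex_of_real cnj_cip by (simp only: mult_ac)
    finally show "cip x (T *v y) = cip (T *v x) y" by (simp only: T2)
  qed
  have psd: "psd T"
    unfolding psd_iff_cip
  proof
    fix z
    have "Re (cip z (T *v z)) = (\<Sum>i\<in>UNIV. s i * Re (cip z (e i) * cnj (cip z (e i))))"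
      unfolding T2 cnj_cip Re_sum by (intro sum.cong refl) simp
    also have "\<dots> \<ge> 0" by (intro sum_nonneg mult_nonneg_nonneg s) (simp add: complex_mult_cnj)
    finally show "0 \<le> Re (cip z (T *v z))" .
  qed
  have lin_eq: "B = C" if "\<And>i. B *v e i = C *v e i" for B C :: "complex^'m^'m"
  proof (rule matrix_eqI_cip)
    fix x
    show "B *v x = C *v x"
      by (subst (1 2) orthonormal_expand[OF e, of x]) (simp add: matvec_smult linear_sum[OF matrix_vector_mul_linear] that)
  qed
  have TT: "T ** T = A"
  proof (rule lin_eq)
    fix i show "(T ** T) *v e i = A *v e i"
      unfolding matrix_vector_mul_assoc[symmetric] by (simp add: Te matvec_smult A power2_eq_square)
  qed
  have "msqrt A = T" unfolding msqrt_def
  proof (rule the_equality)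
    fix S assume "herm S \<and> psd S \<and> S ** S = A"
    then show "S = T" using psd_sqrt_eigenvector[OF _ _ _ s A] Te by (intro lin_eq) auto
  qed (use herm psd TT in auto)
  then show ?thesis by (simp add: Te)
qed

text \<open>The eigenvalues are recorded as squares of \<open>s i\<close>, so that the trace of the
  3/2 power is a sum of cubes and the later inequalities are polynomial in
  \<open>s i\<close>.\<close>

lemma psd_spectral:
  fixes A :: "complex^'m::finite^'m"
  assumes "herm A" "psd A"
  obtains e :: "'m \<Rightarrow> complex^'m" and s :: "'m \<Rightarrow> real" where
    "orthonormal e UNIV" "\<And>i. 0 \<le> s i" "\<And>i. A *v e i = complex_of_real ((s i)\<^sup>2) *s e i"
    "tr32 A = (\<Sum>i\<in>UNIV. s i ^ 3)"
proof -
  obtain e :: "'m \<Rightarrow> complex^'m" and d where e: "orthonormal e UNIV" and d: "\<And>i. A *v e i = complex_of_real (d i) *s e i"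
    using spectral_theorem_herm[OF assms(1)] by metis
  have e1: "cip (e i) (e i) = 1" for i using e by (simp add: orthonormal_def)
  have d0: "d i \<ge> 0" for i
  proof -
    have "0 \<le> Re (cip (e i) (A *v e i))" using assms(2) psd_iff_cip by blast
    then show ?thesis using e1[of i] by (simp add: d cip_smult_right)
  qed
  define s where "s i = sqrt (d i)" for i
  have s: "0 \<le> s i" "A *v e i = complex_of_real ((s i)\<^sup>2) *s e i" for i using d0 d by (auto simp: s_def)
  have "tr32 A = (\<Sum>i\<in>UNIV. s i ^ 3)"
    unfolding tr32_def mtrace_onb[OF e] matrix_vector_mul_assoc[symmetric] msqrt_eigenvector[OF e s]
      matvec_smult s(2) cip_smult_right e1
    by (simp add: power2_eq_square power3_eq_cube mult.assoc)
  then show ?thesis using that e s by metis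
qed

lemma cip_psd_spectral:
  fixes e :: "'m \<Rightarrow> complex^'m::finite"
  assumes e: "orthonormal e UNIV" and A: "\<And>i. A *v e i = complex_of_real ((s i)\<^sup>2) *s e i"
  shows "cip x (A *v y) = (\<Sum>i\<in>UNIV. (s i)\<^sup>2 * (cip x (e i) * cip (e i) y))"
proof -
  have "A *v y = (\<Sum>i\<in>UNIV. cip (e i) y *s (A *v e i))"
    by (subst orthonormal_expand[OF e, of y]) (simp add: matvec_smult linear_sum[OF matrix_vector_mul_linear])
  then show ?thesis by (simp add: A cip_sum_right cip_smult_right algebra_simps)
qed

text \<open>Since s^2 <= 1 + s^3 for s >= 0, the trace of the 3/2 power controls the operator norm.
  This will make a measurable V with integrable \<open>tr32\<close> itself integrable.\<close>

lemma norm_matvec_le_tr32: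
  fixes A :: "complex^'m::finite^'m"
  assumes "herm A" "psd A"
  shows "norm (A *v x) \<le> (CARD('m) + tr32 A) * norm x" "0 \<le> tr32 A"
proof -
  obtain e s where es: "orthonormal e (UNIV::'m set)" "\<And>i. (0::real) \<le> s i" "\<And>i. A *v e i = complex_of_real ((s i)\<^sup>2) *s e i"
    "tr32 A = (\<Sum>i\<in>UNIV. s i ^ 3)" by (rule psd_spectral[OF assms]) blast
  have ne: "norm (e i) = 1" for i using orthonormal_norm[OF es(1)] by simp
  show "0 \<le> tr32 A" using es by (auto intro: sum_nonneg)
  have s2: "(s i)\<^sup>2 \<le> 1 + s i ^ 3" for i
  proof (cases "s i \<le> 1")
    case True then have "(s i)\<^sup>2 \<le> 1" using es(2) by (simp add: power_le_one)
    then show ?thesis using es(2)[of i] by (metis add.commute add_increasing zero_le_power)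
  next
    case False then have "(s i)^2 \<le> s i ^ 3" by (intro power_increasing) auto
    then show ?thesis by simp
  qed
  have "A *v x = (\<Sum>i\<in>UNIV. cip (e i) x *s (A *v e i))"
    by (subst orthonormal_expand[OF es(1), of x]) (simp add: matvec_smult linear_sum[OF matrix_vector_mul_linear])
  then have "norm (A *v x) \<le> (\<Sum>i\<in>UNIV. norm (cip (e i) x *s (A *v e i)))" by (metis norm_sum)
  also have "\<dots> \<le> (\<Sum>i\<in>UNIV. (1 + s i ^ 3) * norm x)"
  proof (rule sum_mono)
    fix i
    have "norm (cip (e i) x *s (A *v e i)) = (s i)\<^sup>2 * cmod (cip (e i) x)"
      by (simp add: es(3) norm_smult ne norm_power norm_mult)
    also have "\<dots> \<le> (1 + s i ^ 3) * norm x"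
      using norm_cip_le[of "e i" x] s2[of i] es(2)[of i] by (intro mult_mono) (auto simp: ne)
    finally show "norm (cip (e i) x *s (A *v e i)) \<le> (1 + s i ^ 3) * norm x" .
  qed
  also have "\<dots> = (CARD('m) + tr32 A) * norm x"
    by (simp add: es(4) sum_distrib_right[symmetric] sum.distrib)
  finally show "norm (A *v x) \<le> (CARD('m) + tr32 A) * norm x" .
qed

section \<open>Absolutely continuous functions\<close>

lemma AE_circ_negligible:
  assumes "AE x in lebesgue_on circ. P x"
  obtains N where "negligible N" "\<And>x. x \<in> circ \<Longrightarrow> x \<notin> N \<Longrightarrow> P x"
proof -
  have "AE x in lebesgue. x \<in> circ \<longrightarrow> P x"
    using assms by (subst (asm) AE_restrict_space_iff) auto
  then obtain N where "N \<in> null_sets lebesgue" "{x. \<not> (x \<in> circ \<longrightarrow> P x)} \<subseteq> N"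
    by (auto simp: eventually_ae_filter)
  then show ?thesis by (intro that[of N]) (auto simp: negligible_iff_null_sets)
qed

text \<open>On a partition so fine that \<open>G\<close> moves by at most epsilon in each cell, the
  increments of \<open>f\<close> sum to at most |C| epsilon (G b - G a), and epsilon is
  arbitrary.\<close>

lemma constant_of_quadratic_variation_bound:
  fixes f :: "real \<Rightarrow> 'a::real_normed_vector" and G :: "real \<Rightarrow> real"
  assumes ab: "a \<le> b" and cG: "continuous_on {a..b} G" and mG: "mono_on {a..b} G"
    and f: "\<And>x y. a \<le> x \<Longrightarrow> x \<le> y \<Longrightarrow> y \<le> b \<Longrightarrow> norm (f y - f x) \<le> C * (G y - G x)\<^sup>2"
  shows "f b = f a"
proof (rule ccontr)
  assume ne: "f b \<noteq> f a"
  \<comment> \<open>Both \<open>+ 1\<close> keep \<open>D\<close> positive. The epsilon chosen next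
    limits the summed increments to half of \<open>norm (f b - f a)\<close>.\<close>
  define D where "D = (\<bar>C\<bar> + 1) * (G b - G a + 1)"
  have Gab: "G a \<le> G b" using mG ab by (auto simp: mono_on_def)
  have D: "D > 0" using Gab by (auto simp: D_def intro!: mult_pos_pos)
  define \<epsilon> where "\<epsilon> = norm (f b - f a) / (2 * D)"
  have eps: "\<epsilon> > 0" using ne D by (simp add: \<epsilon>_def)
  obtain d where d: "d > 0" "\<And>x y. x \<in> {a..b} \<Longrightarrow> y \<in> {a..b} \<Longrightarrow> dist x y < d \<Longrightarrow> dist (G x) (G y) < \<epsilon>"
    using compact_uniformly_continuous[OF cG] eps unfolding uniformly_continuous_on_def
    by (metis compact_Icc dist_commute)
  obtain n where n: "(b - a) / d < real n" using reals_Archimedean2 by blast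
  have n0: "n > 0" using n ab d(1) by (metis divide_nonneg_pos diff_ge_0_iff_ge gr0I leD of_nat_0)
  define t where "t k = a + (b - a) * real k / real n" for k
  have t: "t 0 = a" "t n = b" "a \<le> t k" "t k \<le> t (Suc k)" for k
    using n0 ab by (auto simp: t_def divide_right_mono mult_left_mono)
  have tb: "t k \<le> b" if "k \<le> n" for k
  proof -
    have "real k / real n \<le> 1" using that n0 by simp
    then have "(b - a) * (real k / real n) \<le> b - a" using ab by (intro mult_left_le) auto
    then show ?thesis by (simp add: t_def)
  qed
  have step: "norm (f (t (Suc k)) - f (t k)) \<le> (\<bar>C\<bar> * \<epsilon>) * (G (t (Suc k)) - G (t k))" if "k < n" for k
  proof -
    have "t (Suc k) - t k = (b - a) / real n" using n0 by (simp add: t_def field_simps)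
    moreover have "(b - a) / real n < d" using n n0 d(1) by (simp add: field_simps)
    ultimately have "dist (t k) (t (Suc k)) < d" using t(4)[of k] by (simp add: dist_real_def)
    then have "dist (G (t k)) (G (t (Suc k))) < \<epsilon>" using that tb t by (intro d(2)) (auto simp: Suc_le_eq intro: less_imp_le)
    moreover have G: "G (t k) \<le> G (t (Suc k))" using that tb t mG
      by (auto simp: mono_on_def Suc_le_eq intro: less_imp_le)
    ultimately have le: "G (t (Suc k)) - G (t k) \<le> \<epsilon>" by (simp add: dist_real_def)
    have "norm (f (t (Suc k)) - f (t k)) \<le> C * (G (t (Suc k)) - G (t k))\<^sup>2"
      using that tb t by (intro f) auto
    also have "\<dots> \<le> \<bar>C\<bar> * ((G (t (Suc k)) - G (t k)) * (G (t (Suc k)) - G (t k)))"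
      by (simp add: power2_eq_square mult_right_mono)
    also have "\<dots> \<le> \<bar>C\<bar> * (\<epsilon> * (G (t (Suc k)) - G (t k)))"
      using G le by (intro mult_left_mono mult_right_mono) auto
    finally show ?thesis by (simp add: mult.assoc)
  qed
  have "norm (f (t m) - f (t 0)) \<le> (\<bar>C\<bar> * \<epsilon>) * (G (t m) - G (t 0))" if "m \<le> n" for m
    using that
  proof (induction m)
    case (Suc m)
    have "norm (f (t (Suc m)) - f (t 0)) \<le> norm (f (t (Suc m)) - f (t m)) + norm (f (t m) - f (t 0))"
      by (metis diff_add_cancel add_diff_eq norm_triangle_ineq)
    also have "\<dots> \<le> (\<bar>C\<bar> * \<epsilon>) * (G (t (Suc m)) - G (t m)) + (\<bar>C\<bar> * \<epsilon>) * (G (t m) - G (t 0))"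
      using Suc step by (intro add_mono) auto
    finally show ?case by (simp add: algebra_simps)
  qed auto
  from this[of n] have "norm (f b - f a) \<le> (\<bar>C\<bar> * \<epsilon>) * (G b - G a)" using t by simp
  also have "\<dots> = \<epsilon> * (\<bar>C\<bar> * (G b - G a))" by simp
  also have "\<dots> \<le> \<epsilon> * D" unfolding D_def using eps Gab by (intro mult_left_mono mult_mono) auto
  also have "\<dots> = norm (f b - f a) / 2" using D by (simp add: \<epsilon>_def)
  finally show False using ne by simp
qed

lemma absint_Icc_sub:
  fixes f :: "real \<Rightarrow> 'a::euclidean_space"
  assumes "f absolutely_integrable_on {a..b}" "a \<le> x" "y \<le> b"
  shows "f absolutely_integrable_on {x..y}" "f integrable_on {x..y}"
proof -
  show "f absolutely_integrable_on {x..y}"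
    using assms by (intro absolutely_integrable_on_subinterval[OF assms(1)]) auto
  then show "f integrable_on {x..y}" using absolutely_integrable_on_def by blast
qed

lemma ac_derivD:
  assumes "ac_deriv u u'"
  shows "x \<in> circ \<Longrightarrow> u x = u 0 + integral {0..x} u'" "u' absolutely_integrable_on circ"
  using assms unfolding ac_deriv_def by blast+

lemma ac_deriv_diff:
  assumes "ac_deriv u u'" "0 \<le> x" "x \<le> y" "y \<le> 2*pi"
  shows "u y - u x = integral {x..y} u'"
proof -
  have "u' integrable_on {0..y}" using assms absint_Icc_sub(2)[where f = u' and a = 0 and b = "2*pi" and x = 0 and y = y] by (simp add: ac_deriv_def)
  then have "integral {0..x} u' + integral {x..y} u' = integral {0..y} u'"
    using assms by (intro Henstock_Kurzweil_Integration.integral_combine) auto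
  moreover have "u x = u 0 + integral {0..x} u'" "u y = u 0 + integral {0..y} u'"
    using assms by (auto intro!: ac_derivD)
  ultimately show ?thesis by (metis add_diff_cancel_left add_diff_cancel_left')
qed

lemma ac_deriv_continuous:
  assumes "ac_deriv u u'"
  shows "continuous_on circ u"
proof -
  have "u' integrable_on circ" using assms by (auto simp: ac_deriv_def absolutely_integrable_on_def)
  then have "continuous_on circ (\<lambda>x. u 0 + integral {0..x} u')"
    by (intro continuous_intros indefinite_integral_continuous_1)
  moreover have "continuous_on circ u \<longleftrightarrow> continuous_on circ (\<lambda>x. u 0 + integral {0..x} u')"
    by (rule continuous_on_cong[OF refl ac_derivD(1)[OF assms]])
  ultimately show ?thesis by simp
qed

lemma continuous_circ_bounded:
  fixes u :: "real \<Rightarrow> 'a::real_normed_vector"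
  assumes "continuous_on circ u"
  obtains B where "B > 0" "\<And>x. x \<in> circ \<Longrightarrow> norm (u x) \<le> B"
proof -
  have "bounded (u ` circ)" by (intro compact_imp_bounded compact_continuous_image assms) auto
  then obtain B where "B > 0" "\<forall>y\<in>u ` circ. norm y \<le> B" unfolding bounded_pos by blast
  then show ?thesis using that by blast
qed

lemma absint_bilinear_continuous:
  fixes h :: "'a::euclidean_space \<Rightarrow> 'b::euclidean_space \<Rightarrow> 'c::euclidean_space"
  assumes h: "bounded_bilinear h" and f: "f absolutely_integrable_on circ" and g: "continuous_on circ g"
  shows "(\<lambda>x. h (f x) (g x)) absolutely_integrable_on circ"
    "(\<lambda>x. h (f x) (g x)) integrable_on circ"
proof -
  interpret bounded_bilinear h by fact
  show *: "(\<lambda>x. h (f x) (g x)) absolutely_integrable_on circ"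
  proof -
    define flip where "flip = (\<lambda>y x. h x y)"
    have "(\<lambda>x. flip (g x) (f x)) absolutely_integrable_on circ"
    proof (rule absolutely_integrable_bounded_measurable_product[where h = flip and f = g and g = f])
    show "bilinear flip" using bounded_bilinear.flip[OF h] flip_def
      by (simp add: bilinear_conv_bounded_bilinear)
    show "g \<in> borel_measurable (lebesgue_on circ)"
      using g by (intro continuous_imp_measurable_on_sets_lebesgue) auto
    show "bounded (g ` circ)" by (intro compact_imp_bounded compact_continuous_image g) auto
  qed (use f in auto)
    then show ?thesis by (simp add: flip_def)
  qed
  then show "(\<lambda>x. h (f x) (g x)) integrable_on circ" using absolutely_integrable_on_def by blast
qed

lemma norm_integral_le_const:
  fixes f :: "real \<Rightarrow> 'a::euclidean_space"
  assumes "f integrable_on S" "g integrable_on S" "\<And>x. x \<in> S \<Longrightarrow> norm (f x) \<le> C * g x"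
  shows "norm (integral S f) \<le> C * integral S g"
proof -
  have "norm (integral S f) \<le> integral S (\<lambda>x. C * g x)"
    using assms by (intro integral_norm_bound_integral integrable_on_mult_right) auto
  then show ?thesis by simp
qed

text \<open>Subtracting the primitive of \<open>u'\<close> from \<open>u\<close> leaves a function
  whose increments are quadratic in those of the primitive of \<open>g\<close>, hence a constant.
  The product and exponential rules below verify this error bound in place of differentiating almost
  everywhere.\<close>

lemma ac_derivI_local:
  fixes u :: "real \<Rightarrow> 'a::euclidean_space" and g :: "real \<Rightarrow> real"
  assumes u': "u' absolutely_integrable_on circ" and g: "g absolutely_integrable_on circ" "\<And>x. x \<in> circ \<Longrightarrow> 0 \<le> g x"
    and bd: "\<And>x y. 0 \<le> x \<Longrightarrow> x \<le> y \<Longrightarrow> y \<le> 2*pi \<Longrightarrow>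
           norm (u y - u x - integral {x..y} u') \<le> C * (integral {x..y} g)\<^sup>2"
  shows "ac_deriv u u'"
  unfolding ac_deriv_def
proof (intro conjI ballI u')
  fix z assume z: "z \<in> circ"
  define G where "G x = integral {0..x} g" for x
  define f where "f x = u x - integral {0..x} u'" for x
  have comb: "integral {0..x} v + integral {x..y} v = integral {0..y} v"
    if "v absolutely_integrable_on circ" "0 \<le> x" "x \<le> y" "y \<le> 2*pi" for v :: "real \<Rightarrow> 'b::euclidean_space" and x y
    using that absint_Icc_sub(2)[OF that(1), of 0 y] by (intro Henstock_Kurzweil_Integration.integral_combine) auto
  have "f z = f 0"
  proof (rule constant_of_quadratic_variation_bound)
    have "g integrable_on {0..z}" using absint_Icc_sub[OF g(1), of 0 z] z by auto
    then show "continuous_on {0..z} G" unfolding G_def by (rule indefinite_integral_continuous_1)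
    show "mono_on {0..z} G"
    proof (rule mono_onI)
      fix r s assume "r \<in> {0..z}" "s \<in> {0..z}" "r \<le> s"
      then show "G r \<le> G s"
        unfolding G_def using z g absint_Icc_sub[OF g(1)] by (intro integral_subset_le) auto
    qed
    show "norm (f y - f x) \<le> C * (G y - G x)\<^sup>2" if "0 \<le> x" "x \<le> y" "y \<le> z" for x y
    proof -
      have "f y - f x = u y - u x - integral {x..y} u'"
        using comb[OF u', of x y] that z by (simp add: f_def algebra_simps)
      moreover have "G y - G x = integral {x..y} g"
        using comb[OF g(1), of x y] that z by (simp add: G_def algebra_simps)
      ultimately show ?thesis using bd[of x y] that z by simp
    qed
  qed (use z in auto)
  then show "u z = u 0 + integral {0..z} u'" by (simp add: f_def algebra_simps)
qed

section \<open>Product, exponential and linear rules for absolutely continuous functions\<close>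

lemma ac_deriv_osc:
  fixes u u' :: "real \<Rightarrow> 'a::euclidean_space" and g :: "real \<Rightarrow> real"
  assumes u: "ac_deriv u u'" and g: "g integrable_on circ" "\<And>x. x \<in> circ \<Longrightarrow> norm (u' x) \<le> g x"
    and xy: "0 \<le> x" "x \<le> s" "s \<le> t" "t \<le> y" "y \<le> 2*pi"
  shows "norm (u t - u s) \<le> integral {x..y} g"
proof -
  have gi: "g integrable_on {p..q}" if "0 \<le> p" "q \<le> 2*pi" for p q
    using g(1) that by (intro integrable_on_subinterval[OF g(1)]) auto
  have "u' absolutely_integrable_on circ" using u by (simp add: ac_deriv_def)
  then have "u' integrable_on {s..t}" using absint_Icc_sub(2) xy by force
  then have "norm (u t - u s) \<le> integral {s..t} g"
    unfolding ac_deriv_diff[OF u order_trans[OF xy(1,2)] xy(3) order_trans[OF xy(4,5)]]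
    using xy g gi by (intro integral_norm_bound_integral) auto
  also have "\<dots> \<le> integral {x..y} g"
  proof (intro integral_subset_le)
    show "\<forall>r\<in>{x..y}. 0 \<le> g r"
    proof
      fix r assume "r \<in> {x..y}"
      then have "norm (u' r) \<le> g r" using xy by (intro g) auto
      then show "0 \<le> g r" by (rule order_trans[OF norm_ge_zero])
    qed
  qed (use xy gi in auto)
  finally show ?thesis .
qed

text \<open>With \<open>w\<close> frozen at the right end and \<open>u\<close> at the left end, the
  increment of \<open>h (u x) (w x)\<close> is exactly an integral. Unfreezing costs a derivative
  times the oscillation of the other factor; the oscillations are at most the integral
  \<open>I\<close> of \<open>g\<close>, so the error is at most K I^2.\<close>

lemma ac_deriv_bilinear:
  fixes h :: "'a::euclidean_space \<Rightarrow> 'b::euclidean_space \<Rightarrow> 'c::euclidean_space"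
  assumes h: "bounded_bilinear h" and u: "ac_deriv u u'" and w: "ac_deriv w w'"
  shows "ac_deriv (\<lambda>x. h (u x) (w x)) (\<lambda>x. h (u' x) (w x) + h (u x) (w' x))"
proof -
  interpret h: bounded_bilinear h by fact
  obtain K where K: "K > 0" "\<And>a b. norm (h a b) \<le> norm a * norm b * K" using h.pos_bounded by blast
  have u'i: "u' absolutely_integrable_on circ" and w'i: "w' absolutely_integrable_on circ"
    using u w by (auto simp: ac_deriv_def)
  note cu = ac_deriv_continuous[OF u] and cw = ac_deriv_continuous[OF w]
  define g where "g x = norm (u' x) + norm (w' x)" for x
  have gi: "g absolutely_integrable_on circ" unfolding g_def
    by (intro set_integral_add absolutely_integrable_norm[unfolded o_def] u'i w'i)
  then have gi': "g integrable_on circ" using absolutely_integrable_on_def by blast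
  note i1 = absint_bilinear_continuous[OF h u'i cw]
    and i2 = absint_bilinear_continuous[OF h.flip w'i cu]
  show ?thesis
  proof (rule ac_derivI_local)
    show "(\<lambda>x. h (u' x) (w x) + h (u x) (w' x)) absolutely_integrable_on circ"
      using i1(1) i2(1) by (rule set_integral_add)
    show "g absolutely_integrable_on circ" "\<And>x. 0 \<le> g x" by (auto simp: gi g_def)
    fix x y :: real assume xy: "0 \<le> x" "x \<le> y" "y \<le> 2*pi"
    define I where "I = integral {x..y} g"
    have sub: "{x..y} \<subseteq> circ" using xy by auto
    have gxy: "g integrable_on {x..y}" using gi' xy by (intro integrable_on_subinterval[OF gi']) auto
    have I0: "0 \<le> I" unfolding I_def by (intro integral_nonneg gxy) (auto simp: g_def)
    have u'xy: "u' integrable_on {x..y}" and w'xy: "w' integrable_on {x..y}"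
      using absint_Icc_sub(2)[OF u'i] absint_Icc_sub(2)[OF w'i] xy by auto
    have osc: "norm (u t - u x) \<le> I" "norm (w y - w t) \<le> I" if "t \<in> {x..y}" for t
      using that xy gi' unfolding I_def by (auto intro!: ac_deriv_osc[OF u] ac_deriv_osc[OF w] simp: g_def[abs_def] simp del: I_def)
    have i3: "(\<lambda>t. h (u' t) (w t)) integrable_on {x..y}" "(\<lambda>t. h (u t) (w' t)) integrable_on {x..y}"
      using i1(1) i2(1) xy by (auto intro: absint_Icc_sub(2))
    have i4: "(\<lambda>t. h (u' t) (w y)) integrable_on {x..y}" "(\<lambda>t. h (u x) (w' t)) integrable_on {x..y}"
      using integrable_linear[OF u'xy h.bounded_linear_left[of "w y"]] integrable_linear[OF w'xy h.bounded_linear_right[of "u x"]]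
      by (simp_all add: o_def)
    have e1: "h (u y - u x) (w y) = integral {x..y} (\<lambda>t. h (u' t) (w y))"
      using integral_linear[OF u'xy h.bounded_linear_left[of "w y"]] ac_deriv_diff[OF u xy] by (simp add: o_def)
    have e2: "h (u x) (w y - w x) = integral {x..y} (\<lambda>t. h (u x) (w' t))"
      using integral_linear[OF w'xy h.bounded_linear_right[of "u x"]] ac_deriv_diff[OF w xy] by (simp add: o_def)
    have "h (u y) (w y) - h (u x) (w x) = h (u y - u x) (w y) + h (u x) (w y - w x)"
      by (simp add: h.diff_left h.diff_right)
    also have "\<dots> - integral {x..y} (\<lambda>t. h (u' t) (w t) + h (u t) (w' t)) =
       (integral {x..y} (\<lambda>t. h (u' t) (w y)) - integral {x..y} (\<lambda>t. h (u' t) (w t)))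
       + (integral {x..y} (\<lambda>t. h (u x) (w' t)) - integral {x..y} (\<lambda>t. h (u t) (w' t)))"
      unfolding e1 e2 integral_add[OF i3] by simp
    also have "\<dots> = integral {x..y} (\<lambda>t. h (u' t) (w y) - h (u' t) (w t)) + integral {x..y} (\<lambda>t. h (u x) (w' t) - h (u t) (w' t))"
      using i3 i4 by (simp add: integral_diff)
    also have "\<dots> = integral {x..y} (\<lambda>t. (h (u' t) (w y) - h (u' t) (w t)) + (h (u x) (w' t) - h (u t) (w' t)))"
      using i3 i4 by (intro integral_add[symmetric] integrable_diff)
    also have "norm \<dots> \<le> (K * I) * integral {x..y} g"
    proof (rule norm_integral_le_const[OF _ gxy])
      show "(\<lambda>t. (h (u' t) (w y) - h (u' t) (w t)) + (h (u x) (w' t) - h (u t) (w' t))) integrable_on {x..y}"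
        using i3 i4 by (intro integrable_add integrable_diff)
      fix t assume t: "t \<in> {x..y}"
      have "norm ((h (u' t) (w y) - h (u' t) (w t)) + (h (u x) (w' t) - h (u t) (w' t)))
         = norm (h (u' t) (w y - w t) - h (u t - u x) (w' t))"
        by (simp add: h.diff_left h.diff_right algebra_simps)
      also have "\<dots> \<le> norm (u' t) * norm (w y - w t) * K + norm (u t - u x) * norm (w' t) * K"
        by (intro order_trans[OF norm_triangle_ineq4] add_mono K)
      also have "\<dots> \<le> norm (u' t) * I * K + I * norm (w' t) * K"
        using osc[OF t] K(1) by (intro add_mono mult_right_mono mult_left_mono) auto
      also have "\<dots> = (K * I) * g t" by (simp add: g_def algebra_simps)
      finally show "norm ((h (u' t) (w y) - h (u' t) (w t)) + (h (u x) (w' t) - h (u t) (w' t))) \<le> (K * I) * g t" .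
    qed
    finally show "norm (h (u y) (w y) - h (u x) (w x) - integral {x..y} (\<lambda>x. h (u' x) (w x) + h (u x) (w' x)))
       \<le> K * (integral {x..y} g)\<^sup>2"
      by (simp add: I_def power2_eq_square)
  qed
qed

text \<open>The mean value inequality is used twice: for \<open>exp\<close> on the ball, then for
  \<open>exp z - exp a * z\<close> on the segment, whose derivative \<open>exp z - exp a\<close> is
  small by the first bound.\<close>

lemma exp_quadratic_remainder:
  fixes a b :: complex
  assumes "norm a \<le> B" "norm b \<le> B"
  shows "norm (exp b - exp a) \<le> exp B * norm (b - a)"
    "norm (exp b - exp a - exp a * (b - a)) \<le> exp B * (norm (b - a))\<^sup>2"
proof -
  have bd: "norm (exp z) \<le> exp B" if "z \<in> cball 0 B" for z :: complex
    using that norm_exp[of z] by (smt (verit) dist_0_norm mem_cball exp_le_cancel_iff)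
  have lip: "norm (exp y - exp x) \<le> exp B * norm (y - x)" if "x \<in> cball 0 B" "y \<in> cball 0 B" for x y :: complex
  proof (rule field_differentiable_bound[of "cball 0 B"])
    show "(exp has_field_derivative exp z) (at z within cball 0 B)" for z :: complex
      by (auto intro: derivative_eq_intros)
  qed (use that bd in auto)
  show "norm (exp b - exp a) \<le> exp B * norm (b - a)" using lip assms by (auto simp: dist_norm)
  define S where "S = closed_segment a b"
  have S: "S \<subseteq> cball 0 B" unfolding S_def using assms by (intro closed_segment_subset) auto
  have "norm ((exp b - exp a * b) - (exp a - exp a * a)) \<le> (exp B * norm (b - a)) * norm (b - a)"
  proof (rule field_differentiable_bound[of S "\<lambda>z. exp z - exp a * z"])
    show "((\<lambda>z. exp z - exp a * z) has_field_derivative exp z - exp a) (at z within S)" for z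
      by (auto intro!: derivative_eq_intros)
    show "norm (exp z - exp a) \<le> exp B * norm (b - a)" if "z \<in> S" for z
    proof -
      have "norm (z - a) \<le> norm (b - a)" using that unfolding S_def
        by (metis segment_bound(1) norm_minus_commute)
      moreover have "norm (exp z - exp a) \<le> exp B * norm (z - a)" using lip S that assms by auto
      ultimately show ?thesis by (meson exp_ge_zero mult_left_mono order_trans)
    qed
  qed (auto simp: S_def)
  then show "norm (exp b - exp a - exp a * (b - a)) \<le> exp B * (norm (b - a))\<^sup>2"
    by (simp add: algebra_simps power2_eq_square)
qed

text \<open>Two errors are quadratic in the integral of \<open>norm (h' x)\<close>: the Taylor
  remainder of \<open>exp\<close>, and the cost of freezing \<open>exp (h t)\<close> at the left
  end. Together they give the constant \<open>2 * exp B\<close>.\<close>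

lemma ac_deriv_exp:
  fixes h h' :: "real \<Rightarrow> complex"
  assumes h: "ac_deriv h h'"
  shows "ac_deriv (\<lambda>x. exp (h x)) (\<lambda>x. h' x * exp (h x))"
proof -
  note ch = ac_deriv_continuous[OF h]
  obtain B where B: "B > 0" "\<And>x. x \<in> circ \<Longrightarrow> norm (h x) \<le> B" using continuous_circ_bounded[OF ch] by blast
  have h'i: "h' absolutely_integrable_on circ" using h by (simp add: ac_deriv_def)
  have i1: "(\<lambda>x. h' x * exp (h x)) absolutely_integrable_on circ"
    by (rule absint_bilinear_continuous[OF bounded_bilinear_mult h'i]) (intro continuous_intros ch)
  have gi: "(\<lambda>x. norm (h' x)) absolutely_integrable_on circ"
    by (intro absolutely_integrable_norm[unfolded o_def] h'i)
  show ?thesis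
  proof (rule ac_derivI_local[OF i1 gi, where C = "2 * exp B"])
    fix x y :: real assume xy: "0 \<le> x" "x \<le> y" "y \<le> 2*pi"
    define I where "I = integral {x..y} (\<lambda>x. norm (h' x))"
    have gi': "(\<lambda>x. norm (h' x)) integrable_on circ" using gi absolutely_integrable_on_def by blast
    have gxy: "(\<lambda>x. norm (h' x)) integrable_on {x..y}" using xy by (intro integrable_on_subinterval[OF gi']) auto
    have I0: "0 \<le> I" unfolding I_def by (intro integral_nonneg gxy) auto
    have osc: "norm (h t - h x) \<le> I" if "t \<in> {x..y}" for t
      unfolding I_def using that xy gi' by (intro ac_deriv_osc[OF h]) auto
    have h'xy: "h' integrable_on {x..y}" using absint_Icc_sub(2)[OF h'i] xy by auto
    have i2: "(\<lambda>t. h' t * exp (h t)) integrable_on {x..y}" using i1 xy by (auto intro: absint_Icc_sub(2))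
    have i3: "(\<lambda>t. exp (h x) * h' t) integrable_on {x..y}" using h'xy by (intro integrable_on_mult_right)
    have e: "exp (h x) * (h y - h x) = integral {x..y} (\<lambda>t. exp (h x) * h' t)"
      using ac_deriv_diff[OF h xy] by simp
    have "norm (exp (h y) - exp (h x) - integral {x..y} (\<lambda>x. h' x * exp (h x)))
      = norm ((exp (h y) - exp (h x) - exp (h x) * (h y - h x)) + integral {x..y} (\<lambda>t. exp (h x) * h' t - h' t * exp (h t)))"
      unfolding integral_diff[OF i3 i2] e[symmetric] by (intro arg_cong[where f=norm]) (simp only: algebra_simps)
    also have "\<dots> \<le> exp B * (norm (h y - h x))\<^sup>2 + (exp B * I) * integral {x..y} (\<lambda>x. norm (h' x))"
    proof (intro order_trans[OF norm_triangle_ineq] add_mono exp_quadratic_remainder norm_integral_le_const gxy integrable_diff i2 i3)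
      fix t assume t: "t \<in> {x..y}"
      have "norm (exp (h x) * h' t - h' t * exp (h t)) = norm (exp (h t) - exp (h x)) * norm (h' t)"
        by (metis mult.commute norm_minus_commute norm_mult right_diff_distrib)
      also have "\<dots> \<le> (exp B * norm (h t - h x)) * norm (h' t)"
        using B t xy by (intro mult_right_mono exp_quadratic_remainder) auto
      also have "\<dots> \<le> exp B * I * norm (h' t)"
        using osc[OF t] by (intro mult_right_mono mult_left_mono) auto
      finally show "norm (exp (h x) * h' t - h' t * exp (h t)) \<le> exp B * I * norm (h' t)" .
    qed (use B xy in auto)
    also have "\<dots> \<le> exp B * I\<^sup>2 + exp B * I * I"
      unfolding I_def[symmetric] using osc[of y] xy I0 by (intro add_mono mult_left_mono power_mono) auto
    finally show "norm (exp (h y) - exp (h x) - integral {x..y} (\<lambda>x. h' x * exp (h x))) \<le> 2 * exp B * (integral {x..y} (\<lambda>x. norm (h' x)))\<^sup>2"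
      by (simp add: I_def power2_eq_square)
  qed auto
qed

lemma ac_deriv_cong_AE:
  assumes "ac_deriv u u'" "negligible N" "\<And>x. x \<in> circ \<Longrightarrow> x \<notin> N \<Longrightarrow> v' x = u' x"
    "\<And>x. x \<in> circ \<Longrightarrow> v x = u x"
  shows "ac_deriv v v'"
  unfolding ac_deriv_def
proof (intro conjI ballI)
  show "v' absolutely_integrable_on circ"
    using assms(2,3) by (intro absolutely_integrable_spike[OF ac_derivD(2)[OF assms(1)]]) auto
  fix x assume x: "x \<in> circ"
  have "v x = u x" "v 0 = u 0" using assms(4) x by auto
  moreover have "integral {0..x} u' = integral {0..x} v'"
    using assms(2,3) x by (intro integral_spike[of N]) auto
  ultimately show "v x = v 0 + integral {0..x} v'" using ac_derivD(1)[OF assms(1) x] by simp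
qed

lemma ac_deriv_linear:
  fixes h :: "'a::euclidean_space \<Rightarrow> 'b::euclidean_space"
  assumes h: "bounded_linear h" and u: "ac_deriv u u'"
  shows "ac_deriv (\<lambda>x. h (u x)) (\<lambda>x. h (u' x))"
proof -
  interpret bounded_linear h by fact
  have i: "u' absolutely_integrable_on circ" using u by (simp add: ac_deriv_def)
  have "integral {0..x} (\<lambda>x. h (u' x)) = h (integral {0..x} u')" if "x \<in> circ" for x
    using integral_linear[OF absint_Icc_sub(2)[OF i, of 0 x] h] that by (auto simp: o_def)
  then show ?thesis
    unfolding ac_deriv_def using absolutely_integrable_linear[OF i h, unfolded o_def] ac_derivD(1)[OF u]
    by (metis add comp_def)
qed

lemma ac_deriv_add:
  assumes u: "ac_deriv u u'" and v: "ac_deriv v v'"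
  shows "ac_deriv (\<lambda>x. u x + v x) (\<lambda>x. u' x + v' x)"
proof -
  have i: "u' absolutely_integrable_on circ" "v' absolutely_integrable_on circ" using u v by (auto simp: ac_deriv_def)
  have "integral {0..x} (\<lambda>x. u' x + v' x) = integral {0..x} u' + integral {0..x} v'" if "x \<in> circ" for x
    using that absint_Icc_sub(2)[OF i(1), of 0 x] absint_Icc_sub(2)[OF i(2), of 0 x] by (intro integral_add) auto
  then have "u x + v x = u 0 + v 0 + integral {0..x} (\<lambda>x. u' x + v' x)" if "x \<in> circ" for x
    using ac_derivD(1)[OF u that] ac_derivD(1)[OF v that] that by (simp only: ac_simps)
  then show ?thesis unfolding ac_deriv_def using set_integral_add(1)[OF i] by blast
qed

lemma ac_deriv_const: "ac_deriv (\<lambda>x. c) (\<lambda>x. 0)"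
  by (simp add: ac_deriv_def)

lemma ac_deriv_antideriv:
  assumes "f absolutely_integrable_on circ"
  shows "ac_deriv (\<lambda>x. integral {0..x} f) f"
  using assms by (simp add: ac_deriv_def)

lemma ac_deriv_integral: "ac_deriv u u' \<Longrightarrow> integral circ u' = u (2*pi) - u 0"
  using ac_deriv_diff[of u u' 0 "2*pi"] by simp

section \<open>The interpolation inequality\<close>

lemma bounded_bilinear_smult: "bounded_bilinear ((*s) :: complex \<Rightarrow> complex^'m::finite \<Rightarrow> complex^'m)"
proof
  show "\<exists>K. \<forall>a b. norm (a *s b :: complex^'m) \<le> norm a * norm b * K"
    by (intro exI[of _ 1]) (simp add: norm_smult)
qed (auto simp: vec_eq_iff algebra_simps)

lemma bounded_bilinear_matvec: "bounded_bilinear ((*v) :: complex^'m::finite^'m \<Rightarrow> complex^'m \<Rightarrow> complex^'m)"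
proof -
  have "bilinear ((*v) :: complex^'m^'m \<Rightarrow> complex^'m \<Rightarrow> complex^'m)"
    unfolding bilinear_def
  proof (intro conjI allI)
    fix x :: "complex^'m^'m" show "linear ((*v) x)" by (rule matrix_vector_mul_linear)
  next
    fix y :: "complex^'m" show "linear (\<lambda>x :: complex^'m^'m. x *v y)"
      by (rule linearI) (auto simp: matrix_vector_mult_def vec_eq_iff sum.distrib scaleR_sum_right algebra_simps)
  qed
  then show ?thesis by (simp add: bilinear_conv_bounded_bilinear)
qed

text \<open>The pair (u, w) encodes w = (i d/dx - a) u in the first-order form
  u' = -i (w + a u).\<close>
definition mag_pair :: "(real \<Rightarrow> real) \<Rightarrow> (real \<Rightarrow> complex^'m::finite) \<Rightarrow> (real \<Rightarrow> complex^'m) \<Rightarrow> bool" where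
  "mag_pair a u w \<longleftrightarrow> ac_deriv u (\<lambda>x. (- \<i>) *s (w x + a x *\<^sub>R u x)) \<and> u 0 = u (2*pi) \<and> continuous_on circ w"

abbreviation sqnorm :: "(real \<Rightarrow> complex^'m::finite) \<Rightarrow> real" where
  "sqnorm u \<equiv> integral circ (\<lambda>x. (norm (u x))\<^sup>2)"

text \<open>The minimising s is sqrt (Q / R), but \<open>s = N / R\<close> leads to the same
  conclusion without a root.\<close>

lemma amgm_optimise:
  fixes N R Q :: real
  assumes "0 \<le> N" "0 \<le> R" "0 \<le> Q" and le: "\<And>s. s > 0 \<Longrightarrow> N \<le> s / 2 * R + Q / (2 * s)"
  shows "N\<^sup>2 \<le> R * Q"
proof (cases "N = 0")
  case False
  then have N: "N > 0" using assms by simp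
  show ?thesis
  proof (cases "R = 0")
    case True
    \<comment> \<open>For R = 0 the bound decreases in s, and this s is large enough to give N <= N
      / 2, impossible for N > 0.\<close>
    have "N \<le> Q / (2 * ((Q + 1) / N))" using le[of "(Q + 1) / N"] N assms True by simp
    also have "\<dots> = (Q / (Q + 1)) * (N / 2)" by simp
    also have "\<dots> \<le> 1 * (N / 2)" using N assms by (intro mult_right_mono) auto
    finally show ?thesis using N by simp
  next
    case False
    then have R: "R > 0" using assms by simp
    have "N \<le> N / 2 + Q * R / (2 * N)" using le[of "N / R"] N R by simp
    then have "N * (2 * N) \<le> (N / 2 + Q * R / (2 * N)) * (2 * N)" using N by (intro mult_right_mono) auto
    also have "\<dots> = N * N + Q * R" using N by (simp add: distrib_right)
    finally show ?thesis by (simp add: power2_eq_square mult.commute)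
  qed
qed (use assms in auto)

text \<open>If the cosine is at most 0, the factor on the right is already at least y^2 + 1.
  Otherwise the claim multiplied by |sin| is a quadratic inequality in y with discriminant 0, so
  that 1 / |sin| is the least possible constant.\<close>

lemma Kconst_bound:
  assumes al: "\<alpha> \<notin> \<int>" and that: "(y::real) > 0"
  shows "0 < Kconst \<alpha>" "y\<^sup>2 - 1 \<le> Kconst \<alpha> * (y\<^sup>2 - 2 * cos (2*pi*\<alpha>) * y + 1)"
proof -
  define c where "c = cos (2*pi*\<alpha>)"
  define \<sigma> where "\<sigma> = \<bar>sin (2*pi*\<alpha>)\<bar>"
  have cs: "c\<^sup>2 + \<sigma>\<^sup>2 = 1" by (simp add: c_def \<sigma>_def)
  have "0 < Kconst \<alpha> \<and> y\<^sup>2 - 1 \<le> Kconst \<alpha> * (y\<^sup>2 - 2 * c * y + 1)"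
  proof (cases "frac \<alpha> \<in> {1/4..3/4}")
    case True
    \<comment> \<open>Shifting by half a turn moves the angle into [-pi/2, pi/2] and flips the sign
      of the cosine.\<close>
    define \<theta> where "\<theta> = 2*pi*frac \<alpha> - pi"
    have "2*pi*\<alpha> = \<theta> + pi + 2*pi * of_int \<lfloor>\<alpha>\<rfloor>" by (simp add: \<theta>_def frac_def algebra_simps)
    then have "c = cos (\<theta> + pi)"
      unfolding c_def by (metis cos_add cos_int_2pin sin_int_2pin mult.right_neutral mult_zero_right diff_zero)
    then have "c = - cos \<theta>" by simp
    moreover have "- (pi/2) \<le> \<theta>" "\<theta> \<le> pi/2"
    proof -
      have "pi/2 * 1 \<le> pi/2 * (4 * frac \<alpha>)" "pi/2 * (4 * frac \<alpha>) \<le> pi/2 * 3"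
        using True by (auto intro!: mult_left_mono)
      then show "- (pi/2) \<le> \<theta>" "\<theta> \<le> pi/2" unfolding \<theta>_def by linarith+
    qed
    then have "cos \<theta> \<ge> 0" by (intro cos_ge_zero) auto
    ultimately have "c \<le> 0" by simp
    then have "c * y \<le> 0" using that by (simp add: mult_nonpos_nonneg)
    then show ?thesis using True by (simp add: Kconst_def)
  next
    case False
    \<comment> \<open>A zero of the sine makes 2 alpha an integer. But alpha is not an integer, and
      fractional part 1/2 belongs to the other case.\<close>
    have s0: "\<sigma> > 0"
    proof (rule ccontr)
      assume "\<not> \<sigma> > 0"
      then have "sin (2*pi*\<alpha>) = 0" by (simp add: \<sigma>_def)
      then obtain i where "2*pi*\<alpha> = of_int i * pi" by (auto simp: sin_zero_iff_int2)
      then have i: "\<alpha> = of_int i / 2" by simp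
      show False
      proof (cases "even i")
        case True then show False using al i by (auto elim!: evenE)
      next
        case False
        then obtain j where "i = 2 * j + 1" by (elim oddE)
        then have "\<alpha> = 1/2 + of_int j" using i by simp
        then have "frac \<alpha> = 1/2" by (simp add: frac_unique_iff)
        then show False using \<open>frac \<alpha> \<notin> _\<close> by simp
      qed
    qed
    have s1: "\<sigma> \<le> 1" unfolding \<sigma>_def by simp
    have "\<sigma> * (y\<^sup>2 - 1) \<le> y\<^sup>2 - 2 * c * y + 1"
    proof (cases "\<sigma> = 1")
      case True then show ?thesis using cs by simp
    next
      case False
      \<comment> \<open>This square is 1 - sigma times the quadratic to be shown nonnegative;
        equality holds at y = c / (1 - sigma).\<close>
      have "0 \<le> ((1 - \<sigma>) * y - c)\<^sup>2" by simp
      also have "\<dots> = (1 - \<sigma>) * ((1 - \<sigma>) * y\<^sup>2 - 2 * c * y) + c\<^sup>2" by (simp add: power2_eq_square algebra_simps)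
      also have "c\<^sup>2 = (1 - \<sigma>) * (1 + \<sigma>)" using cs by (simp add: power2_eq_square algebra_simps)
      finally have "0 \<le> (1 - \<sigma>) * (((1 - \<sigma>) * y\<^sup>2 - 2 * c * y) + (1 + \<sigma>))" by (simp add: distrib_left)
      then have "0 \<le> ((1 - \<sigma>) * y\<^sup>2 - 2 * c * y) + (1 + \<sigma>)" using False s1 by (simp add: zero_le_mult_iff)
      then show ?thesis by (simp add: algebra_simps)
    qed
    then have "y\<^sup>2 - 1 \<le> (y\<^sup>2 - 2 * c * y + 1) / \<sigma>" using s0 by (simp add: pos_le_divide_eq mult.commute)
    moreover have "Kconst \<alpha> = 1 / \<sigma>" by (simp only: Kconst_def \<sigma>_def if_not_P[OF False])
    ultimately show ?thesis using s0 by simp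
  qed
  then show "0 < Kconst \<alpha>" "y\<^sup>2 - 1 \<le> Kconst \<alpha> * (y\<^sup>2 - 2 * cos (2*pi*\<alpha>) * y + 1)"
    by (auto simp: c_def)
qed

lemma integral_exp_linear:
  assumes "p \<le> q" "\<mu> \<noteq> (0::real)"
  shows "((\<lambda>t. exp (\<mu> * t)) has_integral (exp (\<mu> * q) - exp (\<mu> * p)) / \<mu>) {p..q}"
proof -
  have "((\<lambda>t. exp (\<mu> * t)) has_integral exp (\<mu> * q) / \<mu> - exp (\<mu> * p) / \<mu>) {p..q}"
    using assms by (intro fundamental_theorem_of_calculus)
      (auto intro!: derivative_eq_intros simp flip: has_real_derivative_iff_has_vector_derivative)
  then show ?thesis by (simp add: diff_divide_distrib)
qed

lemma mag_pair_continuous: "mag_pair a u w \<Longrightarrow> continuous_on circ u" "mag_pair a u w \<Longrightarrow> continuous_on circ w"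
  unfolding mag_pair_def using ac_deriv_continuous by blast+

text \<open>The cross term is the derivative of |u|^2, which integrates to zero by periodicity.\<close>
lemma mag_pair_cross_term:
  assumes m: "mag_pair a u w"
  shows "integral circ (\<lambda>x. u x \<bullet> (\<i> *s w x)) = 0"
proof -
  have "ac_deriv (\<lambda>x. u x \<bullet> u x) (\<lambda>x. ((- \<i>) *s (w x + a x *\<^sub>R u x)) \<bullet> u x + u x \<bullet> ((- \<i>) *s (w x + a x *\<^sub>R u x)))"
    using m by (intro ac_deriv_bilinear bounded_bilinear_inner) (auto simp: mag_pair_def)
  moreover have "((- \<i>) *s (w x + a x *\<^sub>R u x)) \<bullet> u x + u x \<bullet> ((- \<i>) *s (w x + a x *\<^sub>R u x)) = (-2) * (u x \<bullet> (\<i> *s w x))" for x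
  proof -
    have "u x \<bullet> ((- \<i>) *s (w x + a x *\<^sub>R u x)) = - Re (cip (u x) (\<i> *s w x))"
      unfolding Re_cip[symmetric] cip_smult_right cip_add_right scaleR_eq_smult cip_self by simp
    then show ?thesis by (simp add: inner_commute Re_cip)
  qed
  ultimately have "ac_deriv (\<lambda>x. u x \<bullet> u x) (\<lambda>x. (-2) * (u x \<bullet> (\<i> *s w x)))" by simp
  then have "integral circ (\<lambda>x. (-2) * (u x \<bullet> (\<i> *s w x))) = 0"
    using ac_deriv_integral m by (fastforce simp: mag_pair_def)
  then show ?thesis by simp
qed

lemma continuous_on_smult:
  "continuous_on S f \<Longrightarrow> continuous_on S g \<Longrightarrow> continuous_on S (\<lambda>x. f x *s (g x :: complex^'m::finite))"
  by (rule bounded_bilinear.continuous_on[OF bounded_bilinear_smult])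

text \<open>The combination is the right-hand side that remains after multiplication by the
  exponential factor. Expanding the square leaves a cross term that
  \<open>mag_pair_cross_term\<close> removes.\<close>

lemma mag_pair_sqnorm_combination:
  assumes m: "mag_pair a u w"
  shows "sqnorm (\<lambda>x. complex_of_real \<kappa> *s u x - \<i> *s w x) = \<kappa>\<^sup>2 * sqnorm u + sqnorm w"
proof -
  note c = mag_pair_continuous[OF m]
  have "(norm (complex_of_real \<kappa> *s u x - \<i> *s w x))\<^sup>2
     = (\<kappa>\<^sup>2 * (norm (u x))\<^sup>2 + (norm (w x))\<^sup>2) - (2 * \<kappa>) * (u x \<bullet> (\<i> *s w x))" for x
  proof -
    have "(norm (\<i> *s w x))\<^sup>2 = (norm (w x))\<^sup>2" by (simp add: norm_smult)
    then show ?thesis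
      unfolding scaleR_eq_smult[symmetric] power2_norm_eq_inner
      by (simp add: inner_diff_left inner_diff_right inner_commute power2_eq_square algebra_simps)
  qed
  then have "sqnorm (\<lambda>x. complex_of_real \<kappa> *s u x - \<i> *s w x)
     = integral circ (\<lambda>x. (\<kappa>\<^sup>2 * (norm (u x))\<^sup>2 + (norm (w x))\<^sup>2) - (2 * \<kappa>) * (u x \<bullet> (\<i> *s w x)))" by simp
  also have "\<dots> = integral circ (\<lambda>x. \<kappa>\<^sup>2 * (norm (u x))\<^sup>2 + (norm (w x))\<^sup>2) - integral circ (\<lambda>x. (2 * \<kappa>) * (u x \<bullet> (\<i> *s w x)))"
    by (intro integral_diff integrable_continuous_real continuous_intros c continuous_on_smult)
  also have "\<dots> = \<kappa>\<^sup>2 * sqnorm u + sqnorm w"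
    using mag_pair_cross_term[OF m]
    by (subst integral_add) (auto intro!: integrable_continuous_real continuous_intros c)
  finally show ?thesis .
qed

lemma cmod_exp_minus_one_sq:
  "(cmod (exp (Complex r \<theta>) - 1))\<^sup>2 = (exp r)\<^sup>2 - 2 * cos \<theta> * exp r + 1"
proof -
  have "(cmod (exp (Complex r \<theta>) - 1))\<^sup>2 = (exp r * cos \<theta> - 1)\<^sup>2 + (exp r * sin \<theta>)\<^sup>2"
    by (simp add: cmod_power2 Re_exp Im_exp)
  also have "\<dots> = (exp r)\<^sup>2 - 2 * cos \<theta> * exp r + 1"
    by (simp only: power_mult_distrib power2_diff sin_squared_eq) (simp add: algebra_simps)
  finally show ?thesis .
qed

text \<open>Multiplying u by E(t) = exp(kappa t + i int_0^t a) turns the equation into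
  (E u)' = E (kappa u - i w). Integrating over one period starting at x and using
  E(2 pi) = exp(2 pi kappa + 2 pi i alpha) isolates u(x).\<close>
lemma mag_pair_pointwise:
  fixes u w :: "real \<Rightarrow> complex^'m::finite"
  assumes a: "a absolutely_integrable_on circ" and m: "mag_pair a u w"
    and \<alpha>: "\<alpha> = integral circ a / (2*pi)" "\<alpha> \<notin> \<int>" and \<kappa>: "\<kappa> > 0" and x: "x \<in> circ"
  shows "(norm (u x))\<^sup>2 \<le> Kconst \<alpha> / (2 * \<kappa>) * (\<kappa>\<^sup>2 * sqnorm u + sqnorm w)"
proof -
  note c = mag_pair_continuous[OF m]
  define A where "A t = integral {0..t} a" for t
  define h where "h t = complex_of_real (\<kappa> * t) + \<i> * complex_of_real (A t)" for t
  define E where "E t = exp (h t)" for t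
  define q where "q t = complex_of_real \<kappa> *s u t - \<i> *s w t" for t
  define P where "P t = E t *s u t" for t
  define Q where "Q = sqnorm q"
  have Q: "Q = \<kappa>\<^sup>2 * sqnorm u + sqnorm w"
    unfolding Q_def q_def by (rule mag_pair_sqnorm_combination[OF m])
  have Eh: "E t = exp (Complex (\<kappa> * t) (A t))" for t
    by (simp add: E_def h_def complex_eq_iff Complex_eq)
  have nE: "cmod (E t) = exp (\<kappa> * t)" for t by (simp add: Eh)
  have E0: "E 0 = 1" by (simp add: E_def h_def A_def)
  have "ac_deriv (\<lambda>t. \<kappa> * t) (\<lambda>t. \<kappa>)" by (simp add: ac_deriv_def mult.commute)
  from ac_deriv_linear[OF bounded_linear_of_real this]
  have h1: "ac_deriv (\<lambda>t. complex_of_real (\<kappa> * t)) (\<lambda>t. complex_of_real \<kappa>)" .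
  have "ac_deriv A a" unfolding A_def[abs_def] by (rule ac_deriv_antideriv[OF a])
  from ac_deriv_linear[OF bounded_linear_compose[OF bounded_linear_mult_right[of \<i>] bounded_linear_of_real] this]
  have h2: "ac_deriv (\<lambda>t. \<i> * complex_of_real (A t)) (\<lambda>t. \<i> * complex_of_real (a t))" .
  have dE: "ac_deriv E (\<lambda>t. (complex_of_real \<kappa> + \<i> * complex_of_real (a t)) * E t)"
    unfolding E_def[abs_def] h_def[abs_def] by (rule ac_deriv_exp[OF ac_deriv_add[OF h1 h2]])
  have cE: "continuous_on circ E" by (rule ac_deriv_continuous[OF dE])
  have cq: "continuous_on circ q" unfolding q_def by (intro continuous_intros c continuous_on_smult)
  have dP: "ac_deriv P (\<lambda>t. E t *s q t)"
  proof (rule ac_deriv_cong_AE[where N = "{}"])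
    show "ac_deriv P (\<lambda>t. ((complex_of_real \<kappa> + \<i> * complex_of_real (a t)) * E t) *s u t + E t *s ((- \<i>) *s (w t + a t *\<^sub>R u t)))"
      unfolding P_def[abs_def] using m by (intro ac_deriv_bilinear bounded_bilinear_smult dE) (auto simp: mag_pair_def)
    show "E t *s q t = ((complex_of_real \<kappa> + \<i> * complex_of_real (a t)) * E t) *s u t + E t *s ((- \<i>) *s (w t + a t *\<^sub>R u t))" for t
      by (simp add: q_def scaleR_eq_smult vec_eq_iff algebra_simps)
  qed auto
  define y where "y = exp (2*pi*\<kappa>)"
  have y0: "y > 0" by (simp add: y_def)
  define \<Omega> where "\<Omega> = E (2*pi)"
  have n\<Omega>: "cmod \<Omega> = y" by (simp add: \<Omega>_def nE y_def mult.commute)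
  have A2: "A (2*pi) = 2*pi*\<alpha>" by (simp add: A_def \<alpha>)
  have \<Omega>1: "(cmod (\<Omega> - 1))\<^sup>2 = y\<^sup>2 - 2 * cos (2*pi*\<alpha>) * y + 1"
    unfolding \<Omega>_def Eh cmod_exp_minus_one_sq A2 y_def by (simp add: mult.commute)
  have nq: "(\<lambda>t. (norm (q t))\<^sup>2) integrable_on {p..r}" if "{p..r} \<subseteq> circ" for p r
    using that cq by (intro integrable_continuous_real continuous_intros) (auto intro: continuous_on_subset)
  \<comment> \<open>AM-GM with two parameters. \<open>z\<close> compensates a later multiplication
    by |Omega| = y: with z = y on [0, x] and z = 1 on [x, 2 pi], both stretches carry the same
    weight 1 / (2 s) on |q|^2.\<close>
  have Pdiff: "norm (P r - P p) \<le> s / 2 * ((exp (2*\<kappa>*r) - exp (2*\<kappa>*p)) / (2*\<kappa>)) * z + integral {p..r} (\<lambda>t. (norm (q t))\<^sup>2) / (2 * s * z)"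
    if pr: "0 \<le> p" "p \<le> r" "r \<le> 2*pi" and s: "s > 0" "z > 0" for p r s z
  proof -
    have sub: "{p..r} \<subseteq> circ" using pr by auto
    have "P r - P p = integral {p..r} (\<lambda>t. E t *s q t)" using ac_deriv_diff[OF dP pr] .
    also have "norm \<dots> \<le> integral {p..r} (\<lambda>t. s / 2 * z * exp (2*\<kappa>*t) + (norm (q t))\<^sup>2 / (2 * s * z))"
    proof (rule integral_norm_bound_integral)
      show "(\<lambda>t. E t *s q t) integrable_on {p..r}"
        using cE cq sub by (intro integrable_continuous_real continuous_on_smult) (auto intro: continuous_on_subset)
      show "(\<lambda>t. s / 2 * z * exp (2*\<kappa>*t) + (norm (q t))\<^sup>2 / (2 * s * z)) integrable_on {p..r}"
        using cq sub s by (intro integrable_continuous_real continuous_intros) (auto intro: continuous_on_subset)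
      fix t assume "t \<in> {p..r}"
      have e2: "(exp (\<kappa>*t))\<^sup>2 = exp (2*\<kappa>*t)"
        by (simp add: power2_eq_square exp_add[symmetric])
      have "0 \<le> (s * z * exp (\<kappa>*t) - norm (q t))\<^sup>2" by simp
      then have "2 * (s * z) * (exp (\<kappa>*t) * norm (q t)) \<le> (s * z)\<^sup>2 * (exp (\<kappa>*t))\<^sup>2 + (norm (q t))\<^sup>2"
        by (simp add: power2_eq_square algebra_simps)
      then have "exp (\<kappa>*t) * norm (q t) \<le> ((s * z)\<^sup>2 * (exp (\<kappa>*t))\<^sup>2 + (norm (q t))\<^sup>2) / (2 * (s * z))"
        using s by (simp add: pos_le_divide_eq mult.commute)
      also have "\<dots> = s / 2 * z * (exp (\<kappa>*t))\<^sup>2 + (norm (q t))\<^sup>2 / (2 * s * z)"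
        using s by (simp add: add_divide_distrib power2_eq_square)
      finally show "norm (E t *s q t) \<le> s / 2 * z * exp (2*\<kappa>*t) + (norm (q t))\<^sup>2 / (2 * s * z)"
        by (simp only: norm_smult nE e2)
    qed
    also have "\<dots> = s / 2 * z * ((exp (2*\<kappa>*r) - exp (2*\<kappa>*p)) / (2*\<kappa>)) + integral {p..r} (\<lambda>t. (norm (q t))\<^sup>2) / (2 * s * z)"
    proof (rule integral_unique, rule has_integral_add)
      show "((\<lambda>t. s / 2 * z * exp (2*\<kappa>*t)) has_integral s / 2 * z * ((exp (2*\<kappa>*r) - exp (2*\<kappa>*p)) / (2*\<kappa>))) {p..r}"
        using \<kappa> pr by (intro has_integral_mult_right integral_exp_linear) auto
      show "((\<lambda>t. (norm (q t))\<^sup>2 / (2 * s * z)) has_integral integral {p..r} (\<lambda>t. (norm (q t))\<^sup>2) / (2 * s * z)) {p..r}"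
        using integrable_integral[OF nq[OF sub]] by (rule has_integral_divide)
    qed
    finally show ?thesis by (simp add: algebra_simps)
  qed
  \<comment> \<open>The integral of exp (2 kappa t) over [x, x + 2 pi], the period that starts at
    x.\<close>
  define R where "R = exp (2*\<kappa>*x) * (y\<^sup>2 - 1) / (2*\<kappa>)"
  have y1: "y > 1" using \<kappa> by (simp add: y_def)
  have R0: "0 \<le> R" using y1 \<kappa> by (simp add: R_def)
  have P2: "P (2*pi) = \<Omega> *s u 0" using m by (simp add: P_def \<Omega>_def mag_pair_def)
  have P0: "P 0 = u 0" by (simp add: P_def E0)
  have y2: "exp (2*\<kappa>*(2*pi)) = y\<^sup>2" by (simp add: y_def power2_eq_square exp_add[symmetric])
  have "(norm ((\<Omega> - 1) *s P x))\<^sup>2 \<le> R * Q"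
  proof (rule amgm_optimise)
    show "0 \<le> Q" unfolding Q_def using nq[of 0 "2*pi"] by (intro integral_nonneg) auto
    fix s :: real assume s: "s > 0"
    \<comment> \<open>\<open>P\<close> is quasi-periodic: P (2 pi) = Omega P 0. The factor Omega
      carries the stretch [0, x] over to [2 pi, 2 pi + x].\<close>
    have "(\<Omega> - 1) *s P x = \<Omega> *s (P x - P 0) + (P (2*pi) - P x)"
      unfolding P0 P2 by (simp add: vec_eq_iff algebra_simps)
    then have "norm ((\<Omega> - 1) *s P x) \<le> y * norm (P x - P 0) + norm (P (2*pi) - P x)"
      by (metis norm_triangle_ineq norm_smult n\<Omega>)
    also have "\<dots> \<le> y * (s / 2 * ((exp (2*\<kappa>*x) - exp (2*\<kappa>*0)) / (2*\<kappa>)) * y + integral {0..x} (\<lambda>t. (norm (q t))\<^sup>2) / (2 * s * y))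
        + (s / 2 * ((exp (2*\<kappa>*(2*pi)) - exp (2*\<kappa>*x)) / (2*\<kappa>)) * 1 + integral {x..2*pi} (\<lambda>t. (norm (q t))\<^sup>2) / (2 * s * 1))"
      using x s y0 by (intro add_mono mult_left_mono Pdiff) auto
    also have "\<dots> = s / 2 * ((y\<^sup>2 * (exp (2*\<kappa>*x) - 1) + (y\<^sup>2 - exp (2*\<kappa>*x))) / (2*\<kappa>))
        + (integral {0..x} (\<lambda>t. (norm (q t))\<^sup>2) + integral {x..2*pi} (\<lambda>t. (norm (q t))\<^sup>2)) / (2 * s)"
      unfolding y2 using y0 s \<kappa> by (simp add: field_simps power2_eq_square)
    also have "integral {0..x} (\<lambda>t. (norm (q t))\<^sup>2) + integral {x..2*pi} (\<lambda>t. (norm (q t))\<^sup>2) = Q"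
      unfolding Q_def using x nq[of 0 "2*pi"] by (intro Henstock_Kurzweil_Integration.integral_combine) auto
    also have "(y\<^sup>2 * (exp (2*\<kappa>*x) - 1) + (y\<^sup>2 - exp (2*\<kappa>*x))) / (2*\<kappa>) = R" by (simp add: R_def algebra_simps)
    finally show "norm ((\<Omega> - 1) *s P x) \<le> s / 2 * R + Q / (2 * s)" .
  qed (use R0 in auto)
  also have "norm ((\<Omega> - 1) *s P x) = cmod (\<Omega> - 1) * exp (\<kappa>*x) * norm (u x)"
    by (simp add: norm_smult norm_mult P_def nE)
  finally have "(cmod (\<Omega> - 1))\<^sup>2 * exp (2*\<kappa>*x) * (norm (u x))\<^sup>2 \<le> exp (2*\<kappa>*x) * ((y\<^sup>2 - 1) / (2*\<kappa>) * Q)"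
  proof -
    have e2: "(exp (\<kappa>*x))\<^sup>2 = exp (2*\<kappa>*x)" by (simp add: power2_eq_square exp_add[symmetric])
    assume "(cmod (\<Omega> - 1) * exp (\<kappa>*x) * norm (u x))\<^sup>2 \<le> R * Q"
    then show ?thesis unfolding power_mult_distrib R_def e2 by (simp only: times_divide_eq_left times_divide_eq_right mult_ac)
  qed
  then have main: "(cmod (\<Omega> - 1))\<^sup>2 * (norm (u x))\<^sup>2 \<le> (y\<^sup>2 - 1) / (2*\<kappa>) * Q"
  proof -
    assume "(cmod (\<Omega> - 1))\<^sup>2 * exp (2*\<kappa>*x) * (norm (u x))\<^sup>2 \<le> exp (2*\<kappa>*x) * ((y\<^sup>2 - 1) / (2*\<kappa>) * Q)"
    then have "exp (2*\<kappa>*x) * ((cmod (\<Omega> - 1))\<^sup>2 * (norm (u x))\<^sup>2) \<le> exp (2*\<kappa>*x) * ((y\<^sup>2 - 1) / (2*\<kappa>) * Q)"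
      by (simp only: mult_ac)
    then show ?thesis by (simp only: mult_le_cancel_left_pos[OF exp_gt_zero])
  qed
  have Q0: "0 \<le> Q" unfolding Q_def using nq[of 0 "2*pi"] by (intro integral_nonneg) auto
  have "(y\<^sup>2 - 1) / (2*\<kappa>) * Q \<le> (Kconst \<alpha> * (cmod (\<Omega> - 1))\<^sup>2) / (2*\<kappa>) * Q"
    unfolding \<Omega>1 using Kconst_bound[OF \<alpha>(2) y0] \<kappa> Q0 by (intro mult_right_mono divide_right_mono) auto
  with main have "(cmod (\<Omega> - 1))\<^sup>2 * (norm (u x))\<^sup>2 \<le> (cmod (\<Omega> - 1))\<^sup>2 * (Kconst \<alpha> / (2*\<kappa>) * Q)"
    by (simp add: algebra_simps)
  moreover have "(cmod (\<Omega> - 1))\<^sup>2 > 0"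
  proof -
    have "\<Omega> \<noteq> 1" using n\<Omega> y1 by auto
    then show ?thesis by simp
  qed
  ultimately show ?thesis unfolding Q by (simp only: mult_le_cancel_left_pos)
qed

lemma sqnorm_nonneg: "continuous_on circ u \<Longrightarrow> 0 \<le> sqnorm u"
  by (intro integral_nonneg integrable_continuous_real continuous_intros) auto

text \<open>\<open>mag_pair_pointwise\<close> holds for every kappa > 0, and
  \<open>amgm_optimise\<close> selects the best one. Fourth powers keep square roots out of the
  statement.\<close>

lemma mag_pair_interpolation:
  fixes u w :: "real \<Rightarrow> complex^'m::finite"
  assumes a: "a absolutely_integrable_on circ" and m: "mag_pair a u w"
    and \<alpha>: "\<alpha> = integral circ a / (2*pi)" "\<alpha> \<notin> \<int>" and x: "x \<in> circ"
  shows "norm (u x) ^ 4 \<le> (Kconst \<alpha>)\<^sup>2 * sqnorm u * sqnorm w"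
proof -
  note c = mag_pair_continuous[OF m]
  have K: "0 < Kconst \<alpha>" using Kconst_bound(1)[OF \<alpha>(2), of 1] by simp
  have "((norm (u x))\<^sup>2)\<^sup>2 \<le> (Kconst \<alpha> * sqnorm u) * (Kconst \<alpha> * sqnorm w)"
  proof (rule amgm_optimise)
    fix s :: real assume s: "s > 0"
    show "(norm (u x))\<^sup>2 \<le> s / 2 * (Kconst \<alpha> * sqnorm u) + Kconst \<alpha> * sqnorm w / (2 * s)"
      using mag_pair_pointwise[OF a m \<alpha> s x] s by (simp add: field_simps power2_eq_square)
  qed (use K c in \<open>auto intro!: mult_nonneg_nonneg sqnorm_nonneg\<close>)
  moreover have "norm (u x) ^ 4 = ((norm (u x))\<^sup>2)\<^sup>2" by simp
  ultimately show ?thesis by (simp only: power2_eq_square mult_ac)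
qed

section \<open>Linear systems with integrable coefficients\<close>

lemma ac_deriv_exp_real:
  fixes h h' :: "real \<Rightarrow> real"
  assumes h: "ac_deriv h h'"
  shows "ac_deriv (\<lambda>x. exp (h x)) (\<lambda>x. h' x * exp (h x))"
proof -
  have "ac_deriv (\<lambda>x. Re (exp (complex_of_real (h x)))) (\<lambda>x. Re (complex_of_real (h' x) * exp (complex_of_real (h x))))"
    by (intro ac_deriv_linear[OF bounded_linear_Re] ac_deriv_exp ac_deriv_linear[OF bounded_linear_of_real h])
  then show ?thesis by (simp add: Re_exp)
qed

lemma measurable_bounded_absint:
  fixes f :: "real \<Rightarrow> 'a::euclidean_space"
  assumes "f \<in> borel_measurable (lebesgue_on circ)" "g absolutely_integrable_on circ"
    and "\<And>t. t \<in> circ \<Longrightarrow> norm (f t) \<le> g t * M"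
  shows "f absolutely_integrable_on circ"
proof (rule measurable_bounded_by_integrable_imp_absolutely_integrable)
  show "(\<lambda>t. g t * M) integrable_on circ"
    using assms(2) absolutely_integrable_on_def by (intro integrable_on_mult_left) blast
qed (use assms in auto)

text \<open>Picard's operator is a contraction for the Bielecki norm sup exp(-2G) |Y|,
  where G is the primitive of g.\<close>
lemma linear_ode_exists:
  fixes B :: "real \<Rightarrow> 'a::euclidean_space \<Rightarrow> 'a"
  assumes g: "g absolutely_integrable_on circ" "\<And>t. t \<in> circ \<Longrightarrow> 0 \<le> g t"
    and lin: "\<And>t. linear (B t)"
    and bd: "\<And>t x. t \<in> circ \<Longrightarrow> norm (B t x) \<le> g t * norm x"
    and meas: "\<And>Y. continuous_on circ Y \<Longrightarrow> (\<lambda>t. B t (Y t)) \<in> borel_measurable (lebesgue_on circ)"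
    and F: "F absolutely_integrable_on circ"
  shows "\<exists>Y. ac_deriv Y (\<lambda>t. B t (Y t) + F t) \<and> Y 0 = y0"
proof -
  define G where "G t = integral {0..t} g" for t
  have dG: "ac_deriv G g" unfolding G_def[abs_def] by (rule ac_deriv_antideriv[OF g(1)])
  note cG = ac_deriv_continuous[OF dG]
  \<comment> \<open>The fixed point is sought among bounded continuous functions on the whole line,
    which form a complete type; clamping the argument to [0, 2 pi] extends the Picard iterate to
    that line.\<close>
  define cl where "cl x = max 0 (min x (2*pi))" for x :: real
  have cl: "cl x \<in> circ" "x \<in> circ \<Longrightarrow> cl x = x" for x by (auto simp: cl_def)
  have ccl: "continuous_on UNIV cl" unfolding cl_def by (intro continuous_intros)
  have abs: "(\<lambda>t. B t (Y t) + F t) absolutely_integrable_on circ" if Y: "continuous_on circ Y" for Y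
  proof (rule set_integral_add(1)[OF _ F])
    obtain M where M: "M > 0" "\<And>x. x \<in> circ \<Longrightarrow> norm (Y x) \<le> M" using continuous_circ_bounded[OF Y] by blast
    show "(\<lambda>t. B t (Y t)) absolutely_integrable_on circ"
    proof (rule measurable_bounded_absint[OF meas[OF Y] g(1), where M = M])
      fix t assume "t \<in> circ"
      then show "norm (B t (Y t)) \<le> g t * M" using bd[of t "Y t"] M g(2) by (meson mult_left_mono order_trans)
    qed
  qed
  \<comment> \<open>The unknown is z = exp (-2 G) Y, so the plain supremum norm of \<open>z\<close>
    is the weighted norm of \<open>Y\<close>.\<close>
  define \<Phi> where "\<Phi> z x = exp (-2 * G (cl x)) *\<^sub>R (y0 + integral {0..cl x} (\<lambda>t. B t (exp (2 * G t) *\<^sub>R z t) + F t))" for z :: "real \<Rightarrow> 'a" and x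
  have cY: "continuous_on circ (\<lambda>t. exp (2 * G t) *\<^sub>R z t)" if "continuous_on circ z" for z :: "real \<Rightarrow> 'a"
    using that by (intro continuous_intros cG)
  have ig: "(\<lambda>t. B t (exp (2 * G t) *\<^sub>R z t) + F t) integrable_on {0..x}" if "continuous_on circ z" "x \<in> circ" for z :: "real \<Rightarrow> 'a" and x
    using absint_Icc_sub(2)[OF abs[OF cY[OF that(1)]], of 0 x] that(2) by auto
  have \<Phi>: "\<Phi> (apply_bcontfun z) \<in> bcontfun" for z :: "real \<Rightarrow>\<^sub>C 'a"
  proof -
    have cz: "continuous_on circ (apply_bcontfun z)" by auto
    define f where "f x = exp (-2 * G x) *\<^sub>R (y0 + integral {0..x} (\<lambda>t. B t (exp (2 * G t) *\<^sub>R z t) + F t))" for x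
    have cf: "continuous_on circ f" unfolding f_def
      using ig[OF cz, of "2*pi"] by (intro continuous_intros cG indefinite_integral_continuous_1) auto
    then obtain M where M: "\<And>x. x \<in> circ \<Longrightarrow> norm (f x) \<le> M" using continuous_circ_bounded by blast
    have "\<Phi> (apply_bcontfun z) = (\<lambda>x. f (cl x))" unfolding \<Phi>_def f_def ..
    moreover have "continuous_on UNIV (\<lambda>x. f (cl x))"
      by (rule continuous_on_compose2[OF cf ccl]) (use cl in auto)
    ultimately show ?thesis
      using cl(1) M by (intro bcontfun_normI[where b = M]) auto
  qed
  define \<Psi> where "\<Psi> z = Bcontfun (\<Phi> (apply_bcontfun z))" for z :: "real \<Rightarrow>\<^sub>C 'a"
  have \<Psi>: "apply_bcontfun (\<Psi> z) = \<Phi> (apply_bcontfun z)" for z :: "real \<Rightarrow>\<^sub>C 'a"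
    unfolding \<Psi>_def using \<Phi> by (rule Bcontfun_inverse)
  have "ac_deriv (\<lambda>x. exp (2 * G x)) (\<lambda>x. (2 * g x) * exp (2 * G x))"
    by (intro ac_deriv_exp_real ac_deriv_linear[OF bounded_linear_mult_right dG])
  note dE = this
  \<comment> \<open>The integrand is half the derivative of exp (2 G). Multiplied by exp (-2 G), the
    integral becomes (1 - exp (-2 G)) / 2, hence the contraction factor 1/2.\<close>
  have E: "((\<lambda>t. g t * exp (2 * G t)) has_integral (exp (2 * G x) - 1) / 2) {0..x}" if x: "x \<in> circ" for x
  proof -
    have "(\<lambda>x. (2 * g x) * exp (2 * G x)) integrable_on {0..x}"
      using absint_Icc_sub(2)[OF ac_derivD(2)[OF dE], of 0 x] x by auto
    moreover have "integral {0..x} (\<lambda>x. (2 * g x) * exp (2 * G x)) = exp (2 * G x) - 1"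
      using ac_derivD(1)[OF dE x] by (simp add: G_def)
    ultimately have "((\<lambda>x. (2 * g x) * exp (2 * G x)) has_integral exp (2 * G x) - 1) {0..x}"
      by (metis integrable_integral)
    from has_integral_divide[OF this, of 2] show ?thesis by simp
  qed
  have "\<exists>!z. \<Psi> z = z"
  proof (rule banach_fix_type[where c = "1/2"], simp, simp, intro allI)
    fix z z' :: "real \<Rightarrow>\<^sub>C 'a"
    show "dist (\<Psi> z) (\<Psi> z') \<le> 1/2 * dist z z'"
    proof (rule dist_bound)
      fix x
      define y where "y = cl x"
      have y: "y \<in> circ" unfolding y_def by (rule cl(1))
      have czz: "continuous_on circ (apply_bcontfun z)" "continuous_on circ (apply_bcontfun z')" by auto
      define D where "D = (\<lambda>t. B t (exp (2 * G t) *\<^sub>R z t) + F t - (B t (exp (2 * G t) *\<^sub>R z' t) + F t))"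
      have "dist (\<Psi> z x) (\<Psi> z' x) = norm (exp (-2 * G y) *\<^sub>R integral {0..y} D)"
        unfolding D_def integral_diff[OF ig[OF czz(1) y] ig[OF czz(2) y]]
        by (simp add: \<Psi> \<Phi>_def dist_norm y_def[symmetric] scaleR_diff_right[symmetric] del: scaleR_minus_left)
      also have "\<dots> = exp (-2 * G y) * norm (integral {0..y} D)" by simp
      also have "\<dots> \<le> exp (-2 * G y) * (dist z z' * integral {0..y} (\<lambda>t. g t * exp (2 * G t)))"
      proof (rule mult_left_mono[OF norm_integral_le_const])
        show "D integrable_on {0..y}" unfolding D_def by (intro integrable_diff ig czz y)
        show "(\<lambda>t. g t * exp (2 * G t)) integrable_on {0..y}" using E[OF y] by blast
        fix t assume t: "t \<in> {0..y}"
        then have tc: "t \<in> circ" using y by auto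
        have "D t = B t (exp (2 * G t) *\<^sub>R (z t - z' t))"
          by (simp add: D_def linear_diff[OF lin] scaleR_diff_right)
        then have "norm (D t) \<le> g t * (exp (2 * G t) * dist (z t) (z' t))"
          using bd[OF tc, of "exp (2 * G t) *\<^sub>R (z t - z' t)"] by (simp add: dist_norm)
        also have "\<dots> \<le> g t * (exp (2 * G t) * dist z z')"
          using g(2)[OF tc] by (intro mult_left_mono dist_bounded) auto
        finally show "norm (D t) \<le> dist z z' * (g t * exp (2 * G t))" by (simp add: mult_ac)
      qed auto
      also have "\<dots> = dist z z' * ((1 - exp (-2 * G y)) / 2)"
        unfolding integral_unique[OF E[OF y]] by (simp add: exp_minus field_simps)
      also have "\<dots> \<le> dist z z' * (1/2)" by (intro mult_left_mono) auto
      finally show "dist (\<Psi> z x) (\<Psi> z' x) \<le> 1/2 * dist z z'" by simp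
    qed
  qed
  then obtain z where z: "\<Psi> z = z" by blast
  define Y where "Y t = exp (2 * G t) *\<^sub>R z t" for t
  have Yx: "Y x = y0 + integral {0..x} (\<lambda>t. B t (Y t) + F t)" if x: "x \<in> circ" for x
  proof -
    have "apply_bcontfun z x = \<Phi> (apply_bcontfun z) x" using \<Psi>[of z] z by simp
    also have "\<dots> = exp (-2 * G x) *\<^sub>R (y0 + integral {0..x} (\<lambda>t. B t (Y t) + F t))"
      by (simp add: \<Phi>_def cl(2)[OF x] Y_def)
    finally show ?thesis by (simp add: Y_def[of x] exp_minus)
  qed
  have "Y 0 = y0" using Yx[of 0] by simp
  moreover have "ac_deriv Y (\<lambda>t. B t (Y t) + F t)"
    unfolding ac_deriv_def using Yx \<open>Y 0 = y0\<close> abs[of Y] by (auto simp: Y_def[abs_def] intro!: cY) 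
  ultimately show ?thesis by blast
qed

text \<open>Fredholm alternative: the fundamental solutions Y b (b in Basis) give the period map by a
  linear formula, so injectivity of id minus the period map implies surjectivity.\<close>
lemma linear_ode_periodic:
  fixes B :: "real \<Rightarrow> 'a::euclidean_space \<Rightarrow> 'a"
  assumes g: "g absolutely_integrable_on circ" "\<And>t. t \<in> circ \<Longrightarrow> 0 \<le> g t"
    and lin: "\<And>t. linear (B t)"
    and bd: "\<And>t x. t \<in> circ \<Longrightarrow> norm (B t x) \<le> g t * norm x"
    and meas: "\<And>Y. continuous_on circ Y \<Longrightarrow> (\<lambda>t. B t (Y t)) \<in> borel_measurable (lebesgue_on circ)"
    and F: "F absolutely_integrable_on circ"
    and inj: "\<And>Y. ac_deriv Y (\<lambda>t. B t (Y t)) \<Longrightarrow> Y 0 = Y (2*pi) \<Longrightarrow> Y 0 = 0"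
  shows "\<exists>Y. ac_deriv Y (\<lambda>t. B t (Y t) + F t) \<and> Y 0 = Y (2*pi)"
proof -
  have "\<forall>b. \<exists>Y. ac_deriv Y (\<lambda>t. B t (Y t)) \<and> Y 0 = b"
    using linear_ode_exists[OF g lin bd meas, where F = "\<lambda>_. 0"] by simp
  then obtain Y where Y: "\<And>b. ac_deriv (Y b) (\<lambda>t. B t (Y b t))" "\<And>b. Y b 0 = b" by metis
  obtain P where P: "ac_deriv P (\<lambda>t. B t (P t) + F t)" "P 0 = 0"
    using linear_ode_exists[OF g lin bd meas F] by metis
  define S where "S y t = (\<Sum>b\<in>Basis. (y \<bullet> b) *\<^sub>R Y b t)" for y t
  have S: "ac_deriv (S y) (\<lambda>t. B t (S y t))" for y
  proof -
    have "ac_deriv (\<lambda>t. \<Sum>b\<in>X. (y \<bullet> b) *\<^sub>R Y b t) (\<lambda>t. \<Sum>b\<in>X. (y \<bullet> b) *\<^sub>R B t (Y b t))" if "finite X" for X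
      using that
      by (induction X) (auto intro!: ac_deriv_add ac_deriv_linear[OF bounded_linear_scaleR_right Y(1)] simp: ac_deriv_const)
    from this[OF finite_Basis] show ?thesis
      by (simp add: S_def[abs_def] linear_sum[OF lin] linear_cmul[OF lin])
  qed
  have S0: "S y 0 = y" for y by (simp add: S_def Y(2) euclidean_representation)
  define T where "T y = y - S y (2*pi)" for y
  have linT: "linear T"
    by (rule linearI) (auto simp: T_def S_def inner_add_left scaleR_add_left sum.distrib scaleR_sum_right algebra_simps)
  moreover have "inj T"
    using inj[OF S] S0 by (subst linear_injective_0[OF linT]) (simp add: T_def)
  ultimately have "surj T" by (intro linear_injective_imp_surjective) auto
  \<comment> \<open>\<open>P\<close> starts at 0, so \<open>S y\<close> plus \<open>P\<close> is
    periodic exactly when \<open>T y = P (2*pi)\<close>.\<close>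
  then obtain y where y: "T y = P (2*pi)" by (metis surjD)
  have "ac_deriv (\<lambda>t. S y t + P t) (\<lambda>t. B t (S y t) + (B t (P t) + F t))"
    by (intro ac_deriv_add S P)
  moreover have "S y 0 + P 0 = S y (2*pi) + P (2*pi)" using y by (simp add: T_def S0 P algebra_simps)
  ultimately show ?thesis
    by (intro exI[of _ "\<lambda>t. S y t + P t"]) (simp add: linear_add[OF lin] add.assoc)
qed

section \<open>Eigenfunctions\<close>

text \<open>As for mag_pair, the second-order equation H u = f is encoded as a first-order system.\<close>
definition schr_pair :: "(real \<Rightarrow> real) \<Rightarrow> (real \<Rightarrow> complex^'m::finite^'m) \<Rightarrow>
    (real \<Rightarrow> complex^'m) \<Rightarrow> (real \<Rightarrow> complex^'m) \<Rightarrow> (real \<Rightarrow> complex^'m) \<Rightarrow> bool" where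
  "schr_pair a V u w f \<longleftrightarrow> mag_pair a u w \<and>
     ac_deriv w (\<lambda>x. (- \<i>) *s (f x + a x *\<^sub>R w x + V x *v u x)) \<and> w 0 = w (2*pi)"

abbreviation eig_pair where
  "eig_pair a V \<mu> u w \<equiv> schr_pair a V u w (\<lambda>x. \<mu> *s u x)"

lemma smult_i_cancel: "(- \<i>) *s (\<i> *s (x :: complex^'m::finite)) = x" "\<i> *s ((- \<i>) *s x) = x"
  by (simp_all add: vec_eq_iff)

text \<open>The derivatives quantified in \<open>applyH\<close> matter only almost everywhere.
  Solving both equations for them and substituting the result changes them on a null set and leaves
  a system without exceptional points.\<close>

lemma applyH_iff_schr_pair:
  fixes V :: "real \<Rightarrow> complex^'m::finite^'m"
  shows "applyH a V u f \<longleftrightarrow> (\<exists>w. schr_pair a V u w f)"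
proof
  assume "applyH a V u f"
  then obtain u' w w' where h: "ac_deriv u u'" "ac_deriv w w'" "u 0 = u (2*pi)" "w 0 = w (2*pi)"
    and e1: "AE x in lebesgue_on circ. w x = \<i> *s u' x - a x *\<^sub>R u x"
    and e2: "AE x in lebesgue_on circ. f x = \<i> *s w' x - a x *\<^sub>R w x - V x *v u x"
    unfolding applyH_def by blast
  obtain N1 where N1: "negligible N1" "\<And>x. x \<in> circ \<Longrightarrow> x \<notin> N1 \<Longrightarrow> w x = \<i> *s u' x - a x *\<^sub>R u x"
    using AE_circ_negligible[OF e1] by metis
  obtain N2 where N2: "negligible N2" "\<And>x. x \<in> circ \<Longrightarrow> x \<notin> N2 \<Longrightarrow> f x = \<i> *s w' x - a x *\<^sub>R w x - V x *v u x"
    using AE_circ_negligible[OF e2] by metis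
  have "ac_deriv u (\<lambda>x. (- \<i>) *s (w x + a x *\<^sub>R u x))"
  proof (rule ac_deriv_cong_AE[OF h(1) N1(1)])
    fix x assume "x \<in> circ" "x \<notin> N1"
    then have "w x + a x *\<^sub>R u x = \<i> *s u' x" using N1(2) by simp
    then show "(- \<i>) *s (w x + a x *\<^sub>R u x) = u' x" by (simp only: smult_i_cancel)
  qed auto
  moreover have "ac_deriv w (\<lambda>x. (- \<i>) *s (f x + a x *\<^sub>R w x + V x *v u x))"
  proof (rule ac_deriv_cong_AE[OF h(2) N2(1)])
    fix x assume "x \<in> circ" "x \<notin> N2"
    then have "f x + a x *\<^sub>R w x + V x *v u x = \<i> *s w' x" using N2(2) by simp
    then show "(- \<i>) *s (f x + a x *\<^sub>R w x + V x *v u x) = w' x" by (simp only: smult_i_cancel)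
  qed auto
  ultimately show "\<exists>w. schr_pair a V u w f"
    using h ac_deriv_continuous[OF h(2)] unfolding schr_pair_def mag_pair_def by blast
next
  assume "\<exists>w. schr_pair a V u w f"
  then obtain w where "schr_pair a V u w f" by blast
  then have h: "ac_deriv u (\<lambda>x. (- \<i>) *s (w x + a x *\<^sub>R u x))"
     "ac_deriv w (\<lambda>x. (- \<i>) *s (f x + a x *\<^sub>R w x + V x *v u x))"
     "u 0 = u (2*pi)" "w 0 = w (2*pi)"
    by (simp_all add: schr_pair_def mag_pair_def)
  moreover have "AE x in lebesgue_on circ. w x = \<i> *s ((- \<i>) *s (w x + a x *\<^sub>R u x)) - a x *\<^sub>R u x"
    unfolding smult_i_cancel by simp
  moreover have "AE x in lebesgue_on circ. f x = \<i> *s ((- \<i>) *s (f x + a x *\<^sub>R w x + V x *v u x)) - a x *\<^sub>R w x - V x *v u x"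
    unfolding smult_i_cancel by simp
  ultimately show "applyH a V u f" unfolding applyH_def by blast
qed

lemma eigenfun_iff: "eigenfun a V \<mu> u \<longleftrightarrow> (\<exists>w. eig_pair a V \<mu> u w) \<and> (\<exists>x\<in>circ. u x \<noteq> 0)"
  by (simp add: eigenfun_def applyH_iff_schr_pair)

lemma ac_deriv_eq: "ac_deriv u u' \<Longrightarrow> (\<And>x. u' x = v' x) \<Longrightarrow> ac_deriv u v'"
  using ext[of u' v'] by simp

section \<open>Linearity of the first-order pairs\<close>

lemma mag_pair_zero: "mag_pair a (\<lambda>x. 0) (\<lambda>x. 0)"
  by (simp add: mag_pair_def ac_deriv_const)

lemma bounded_linear_smult: "bounded_linear (\<lambda>x. c *s (x :: complex^'m::finite))"
  by (rule bounded_bilinear.bounded_linear_right[OF bounded_bilinear_smult])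

lemma mag_pair_smult:
  assumes "mag_pair a u w"
  shows "mag_pair a (\<lambda>x. c *s u x) (\<lambda>x. c *s w x)"
proof -
  have m: "ac_deriv u (\<lambda>x. (- \<i>) *s (w x + a x *\<^sub>R u x))" "u 0 = u (2*pi)" "continuous_on circ w"
    using assms unfolding mag_pair_def by blast+
  have "ac_deriv (\<lambda>x. c *s u x) (\<lambda>x. (- \<i>) *s (c *s w x + a x *\<^sub>R (c *s u x)))"
    by (rule ac_deriv_eq[OF ac_deriv_linear[OF bounded_linear_smult m(1)]])
       (simp add: scaleR_eq_smult vec_eq_iff algebra_simps)
  then show ?thesis using m(2,3) unfolding mag_pair_def by (simp add: continuous_on_smult)
qed

lemma mag_pair_add:
  assumes "mag_pair a u w" "mag_pair a v z"
  shows "mag_pair a (\<lambda>x. u x + v x) (\<lambda>x. w x + z x)"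
proof -
  have m: "ac_deriv u (\<lambda>x. (- \<i>) *s (w x + a x *\<^sub>R u x))" "u 0 = u (2*pi)" "continuous_on circ w"
    "ac_deriv v (\<lambda>x. (- \<i>) *s (z x + a x *\<^sub>R v x))" "v 0 = v (2*pi)" "continuous_on circ z"
    using assms unfolding mag_pair_def by blast+
  have "ac_deriv (\<lambda>x. u x + v x) (\<lambda>x. (- \<i>) *s (w x + z x + a x *\<^sub>R (u x + v x)))"
    by (rule ac_deriv_eq[OF ac_deriv_add[OF m(1,4)]]) (simp add: scaleR_eq_smult vec_eq_iff algebra_simps)
  moreover have "continuous_on circ (\<lambda>x. w x + z x)" by (intro continuous_intros m)
  ultimately show ?thesis using m(2,5) unfolding mag_pair_def by simp
qed

lemma mag_pair_sum:
  assumes "\<And>k. k \<in> S \<Longrightarrow> mag_pair a (u k) (w k)" "finite S"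
  shows "mag_pair a (\<lambda>x. \<Sum>k\<in>S. c k *s u k x) (\<lambda>x. \<Sum>k\<in>S. c k *s w k x)"
  using assms(2,1) by (induction S) (auto intro!: mag_pair_add mag_pair_smult mag_pair_zero)

lemma schr_pair_smult:
  assumes "schr_pair a V u w f"
  shows "schr_pair a V (\<lambda>x. c *s u x) (\<lambda>x. c *s w x) (\<lambda>x. c *s f x)"
proof -
  have m: "mag_pair a u w" "ac_deriv w (\<lambda>x. (- \<i>) *s (f x + a x *\<^sub>R w x + V x *v u x))" "w 0 = w (2*pi)"
    using assms unfolding schr_pair_def by blast+
  have "ac_deriv (\<lambda>x. c *s w x) (\<lambda>x. (- \<i>) *s (c *s f x + a x *\<^sub>R (c *s w x) + V x *v (c *s u x)))"
    by (rule ac_deriv_eq[OF ac_deriv_linear[OF bounded_linear_smult m(2)]], unfold matvec_smult)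
       (simp add: scaleR_eq_smult vec_eq_iff algebra_simps)
  then show ?thesis using m(3) mag_pair_smult[OF m(1)] unfolding schr_pair_def by simp
qed

lemma schr_pair_add:
  assumes "schr_pair a V u w f" "schr_pair a V v z g"
  shows "schr_pair a V (\<lambda>x. u x + v x) (\<lambda>x. w x + z x) (\<lambda>x. f x + g x)"
proof -
  have m: "mag_pair a u w" "ac_deriv w (\<lambda>x. (- \<i>) *s (f x + a x *\<^sub>R w x + V x *v u x))" "w 0 = w (2*pi)"
    "mag_pair a v z" "ac_deriv z (\<lambda>x. (- \<i>) *s (g x + a x *\<^sub>R z x + V x *v v x))" "z 0 = z (2*pi)"
    using assms unfolding schr_pair_def by blast+
  have "ac_deriv (\<lambda>x. w x + z x) (\<lambda>x. (- \<i>) *s (f x + g x + a x *\<^sub>R (w x + z x) + V x *v (u x + v x)))"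
    by (rule ac_deriv_eq[OF ac_deriv_add[OF m(2,5)]], unfold matrix_vector_right_distrib)
       (simp add: scaleR_eq_smult vec_eq_iff algebra_simps)
  then show ?thesis using m(3,6) mag_pair_add[OF m(1,4)] unfolding schr_pair_def by simp
qed

text \<open>Solutions are determined on [0, 2 pi] only, so identities valid there must be enough to
  exchange one function for another.\<close>

lemma schr_pair_cong:
  assumes "schr_pair a V u w f" "\<And>x. x \<in> circ \<Longrightarrow> v x = u x" "\<And>x. x \<in> circ \<Longrightarrow> g x = f x"
  shows "schr_pair a V v w g"
proof -
  have m: "ac_deriv u (\<lambda>x. (- \<i>) *s (w x + a x *\<^sub>R u x))" "u 0 = u (2*pi)" "continuous_on circ w"
    "ac_deriv w (\<lambda>x. (- \<i>) *s (f x + a x *\<^sub>R w x + V x *v u x))" "w 0 = w (2*pi)"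
    using assms(1) unfolding schr_pair_def mag_pair_def by blast+
  have "ac_deriv v (\<lambda>x. (- \<i>) *s (w x + a x *\<^sub>R v x))"
    by (rule ac_deriv_cong_AE[OF m(1) negligible_empty]) (simp_all only: assms(2))
  moreover have "ac_deriv w (\<lambda>x. (- \<i>) *s (g x + a x *\<^sub>R w x + V x *v v x))"
    by (rule ac_deriv_cong_AE[OF m(4) negligible_empty]) (simp_all only: assms(2,3))
  moreover have "v 0 = u 0" "v (2*pi) = u (2*pi)" using assms(2) by auto
  ultimately show ?thesis using m(2,3,5) unfolding schr_pair_def mag_pair_def by simp
qed

lemma eig_pair_smult: "eig_pair a V \<mu> u w \<Longrightarrow> eig_pair a V \<mu> (\<lambda>x. c *s u x) (\<lambda>x. c *s w x)"
  by (drule schr_pair_smult[where c = c], erule schr_pair_cong) (auto simp: vec_eq_iff)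

lemma eig_pair_add: "eig_pair a V \<mu> u w \<Longrightarrow> eig_pair a V \<mu> v z \<Longrightarrow> eig_pair a V \<mu> (\<lambda>x. u x + v x) (\<lambda>x. w x + z x)"
  by (drule (1) schr_pair_add, erule schr_pair_cong) (auto simp: vec_eq_iff algebra_simps)

lemma eig_pair_zero: "eig_pair a V \<mu> (\<lambda>x. 0) (\<lambda>x. 0)"
  by (simp add: schr_pair_def mag_pair_zero ac_deriv_const)

lemma eig_pair_sum:
  assumes "\<And>k. k \<in> S \<Longrightarrow> eig_pair a V \<mu> (u k) (w k)" "finite S"
  shows "eig_pair a V \<mu> (\<lambda>x. \<Sum>k\<in>S. u k x) (\<lambda>x. \<Sum>k\<in>S. w k x)"
  using assms(2,1)
proof (induction S)
  case (insert k S)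
  have "eig_pair a V \<mu> (\<lambda>x. u k x + (\<Sum>k\<in>S. u k x)) (\<lambda>x. w k x + (\<Sum>k\<in>S. w k x))"
    using insert by (intro eig_pair_add) auto
  then show ?case using insert by simp
qed (simp add: schr_pair_def mag_pair_zero ac_deriv_const)

section \<open>The L2 inner product and integration by parts\<close>

definition L2ip :: "(real \<Rightarrow> complex^'m::finite) \<Rightarrow> (real \<Rightarrow> complex^'m) \<Rightarrow> complex" where
  "L2ip u v = integral circ (\<lambda>x. cip (u x) (v x))"

lemma continuous_on_cip:
  "continuous_on S f \<Longrightarrow> continuous_on S g \<Longrightarrow> continuous_on S (\<lambda>x. cip (f x) (g x))"
  by (rule bounded_bilinear.continuous_on[OF bounded_bilinear_cip])

lemma integrable_cip:
  "continuous_on circ f \<Longrightarrow> continuous_on circ g \<Longrightarrow> (\<lambda>x. cip (f x) (g x)) integrable_on circ"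
  by (intro integrable_continuous_real continuous_on_cip)

lemma L2ip_self: "continuous_on circ u \<Longrightarrow> L2ip u u = complex_of_real (sqnorm u)"
  using integral_linear[OF integrable_continuous_real bounded_linear_of_real, of 0 "2*pi" "\<lambda>x. (norm (u x))\<^sup>2"]
  by (simp add: L2ip_def cip_self o_def continuous_intros)

lemma cnj_L2ip: "cnj (L2ip u v) = L2ip v u"
  by (simp add: L2ip_def integral_cnj cnj_cip)

lemma L2ip_sum_right:
  assumes "continuous_on circ u" "\<And>k. k \<in> S \<Longrightarrow> continuous_on circ (f k)" "finite S"
  shows "L2ip u (\<lambda>x. \<Sum>k\<in>S. c k *s f k x) = (\<Sum>k\<in>S. c k * L2ip u (f k))"
  unfolding L2ip_def cip_sum_right cip_smult_right
  using assms by (subst Henstock_Kurzweil_Integration.integral_sum) (auto intro!: integrable_on_mult_right integrable_cip)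

lemma L2ip_sum_left:
  assumes "continuous_on circ u" "\<And>k. k \<in> S \<Longrightarrow> continuous_on circ (f k)" "finite S"
  shows "L2ip (\<lambda>x. \<Sum>k\<in>S. c k *s f k x) u = (\<Sum>k\<in>S. cnj (c k) * L2ip (f k) u)"
proof -
  have "L2ip (\<lambda>x. \<Sum>k\<in>S. c k *s f k x) u = cnj (L2ip u (\<lambda>x. \<Sum>k\<in>S. c k *s f k x))" by (simp add: cnj_L2ip)
  also have "\<dots> = (\<Sum>k\<in>S. cnj (c k) * L2ip (f k) u)" by (simp add: L2ip_sum_right[OF assms] cnj_L2ip)
  finally show ?thesis .
qed

lemma L2ip_smult: "L2ip (\<lambda>x. c *s u x) v = cnj c * L2ip u v" "L2ip u (\<lambda>x. c *s v x) = c * L2ip u v"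
  by (simp_all add: L2ip_def cip_smult_left cip_smult_right)

lemma L2ip_diff_right:
  "continuous_on circ u \<Longrightarrow> continuous_on circ v \<Longrightarrow> continuous_on circ w \<Longrightarrow>
   L2ip u (\<lambda>x. v x - w x) = L2ip u v - L2ip u w"
  unfolding L2ip_def cip_diff_right by (intro integral_diff integrable_cip)

lemma sqnorm_eq_0_imp:
  assumes c: "continuous_on circ u" and 0: "sqnorm u = 0" and x: "x \<in> circ"
  shows "u x = (0 :: complex^'m::finite)"
proof -
  have "continuous_on circ (\<lambda>x. (norm (u x))\<^sup>2)" by (intro continuous_intros c)
  then have "((\<lambda>x. (norm (u x))\<^sup>2) has_integral 0) (cbox 0 (2*pi))"
    using integrable_integral[OF integrable_continuous_real] 0 by fastforce
  with _ _ have "(norm (u x))\<^sup>2 = 0"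
    by (rule has_integral_0_cbox_imp_0) (use x c in \<open>auto intro!: continuous_intros simp: not_le[THEN iffD2, OF pi_gt_zero]\<close>)
  then show ?thesis by simp
qed

lemma sqnorm_pos:
  "continuous_on circ u \<Longrightarrow> x \<in> circ \<Longrightarrow> u x \<noteq> 0 \<Longrightarrow> 0 < sqnorm u"
  using sqnorm_eq_0_imp[of u x] sqnorm_nonneg[of u] by fastforce

lemma integrable_V_cip:
  fixes V :: "real \<Rightarrow> complex^'m::finite^'m"
  assumes V: "V absolutely_integrable_on circ" and c: "continuous_on circ u" "continuous_on circ v"
  shows "(\<lambda>x. cip (u x) (V x *v v x)) integrable_on circ"
proof -
  have "(\<lambda>x. V x *v v x) absolutely_integrable_on circ"
    by (rule absint_bilinear_continuous(1)[OF bounded_bilinear_matvec V c(2)])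
  then show ?thesis
    using absint_bilinear_continuous(2)[OF bounded_bilinear.flip[OF bounded_bilinear_cip] _ c(1)] by simp
qed

text \<open>Integration by parts for A = i d/dx - a: the derivative of
  \<open>cip (u x) (z x)\<close> is i times the difference of the integrands, the real
  \<open>a\<close> cancelling, and its integral is 0 by periodicity. In operator terms, <Au, Av> =
  <u, (H + V) v>.\<close>

lemma form_identity:
  fixes V :: "real \<Rightarrow> complex^'m::finite^'m"
  assumes V: "V absolutely_integrable_on circ"
    and m: "mag_pair a u w" and s: "schr_pair a V v z f" and f: "continuous_on circ f"
  shows "L2ip w z = L2ip u f + integral circ (\<lambda>x. cip (u x) (V x *v v x))"
proof -
  have s': "mag_pair a v z" using s by (simp add: schr_pair_def)
  note c = mag_pair_continuous[OF m] mag_pair_continuous[OF s']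
  have "ac_deriv (\<lambda>x. cip (u x) (z x)) (\<lambda>x. cip ((- \<i>) *s (w x + a x *\<^sub>R u x)) (z x)
      + cip (u x) ((- \<i>) *s (f x + a x *\<^sub>R z x + V x *v v x)))"
    using m s by (intro ac_deriv_bilinear bounded_bilinear_cip) (auto simp: mag_pair_def schr_pair_def)
  moreover have "cip ((- \<i>) *s (w x + a x *\<^sub>R u x)) (z x) + cip (u x) ((- \<i>) *s (f x + a x *\<^sub>R z x + V x *v v x))
     = \<i> * (cip (w x) (z x) - (cip (u x) (f x) + cip (u x) (V x *v v x)))" for x
    unfolding scaleR_eq_smult cip_smult_left cip_smult_right cip_add_left cip_add_right by (simp add: algebra_simps)
  ultimately have "ac_deriv (\<lambda>x. cip (u x) (z x)) (\<lambda>x. \<i> * (cip (w x) (z x) - (cip (u x) (f x) + cip (u x) (V x *v v x))))" by simp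
  from ac_deriv_integral[OF this] have "integral circ (\<lambda>x. \<i> * (cip (w x) (z x) - (cip (u x) (f x) + cip (u x) (V x *v v x)))) = 0"
    using m s by (simp add: mag_pair_def schr_pair_def)
  then have "integral circ (\<lambda>x. cip (w x) (z x) - (cip (u x) (f x) + cip (u x) (V x *v v x))) = 0" by simp
  also have "integral circ (\<lambda>x. cip (w x) (z x) - (cip (u x) (f x) + cip (u x) (V x *v v x)))
     = L2ip w z - integral circ (\<lambda>x. cip (u x) (f x) + cip (u x) (V x *v v x))"
    unfolding L2ip_def by (intro integral_diff integrable_add integrable_cip integrable_V_cip V c f)
  also have "integral circ (\<lambda>x. cip (u x) (f x) + cip (u x) (V x *v v x)) = L2ip u f + integral circ (\<lambda>x. cip (u x) (V x *v v x))"
    unfolding L2ip_def by (intro integral_add integrable_cip integrable_V_cip V c f)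
  finally show ?thesis by simp
qed

section \<open>Symmetry of the operator and orthonormal eigenfunctions\<close>

locale schrodinger =
  fixes a :: "real \<Rightarrow> real" and V :: "real \<Rightarrow> complex^'m::finite^'m" and \<alpha> :: real
  assumes a_int: "a absolutely_integrable_on circ"
    and V_int: "V absolutely_integrable_on circ"
    and V_herm: "\<And>x. x \<in> circ \<Longrightarrow> herm (V x)"
    and \<alpha>_eq: "\<alpha> = integral circ a / (2*pi)"
    and \<alpha>_nonint: "\<alpha> \<notin> \<int>"
begin

definition Vform :: "(real \<Rightarrow> complex^'m) \<Rightarrow> (real \<Rightarrow> complex^'m) \<Rightarrow> complex" where
  "Vform u v = integral circ (\<lambda>x. cip (u x) (V x *v v x))"

lemma eig_pair_mag: "eig_pair a V \<mu> u w \<Longrightarrow> mag_pair a u w"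
  by (simp add: schr_pair_def)

lemmas eig_pair_continuous = mag_pair_continuous[OF eig_pair_mag]

lemma eig_form:
  assumes "mag_pair a u w" "eig_pair a V \<mu> v z"
  shows "L2ip w z = \<mu> * L2ip u v + Vform u v"
  using form_identity[OF V_int assms] eig_pair_continuous[OF assms(2)]
  by (simp add: Vform_def L2ip_smult continuous_on_smult)

lemma cnj_Vform: "cnj (Vform u v) = Vform v u"
proof -
  have "cnj (Vform u v) = integral circ (\<lambda>x. cip (V x *v v x) (u x))" by (simp add: Vform_def integral_cnj cnj_cip)
  also have "\<dots> = Vform v u" unfolding Vform_def by (intro integral_cong) (simp add: herm_cip[OF V_herm])
  finally show ?thesis .
qed

text \<open>The form <Au, Av> is evaluated through the eigenvalue equation of either function, and
  the Hermitian potential terms cancel. The case u = v makes eigenvalues real; distinct real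
  eigenvalues then give orthogonality.\<close>

lemma eig_pair_sesq:
  assumes "eig_pair a V \<mu> u w" "eig_pair a V \<nu> v z"
  shows "(\<nu> - cnj \<mu>) * L2ip u v = 0"
proof -
  have "\<nu> * L2ip u v + Vform u v = cnj (\<mu> * L2ip v u + Vform v u)"
    using eig_form[OF eig_pair_mag[OF assms(1)] assms(2)] eig_form[OF eig_pair_mag[OF assms(2)] assms(1)]
    by (metis cnj_L2ip)
  then show ?thesis by (simp add: cnj_L2ip cnj_Vform algebra_simps)
qed

lemma eigenvalue_real:
  assumes "eigenfun a V \<mu> u"
  shows "\<mu> = complex_of_real (Re \<mu>)"
proof -
  obtain w x where w: "eig_pair a V \<mu> u w" and x: "x \<in> circ" "u x \<noteq> 0" using assms eigenfun_iff by metis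
  have c: "continuous_on circ u" using eig_pair_continuous[OF w] by auto
  have "\<mu> = cnj \<mu>"
    using eig_pair_sesq[OF w w] sqnorm_pos[OF c x] by (simp add: L2ip_self[OF c])
  then show ?thesis by (simp add: complex_eq_iff)
qed

text \<open>An orthonormal system, not a basis of L2. \<open>e\<close> may repeat a value, which
  accounts for multiplicity; \<open>w k\<close> is the companion (i d/dx - a) phi_k.\<close>

definition eig_onb :: "nat \<Rightarrow> (nat \<Rightarrow> real) \<Rightarrow> (nat \<Rightarrow> real \<Rightarrow> complex^'m) \<Rightarrow> (nat \<Rightarrow> real \<Rightarrow> complex^'m) \<Rightarrow> bool" where
  "eig_onb n e \<phi> w \<longleftrightarrow> (\<forall>k<n. eig_pair a V (complex_of_real (e k)) (\<phi> k) (w k)) \<and>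
     (\<forall>j<n. \<forall>k<n. L2ip (\<phi> j) (\<phi> k) = (if j = k then 1 else 0))"

lemma eig_pair_normalise:
  assumes p: "eig_pair a V \<mu> u w" and x: "x \<in> circ" "u x \<noteq> 0"
  obtains c where "c \<noteq> 0" "L2ip (\<lambda>x. c *s u x) (\<lambda>x. c *s u x) = 1"
proof -
  have c: "continuous_on circ u" using eig_pair_continuous[OF p] by auto
  define c where "c = complex_of_real (1 / sqrt (sqnorm u))"
  have "sqnorm u > 0" using sqnorm_pos[OF c x] .
  moreover have "L2ip (\<lambda>x. c *s u x) (\<lambda>x. c *s u x) = complex_of_real (1 / sqrt (sqnorm u) * (1 / sqrt (sqnorm u)) * sqnorm u)"
    unfolding c_def L2ip_smult L2ip_self[OF c] by (simp only: complex_cnj_complex_of_real of_real_mult mult_ac)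
  ultimately show ?thesis
    by (intro that[of c]) (auto simp: c_def simp del: of_real_mult of_real_divide)
qed
end

section \<open>The Lieb-Thirring bound\<close>

text \<open>A Gram-Schmidt step. The change of coefficients from \<open>b\<close> to
  \<open>b'\<close> is triangular with diagonal entries 1 and \<open>c\<close>, hence
  injective.\<close>

lemma lin_indep_replace:
  fixes \<phi> :: "nat \<Rightarrow> real \<Rightarrow> complex^'m::finite"
  assumes li: "lin_indep n \<phi>" and m: "m < n" and c: "c \<noteq> 0"
  shows "lin_indep n (\<phi>(m := (\<lambda>x. c *s (\<phi> m x - (\<Sum>k<m. d k *s \<phi> k x)))))"
  unfolding lin_indep_def
proof (intro allI impI)
  fix b :: "nat \<Rightarrow> complex" and k
  let ?\<phi>' = "\<phi>(m := (\<lambda>x. c *s (\<phi> m x - (\<Sum>k<m. d k *s \<phi> k x))))"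
  assume z: "\<forall>x\<in>circ. (\<Sum>k<n. b k *s ?\<phi>' k x) = 0" and k: "k < n"
  define b' where "b' k = (if k = m then b m * c else b k - (if k < m then b m * c * d k else 0))" for k
  have split: "(\<Sum>k<n. f k) = f m + (\<Sum>k\<in>{..<n}-{m}. f k)" for f :: "nat \<Rightarrow> complex^'m"
    using m by (intro sum.remove) auto
  have "(\<Sum>k<n. b' k *s \<phi> k x) = 0" if x: "x \<in> circ" for x
  proof -
    have lt: "(\<Sum>k\<in>{..<n}-{m}. (if k < m then b m * c * d k else 0) *s \<phi> k x) = (b m * c) *s (\<Sum>k<m. d k *s \<phi> k x)"
    proof -
      have "(\<Sum>k\<in>{..<n}-{m}. (if k < m then b m * c * d k else 0) *s \<phi> k x) = (\<Sum>k<m. (b m * c * d k) *s \<phi> k x)"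
        using m by (intro sum.mono_neutral_cong_right) auto
      then show ?thesis by (simp add: vec.scale_sum_right mult.assoc)
    qed
    have "(\<Sum>k<n. b' k *s \<phi> k x) = (b m * c) *s \<phi> m x
       + (\<Sum>k\<in>{..<n}-{m}. b k *s \<phi> k x - (if k < m then b m * c * d k else 0) *s \<phi> k x)"
      by (subst split) (simp add: b'_def vec.scale_left_diff_distrib)
    also have "\<dots> = (b m * c) *s \<phi> m x + ((\<Sum>k\<in>{..<n}-{m}. b k *s \<phi> k x) - (b m * c) *s (\<Sum>k<m. d k *s \<phi> k x))"
      unfolding sum_subtractf lt ..
    also have "\<dots> = b m *s ?\<phi>' m x + (\<Sum>k\<in>{..<n}-{m}. b k *s ?\<phi>' k x)"
      by (simp add: vec.scale_right_diff_distrib)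
    also have "\<dots> = (\<Sum>k<n. b k *s ?\<phi>' k x)" by (rule split[symmetric])
    also have "\<dots> = 0" using z x by blast
    finally show ?thesis .
  qed
  then have b': "b' k = 0" if "k < n" for k using li that unfolding lin_indep_def by blast
  have "b m = 0" using b'[OF m] c by (simp add: b'_def)
  then show "b k = 0" using b'[OF k] by (auto simp: b'_def split: if_splits)
qed

text \<open>The constant is optimal: equality holds for N = r^3 / K^2 and K s = sqrt 3 r.\<close>
lemma young_optimal:
  fixes s r K N :: real
  assumes s: "0 \<le> s" and r: "0 \<le> r" and K: "0 < K" and N: "r ^ 3 \<le> K\<^sup>2 * N"
  shows "s\<^sup>2 * r \<le> N + 2 / (3 * sqrt 3) * K * s ^ 3"
proof -
  define q where "q = sqrt (3::real)"
  have q: "q > 0" "q\<^sup>2 = 3" by (auto simp: q_def)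
  define t where "t = K * s / q"
  have t: "0 \<le> t" using s K q by (simp add: t_def)
  \<comment> \<open>The cubic r^3 - 3 t^2 r + 2 t^3 has the double root r = t, and t = K s / sqrt 3
    is the scaling for which 3 t^2 = K^2 s^2.\<close>
  have "0 \<le> (r - t)\<^sup>2 * (r + 2 * t)" using r t by (intro mult_nonneg_nonneg) auto
  also have "\<dots> = r ^ 3 - 3 * t\<^sup>2 * r + 2 * t ^ 3" by (simp add: power2_eq_square power3_eq_cube algebra_simps)
  also have "3 * t\<^sup>2 = K\<^sup>2 * s\<^sup>2" using q by (simp add: t_def power_divide power_mult_distrib)
  also have "t ^ 3 = K\<^sup>2 * (K * s ^ 3 / (3 * q))"
    using q by (simp add: t_def power_divide power_mult_distrib) (simp add: power2_eq_square power3_eq_cube)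
  finally have "K\<^sup>2 * (s\<^sup>2 * r) \<le> K\<^sup>2 * (N + 2 * (K * s ^ 3 / (3 * q)))" using N by (simp add: algebra_simps)
  then have "s\<^sup>2 * r \<le> N + 2 * (K * s ^ 3 / (3 * q))" using K by simp
  then show ?thesis by (simp add: q_def)
qed

context schrodinger begin

text \<open>Gram-Schmidt: eigenfunctions of different eigenvalues are already orthogonal, so
  orthogonalisation never leaves an eigenspace.\<close>
lemma eig_onb_exists:
  fixes u :: "nat \<Rightarrow> real \<Rightarrow> complex^'m"
  assumes ef: "\<And>k. k < n \<Longrightarrow> eigenfun a V (complex_of_real (e k)) (u k)" and li: "lin_indep n u"
  obtains \<phi> w where "eig_onb n e \<phi> w"
proof -
  \<comment> \<open>All \<open>n\<close> functions are kept, and kept independent; only the first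
    \<open>m\<close> are orthonormal so far.\<close>
  have "\<exists>\<phi> w. lin_indep n \<phi> \<and> (\<forall>k<n. eig_pair a V (complex_of_real (e k)) (\<phi> k) (w k)) \<and>
     (\<forall>j<m. \<forall>k<m. L2ip (\<phi> j) (\<phi> k) = (if j = k then 1 else 0))" if "m \<le> n" for m
    using that
  proof (induction m)
    case 0
    have "\<forall>k. \<exists>w. k < n \<longrightarrow> eig_pair a V (complex_of_real (e k)) (u k) w" using ef eigenfun_iff by metis
    then obtain w where "\<forall>k<n. eig_pair a V (complex_of_real (e k)) (u k) (w k)" by metis
    then show ?case using li by auto
  next
    case (Suc m)
    then obtain \<phi> w where li: "lin_indep n \<phi>" and ep: "\<And>k. k < n \<Longrightarrow> eig_pair a V (complex_of_real (e k)) (\<phi> k) (w k)"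
      and on: "\<And>j k. j < m \<Longrightarrow> k < m \<Longrightarrow> L2ip (\<phi> j) (\<phi> k) = (if j = k then 1 else 0)" by auto
    have m: "m < n" using Suc.prems by simp
    define d where "d k = L2ip (\<phi> k) (\<phi> m)" for k
    define P where "P x = (\<Sum>k<m. d k *s \<phi> k x)" for x
    define \<psi> where "\<psi> x = \<phi> m x - P x" for x
    define z where "z x = w m x + (\<Sum>k<m. (- d k) *s w k x)" for x
    have cont: "continuous_on circ (\<phi> k)" if "k < n" for k using eig_pair_continuous[OF ep[OF that]] by auto
    have dz: "d k = 0 \<or> e k = e m" if "k < m" for k
      using eig_pair_sesq[OF ep[of k] ep[OF m]] that m by (auto simp: d_def)
    have summand: "eig_pair a V (complex_of_real (e m)) (\<lambda>x. (- d k) *s \<phi> k x) (\<lambda>x. (- d k) *s w k x)" if "k < m" for k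
    proof (cases "d k = 0")
      case True
      then show ?thesis using eig_pair_zero[of a V "complex_of_real (e m)"] by simp
    next
      case False
      then have "e k = e m" using dz[OF that] by simp
      then show ?thesis using eig_pair_smult[OF ep[of k], where c = "- d k"] that m by simp
    qed
    have "eig_pair a V (complex_of_real (e m)) (\<lambda>x. \<phi> m x + (\<Sum>k<m. (- d k) *s \<phi> k x)) z"
      unfolding z_def by (intro eig_pair_add ep m eig_pair_sum summand) auto
    then have \<psi>: "eig_pair a V (complex_of_real (e m)) \<psi> z"
      by (rule schr_pair_cong) (simp_all add: \<psi>_def P_def sum_negf)
    have cP: "continuous_on circ P" unfolding P_def using m cont
      by (intro continuous_intros continuous_on_smult) auto
    have orth: "L2ip (\<phi> j) \<psi> = 0" if "j < m" for j
    proof -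
      have "L2ip (\<phi> j) \<psi> = L2ip (\<phi> j) (\<phi> m) - L2ip (\<phi> j) P"
        unfolding \<psi>_def[abs_def] using that m cont cP by (intro L2ip_diff_right) auto
      also have "L2ip (\<phi> j) P = (\<Sum>k<m. d k * L2ip (\<phi> j) (\<phi> k))"
        unfolding P_def[abs_def] using that m cont by (intro L2ip_sum_right) auto
      also have "\<dots> = (\<Sum>k<m. if k = j then d j else 0)" using that by (intro sum.cong) (auto simp: on)
      also have "\<dots> = d j" using that by simp
      finally show ?thesis by (simp add: d_def)
    qed
    have "\<exists>x\<in>circ. \<psi> x \<noteq> 0"
    proof (rule ccontr)
      assume "\<not> (\<exists>x\<in>circ. \<psi> x \<noteq> 0)"
      then have z: "\<forall>x\<in>circ. 1 *s \<psi> x = 0" by simp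
      \<comment> \<open>If psi vanished on [0, 2 pi], the coefficients 1 at \<open>m\<close> and 0
        elsewhere would be a nontrivial relation among independent functions.\<close>
      have "lin_indep n (\<phi>(m := \<lambda>x. 1 *s \<psi> x))"
        unfolding \<psi>_def P_def by (rule lin_indep_replace[OF li m]) simp
      moreover define b where "b k = (if k = m then 1 else 0 :: complex)" for k
      have "\<forall>x\<in>circ. (\<Sum>k<n. b k *s (\<phi>(m := \<lambda>x. 1 *s \<psi> x)) k x) = 0"
        using z by (auto intro!: sum.neutral simp: b_def)
      ultimately have "b m = 0" using m unfolding lin_indep_def by blast
      then show False by (simp add: b_def)
    qed
    then obtain x where x: "x \<in> circ" "\<psi> x \<noteq> 0" by blast
    obtain c where c: "c \<noteq> 0" "L2ip (\<lambda>x. c *s \<psi> x) (\<lambda>x. c *s \<psi> x) = 1"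
      using eig_pair_normalise[OF \<psi> x] by metis
    define \<phi>' where "\<phi>' = \<phi>(m := \<lambda>x. c *s \<psi> x)"
    define w' where "w' = w(m := \<lambda>x. c *s z x)"
    have "lin_indep n \<phi>'" unfolding \<phi>'_def \<psi>_def P_def by (rule lin_indep_replace[OF li m c(1)])
    moreover have "\<forall>k<n. eig_pair a V (complex_of_real (e k)) (\<phi>' k) (w' k)"
      using ep eig_pair_smult[OF \<psi>, of c] by (auto simp: \<phi>'_def w'_def)
    moreover have "\<forall>j<Suc m. \<forall>k<Suc m. L2ip (\<phi>' j) (\<phi>' k) = (if j = k then 1 else 0)"
    proof (intro allI impI)
      fix j k assume jk: "j < Suc m" "k < Suc m"
      have o2: "L2ip \<psi> (\<phi> j) = 0" if "j < m" for j using orth[OF that] cnj_L2ip[of "\<phi> j" \<psi>] by simp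
      show "L2ip (\<phi>' j) (\<phi>' k) = (if j = k then 1 else 0)"
        using jk on c(2) orth o2 by (auto simp: \<phi>'_def less_Suc_eq L2ip_smult)
    qed
    ultimately show ?case by blast
  qed
  from this[of n] show ?thesis using that unfolding eig_onb_def by blast
qed

lemma eig_onbD:
  assumes "eig_onb n e \<phi> w" "k < n"
  shows "eig_pair a V (complex_of_real (e k)) (\<phi> k) (w k)" "mag_pair a (\<phi> k) (w k)"
    "continuous_on circ (\<phi> k)" "continuous_on circ (w k)"
    "j < n \<Longrightarrow> L2ip (\<phi> j) (\<phi> k) = (if j = k then 1 else 0)"
  using assms eig_pair_continuous eig_pair_mag unfolding eig_onb_def by blast+

text \<open>The Gram matrix of the \<open>\<phi> k\<close> is the identity, but that of the
  \<open>w k\<close> is in general not diagonal: by \<open>eig_form\<close> its off-diagonal entries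
  are those of the potential. The kinetic energy of a combination therefore stays a double
  sum.\<close>

lemma eig_onb_combination:
  assumes o: "eig_onb n e \<phi> w"
  defines "g \<equiv> \<lambda>c x. \<Sum>k<n. c k *s \<phi> k x" and "h \<equiv> \<lambda>c x. \<Sum>k<n. c k *s w k x"
  shows "mag_pair a (g c) (h c)" "sqnorm (g c) = (\<Sum>k<n. (cmod (c k))\<^sup>2)"
    "complex_of_real (sqnorm (h c)) = (\<Sum>j<n. \<Sum>k<n. cnj (c j) * c k * L2ip (w j) (w k))"
    "k < n \<Longrightarrow> L2ip (g c) (\<phi> k) = cnj (c k)"
proof -
  show "mag_pair a (g c) (h c)" unfolding g_def h_def by (intro mag_pair_sum eig_onbD[OF o]) auto
  have exp: "L2ip (\<lambda>x. \<Sum>k<n. c k *s f k x) (\<lambda>x. \<Sum>k<n. c k *s f k x) = (\<Sum>j<n. \<Sum>k<n. cnj (c j) * c k * L2ip (f j) (f k))"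
    if "\<And>k. k < n \<Longrightarrow> continuous_on circ (f k)" for f
  proof -
    have "L2ip (\<lambda>x. \<Sum>k<n. c k *s f k x) (\<lambda>x. \<Sum>k<n. c k *s f k x) = (\<Sum>j<n. cnj (c j) * L2ip (f j) (\<lambda>x. \<Sum>k<n. c k *s f k x))"
      using that by (intro L2ip_sum_left continuous_intros continuous_on_smult) auto
    also have "\<dots> = (\<Sum>j<n. cnj (c j) * (\<Sum>k<n. c k * L2ip (f j) (f k)))"
      using that by (intro sum.cong refl arg_cong2[of _ _ _ _ "(*)"] L2ip_sum_right) auto
    finally show ?thesis by (simp add: sum_distrib_left mult.assoc)
  qed
  have cg: "continuous_on circ (g c)" "continuous_on circ (h c)"
    using eig_onbD[OF o] unfolding g_def h_def by (auto intro!: continuous_intros continuous_on_smult)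
  have "complex_of_real (sqnorm (g c)) = (\<Sum>j<n. \<Sum>k<n. cnj (c j) * c k * L2ip (\<phi> j) (\<phi> k))"
    unfolding L2ip_self[OF cg(1), symmetric] unfolding g_def by (rule exp) (rule eig_onbD[OF o])
  also have "\<dots> = (\<Sum>j<n. \<Sum>k<n. if k = j then cnj (c j) * c j else 0)"
    using eig_onbD(5)[OF o] by (intro sum.cong refl) auto
  also have "\<dots> = complex_of_real (\<Sum>k<n. (cmod (c k))\<^sup>2)"
    by (simp add: complex_norm_square mult.commute del: of_real_power)
  finally show "sqnorm (g c) = (\<Sum>k<n. (cmod (c k))\<^sup>2)" by (simp only: of_real_eq_iff)
  show "complex_of_real (sqnorm (h c)) = (\<Sum>j<n. \<Sum>k<n. cnj (c j) * c k * L2ip (w j) (w k))"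
    unfolding L2ip_self[OF cg(2), symmetric] unfolding h_def by (rule exp) (rule eig_onbD[OF o])
  assume k: "k < n"
  have "L2ip (g c) (\<phi> k) = (\<Sum>j<n. cnj (c j) * L2ip (\<phi> j) (\<phi> k))"
    unfolding g_def using k eig_onbD(3)[OF o] by (intro L2ip_sum_left) auto
  also have "\<dots> = (\<Sum>j<n. if j = k then cnj (c k) else 0)"
    using k eig_onbD(5)[OF o] by (intro sum.cong refl) auto
  finally show "L2ip (g c) (\<phi> k) = cnj (c k)" using k by simp
qed

lemma Kconst_pos: "0 < Kconst \<alpha>"
  using Kconst_bound(1)[OF \<alpha>_nonint, of 1] by simp

text \<open>At a fixed x, test the interpolation inequality on g_i = sum_k <phi_k(x), e_i> phi_k for an
  eigenbasis e_i of V(x); the value <e_i, g_i(x)> equals the squared L2 norm of g_i.\<close>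
lemma pointwise_lieb_thirring:
  assumes o: "eig_onb n e \<phi> w" and x: "x \<in> circ" and psd: "psd (V x)"
  shows "Re (\<Sum>k<n. cip (\<phi> k x) (V x *v \<phi> k x))
     \<le> Re (\<Sum>j<n. \<Sum>k<n. cip (\<phi> k x) (\<phi> j x) * L2ip (w j) (w k)) + 2 / (3 * sqrt 3) * Kconst \<alpha> * tr32 (V x)"
proof -
  obtain b :: "'m \<Rightarrow> complex^'m" and s where b: "orthonormal b UNIV" and s: "\<And>i. 0 \<le> s i"
    and Vb: "\<And>i. V x *v b i = complex_of_real ((s i)\<^sup>2) *s b i" and tr: "tr32 (V x) = (\<Sum>i\<in>UNIV. s i ^ 3)"
    using psd_spectral[OF V_herm[OF x] psd] by blast
  \<comment> \<open>With these coefficients \<open>g i\<close> represents the functional g -> <b i,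
    g(x)> on the span of the \<open>\<phi> k\<close>; among functions of the same norm it has the
    largest \<open>b i\<close> component at x.\<close>
  define c where "c i k = cip (\<phi> k x) (b i)" for i k
  define g where "g i y = (\<Sum>k<n. c i k *s \<phi> k y)" for i y
  define h where "h i y = (\<Sum>k<n. c i k *s w k y)" for i y
  define r where "r i = (\<Sum>k<n. (cmod (c i k))\<^sup>2)" for i
  define N where "N i = sqnorm (h i)" for i
  have r0: "0 \<le> r i" for i unfolding r_def by (intro sum_nonneg) auto
  have mp: "mag_pair a (g i) (h i)" for i
    unfolding g_def[abs_def] h_def[abs_def] by (rule eig_onb_combination(1)[OF o])
  have rg: "sqnorm (g i) = r i" for i
    unfolding g_def r_def by (rule eig_onb_combination(2)[OF o])
  have Ni: "complex_of_real (N i) = (\<Sum>j<n. \<Sum>k<n. cnj (c i j) * c i k * L2ip (w j) (w k))" for i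
    unfolding N_def h_def by (rule eig_onb_combination(3)[OF o])
  have r3: "r i ^ 3 \<le> (Kconst \<alpha>)\<^sup>2 * N i" for i
  proof (cases "r i = 0")
    case True
    then show ?thesis unfolding N_def using mag_pair_continuous(2)[OF mp] by (simp add: sqnorm_nonneg)
  next
    case False
    then have rp: "r i > 0" using r0[of i] by simp
    have "cip (b i) (g i x) = (\<Sum>k<n. c i k * cip (b i) (\<phi> k x))"
      by (simp add: g_def cip_sum_right cip_smult_right)
    also have "\<dots> = complex_of_real (r i)"
      unfolding r_def of_real_sum by (intro sum.cong refl) (simp only: complex_norm_square c_def cnj_cip)
    finally have "r i = cmod (cip (b i) (g i x))" using r0[of i] by simp
    also have "\<dots> \<le> norm (g i x)" using norm_cip_le[of "b i" "g i x"] orthonormal_norm[OF b, of i] by simp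
    finally have "r i ^ 4 \<le> norm (g i x) ^ 4" using r0 by (intro power_mono) auto
    also have "\<dots> \<le> (Kconst \<alpha>)\<^sup>2 * sqnorm (g i) * sqnorm (h i)"
      by (rule mag_pair_interpolation[OF a_int mp \<alpha>_eq \<alpha>_nonint x])
    \<comment> \<open>Cancelling one factor \<open>r i\<close> produces the cube, and with it the
      exponent 3/2 of V.\<close>
    finally have "r i * r i ^ 3 \<le> r i * ((Kconst \<alpha>)\<^sup>2 * N i)"
      unfolding rg N_def by (simp add: power4_eq_xxxx power3_eq_cube mult_ac)
    then show ?thesis using rp by simp
  qed
  \<comment> \<open>The eigenbasis \<open>b\<close> depends on x with no measurability known.
    Parseval sums it away and leaves a function continuous in x, which can be integrated.\<close>
  have sumN: "(\<Sum>i\<in>UNIV. N i) = Re (\<Sum>j<n. \<Sum>k<n. cip (\<phi> k x) (\<phi> j x) * L2ip (w j) (w k))"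
  proof -
    have "complex_of_real (\<Sum>i\<in>UNIV. N i) = (\<Sum>i\<in>UNIV. \<Sum>j<n. \<Sum>k<n. cnj (c i j) * c i k * L2ip (w j) (w k))"
      by (simp add: Ni)
    also have "\<dots> = (\<Sum>j<n. \<Sum>k<n. \<Sum>i\<in>UNIV. cnj (c i j) * c i k * L2ip (w j) (w k))"
      by (subst sum.swap, intro sum.cong refl, rule sum.swap)
    also have "\<dots> = (\<Sum>j<n. \<Sum>k<n. (\<Sum>i\<in>UNIV. cip (\<phi> k x) (b i) * cip (b i) (\<phi> j x)) * L2ip (w j) (w k))"
      unfolding sum_distrib_right c_def cnj_cip by (simp only: mult_ac)
    also have "\<dots> = (\<Sum>j<n. \<Sum>k<n. cip (\<phi> k x) (\<phi> j x) * L2ip (w j) (w k))"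
      by (simp only: parseval[OF b])
    finally show ?thesis by (metis Re_complex_of_real)
  qed
  have "(\<Sum>k<n. cip (\<phi> k x) (V x *v \<phi> k x)) = (\<Sum>k<n. \<Sum>i\<in>UNIV. (s i)\<^sup>2 * (c i k * cnj (c i k)))"
    by (simp add: cip_psd_spectral[OF b Vb] c_def cnj_cip)
  also have "\<dots> = complex_of_real (\<Sum>i\<in>UNIV. (s i)\<^sup>2 * r i)"
    by (subst sum.swap) (simp add: r_def sum_distrib_left complex_norm_square[symmetric])
  finally have "Re (\<Sum>k<n. cip (\<phi> k x) (V x *v \<phi> k x)) = (\<Sum>i\<in>UNIV. (s i)\<^sup>2 * r i)" by simp
  also have "\<dots> \<le> (\<Sum>i\<in>UNIV. N i + 2 / (3 * sqrt 3) * Kconst \<alpha> * s i ^ 3)"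
    by (intro sum_mono young_optimal s r0 Kconst_pos r3)
  also have "\<dots> = (\<Sum>i\<in>UNIV. N i) + 2 / (3 * sqrt 3) * Kconst \<alpha> * tr32 (V x)"
    by (simp add: sum.distrib tr sum_distrib_left)
  finally show ?thesis unfolding sumN .
qed

text \<open>Integration of the pointwise bound turns \<open>cip (\<phi> k x) (\<phi> j x)\<close>
  into Kronecker deltas and leaves the sum of <w j, w j>. By \<open>eig_form\<close> this is the sum
  of the \<open>e j\<close> plus the potential energy, which also stands on the left and
  cancels.\<close>

lemma lieb_thirring:
  assumes o: "eig_onb n e \<phi> w" and psd: "\<And>x. x \<in> circ \<Longrightarrow> psd (V x)"
    and tr: "(\<lambda>x. tr32 (V x)) integrable_on circ"
  shows "- (\<Sum>k<n. e k) \<le> 2 / (3 * sqrt 3) * Kconst \<alpha> * integral circ (\<lambda>x. tr32 (V x))"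
proof -
  define C where "C = 2 / (3 * sqrt 3) * Kconst \<alpha>"
  have iV: "(\<lambda>x. cip (\<phi> k x) (V x *v \<phi> k x)) integrable_on circ" if "k < n" for k
    using eig_onbD[OF o that] by (intro integrable_V_cip V_int)
  have ic: "(\<lambda>x. cip (\<phi> k x) (\<phi> j x)) integrable_on circ" if "k < n" "j < n" for j k
    using that eig_onbD[OF o] by (intro integrable_cip) auto
  have iV': "(\<lambda>x. \<Sum>k<n. cip (\<phi> k x) (V x *v \<phi> k x)) integrable_on circ"
    using iV by (intro Henstock_Kurzweil_Integration.integrable_sum) auto
  have ic': "(\<lambda>x. \<Sum>j<n. \<Sum>k<n. cip (\<phi> k x) (\<phi> j x) * L2ip (w j) (w k)) integrable_on circ"
    using ic by (intro Henstock_Kurzweil_Integration.integrable_sum integrable_on_mult_left) auto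
  have Re_int: "integral circ (\<lambda>x. Re (f x)) = Re (integral circ f)" "(\<lambda>x. Re (f x)) integrable_on circ"
    if "f integrable_on circ" for f :: "real \<Rightarrow> complex"
    using integral_linear[OF that bounded_linear_Re] integrable_linear[OF that bounded_linear_Re] by (simp_all add: o_def)
  have "Re (\<Sum>k<n. Vform (\<phi> k) (\<phi> k)) = Re (integral circ (\<lambda>x. \<Sum>k<n. cip (\<phi> k x) (V x *v \<phi> k x)))"
    unfolding Vform_def using iV by (subst Henstock_Kurzweil_Integration.integral_sum) auto
  also have "\<dots> = integral circ (\<lambda>x. Re (\<Sum>k<n. cip (\<phi> k x) (V x *v \<phi> k x)))"
    by (rule Re_int(1)[OF iV', symmetric])
  also have "\<dots> \<le> integral circ (\<lambda>x. Re (\<Sum>j<n. \<Sum>k<n. cip (\<phi> k x) (\<phi> j x) * L2ip (w j) (w k)) + C * tr32 (V x))"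
    unfolding C_def
    by (intro integral_le integrable_add integrable_on_mult_right Re_int(2) iV' ic' tr pointwise_lieb_thirring[OF o] psd)
  also have "\<dots> = Re (integral circ (\<lambda>x. \<Sum>j<n. \<Sum>k<n. cip (\<phi> k x) (\<phi> j x) * L2ip (w j) (w k))) + C * integral circ (\<lambda>x. tr32 (V x))"
    by (subst integral_add) (auto intro!: Re_int integrable_on_mult_right ic' tr simp del: Re_sum)
  also have "integral circ (\<lambda>x. \<Sum>j<n. \<Sum>k<n. cip (\<phi> k x) (\<phi> j x) * L2ip (w j) (w k))
     = (\<Sum>j<n. \<Sum>k<n. L2ip (\<phi> k) (\<phi> j) * L2ip (w j) (w k))"
  proof -
    have "integral circ (\<lambda>x. \<Sum>j<n. \<Sum>k<n. cip (\<phi> k x) (\<phi> j x) * L2ip (w j) (w k))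
      = (\<Sum>j<n. integral circ (\<lambda>x. \<Sum>k<n. cip (\<phi> k x) (\<phi> j x) * L2ip (w j) (w k)))"
      using ic by (intro Henstock_Kurzweil_Integration.integral_sum Henstock_Kurzweil_Integration.integrable_sum integrable_on_mult_left) auto
    also have "\<dots> = (\<Sum>j<n. \<Sum>k<n. integral circ (\<lambda>x. cip (\<phi> k x) (\<phi> j x) * L2ip (w j) (w k)))"
      using ic by (intro sum.cong refl Henstock_Kurzweil_Integration.integral_sum integrable_on_mult_left) auto
    finally show ?thesis by (simp add: L2ip_def)
  qed
  also have "\<dots> = (\<Sum>j<n. \<Sum>k<n. if k = j then L2ip (w j) (w j) else 0)"
    using eig_onbD(5)[OF o] by (intro sum.cong refl) auto
  also have "\<dots> = (\<Sum>j<n. complex_of_real (e j) + Vform (\<phi> j) (\<phi> j))"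
    using eig_form[OF eig_onbD(2)[OF o] eig_onbD(1)[OF o]] eig_onbD(5)[OF o] by simp
  finally show ?thesis by (simp add: sum.distrib C_def)
qed
end

section \<open>The spectrum\<close>

context schrodinger begin

text \<open>With G the squared norm of a combination g of eigenfunctions with eigenvalues at most E,
  the form identity and interpolation bound the kinetic energy by C G, hence |g(x)|^2 by a multiple
  of G; testing with g = sum_k conj(phi_k(x)_i) phi_k bounds the sum of |phi_k(x)_i|^2.\<close>
lemma eig_onb_count_bound:
  "\<exists>N. \<forall>n e \<phi> w. eig_onb n e \<phi> w \<and> (\<forall>k<n. e k \<le> E) \<longrightarrow> n \<le> N"
proof -
  \<comment> \<open>The maximum with 0 keeps \<open>C\<close> nonnegative for negative
    \<open>E\<close>.\<close>
  define E' where "E' = max E 0"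
  obtain B where B: "B > 0" "\<And>x (y::complex^'m). norm (V x *v y) \<le> norm (V x) * norm y * B"
    using bounded_bilinear.pos_bounded[OF bounded_bilinear_matvec] by metis
  define v where "v = B * integral circ (\<lambda>x. norm (V x))"
  have nV: "(\<lambda>x. norm (V x)) integrable_on circ"
    using absolutely_integrable_norm[OF V_int] absolutely_integrable_on_def unfolding o_def by blast
  have v0: "0 \<le> v" unfolding v_def using B(1) by (intro mult_nonneg_nonneg integral_nonneg nV) auto
  define K where "K = Kconst \<alpha>"
  have K: "K > 0" unfolding K_def by (rule Kconst_pos)
  \<comment> \<open>For kinetic energy \<open>W\<close> and squared norm \<open>G\<close>, this
    results from W <= E' G + v K sqrt (G W) when AM-GM moves half of \<open>W\<close> to the
    left.\<close>
  define C where "C = 2 * E' + v\<^sup>2 * K\<^sup>2"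
  have C: "C \<ge> 0" by (simp add: C_def E'_def)
  define D where "D = K * sqrt C"
  have bound: "real n \<le> 2 * pi * (CARD('m) * D)" if o: "eig_onb n e \<phi> w" and e: "\<And>k. k < n \<Longrightarrow> e k \<le> E" for n e \<phi> w
  proof -
    have comb: "norm (\<Sum>k<n. c k *s \<phi> k x) ^ 4 \<le> K\<^sup>2 * C * (\<Sum>k<n. (cmod (c k))\<^sup>2)\<^sup>2" if x: "x \<in> circ" for c x
    proof -
      define g where "g x = (\<Sum>k<n. c k *s \<phi> k x)" for x
      define h where "h x = (\<Sum>k<n. c k *s w k x)" for x
      define G where "G = (\<Sum>k<n. (cmod (c k))\<^sup>2)"
      define W where "W = sqnorm h"
      have mp: "mag_pair a g h" unfolding g_def[abs_def] h_def[abs_def] by (rule eig_onb_combination(1)[OF o])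
      have gG: "sqnorm g = G" unfolding g_def G_def by (rule eig_onb_combination(2)[OF o])
      have gphi: "L2ip g (\<phi> k) = cnj (c k)" if "k < n" for k unfolding g_def by (rule eig_onb_combination(4)[OF o that])
      note cg = mag_pair_continuous[OF mp]
      have G0: "0 \<le> G" unfolding G_def by (intro sum_nonneg) auto
      have W0: "0 \<le> W" unfolding W_def by (intro sqnorm_nonneg cg)
      have int4: "norm (g y) ^ 4 \<le> K\<^sup>2 * G * W" if "y \<in> circ" for y
        using mag_pair_interpolation[OF a_int mp \<alpha>_eq \<alpha>_nonint that] by (simp add: K_def gG W_def)
      define s where "s = K * sqrt (G * W)"
      have s2: "(norm (g y))\<^sup>2 \<le> s" if "y \<in> circ" for y
      proof (rule power2_le_imp_le)
        show "((norm (g y))\<^sup>2)\<^sup>2 \<le> s\<^sup>2" using int4[OF that] G0 W0 by (simp add: s_def power_mult_distrib mult.assoc)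
        show "0 \<le> s" using K G0 W0 by (simp add: s_def)
      qed
      have "complex_of_real W = L2ip h h" unfolding W_def using L2ip_self[OF cg(2)] by simp
      also have "\<dots> = (\<Sum>k<n. c k * L2ip h (w k))"
      proof -
        have "L2ip h (\<lambda>x. \<Sum>k<n. c k *s w k x) = (\<Sum>k<n. c k * L2ip h (w k))"
          using eig_onbD(4)[OF o] cg(2) by (intro L2ip_sum_right) auto
        then show ?thesis unfolding h_def[abs_def, symmetric] .
      qed
      also have "\<dots> = (\<Sum>k<n. c k * (complex_of_real (e k) * cnj (c k) + Vform g (\<phi> k)))"
        using eig_form[OF mp eig_onbD(1)[OF o]] by (intro sum.cong refl) (simp add: gphi)
      also have "\<dots> = complex_of_real (\<Sum>k<n. e k * (cmod (c k))\<^sup>2) + (\<Sum>k<n. c k * Vform g (\<phi> k))"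
        unfolding distrib_left sum.distrib of_real_sum of_real_mult complex_norm_square by (simp only: mult_ac)
      also have "(\<Sum>k<n. c k * Vform g (\<phi> k)) = Vform g g"
      proof -
        have "Vform g g = integral circ (\<lambda>x. \<Sum>k<n. c k * cip (g x) (V x *v \<phi> k x))"
          unfolding Vform_def
          by (intro integral_cong) (simp add: g_def[of _] linear_sum[OF matrix_vector_mul_linear] matvec_smult cip_sum_right[symmetric] cip_smult_right[symmetric])
        also have "\<dots> = (\<Sum>k<n. c k * Vform g (\<phi> k))"
          unfolding Vform_def using eig_onbD(3)[OF o] cg(1)
          by (subst Henstock_Kurzweil_Integration.integral_sum) (auto intro!: integrable_on_mult_right integrable_V_cip V_int)
        finally show ?thesis by simp
      qed
      finally have "complex_of_real W = complex_of_real (\<Sum>k<n. e k * (cmod (c k))\<^sup>2) + Vform g g" .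
      then have "W = (\<Sum>k<n. e k * (cmod (c k))\<^sup>2) + Re (Vform g g)"
        by (metis Re_complex_of_real plus_complex.sel(1))
      also have "(\<Sum>k<n. e k * (cmod (c k))\<^sup>2) \<le> (\<Sum>k<n. E' * (cmod (c k))\<^sup>2)"
        using e by (intro sum_mono mult_right_mono) (auto simp: E'_def le_max_iff_disj)
      also have "\<dots> = E' * G" by (simp add: G_def sum_distrib_left)
      also have "Re (Vform g g) \<le> s * v"
      proof -
        have "Re (Vform g g) \<le> norm (Vform g g)" by (rule complex_Re_le_cmod)
        also have "\<dots> \<le> (s * B) * integral circ (\<lambda>x. norm (V x))"
          unfolding Vform_def
        proof (rule norm_integral_le_const[OF _ nV])
          show "(\<lambda>x. cip (g x) (V x *v g x)) integrable_on circ" by (intro integrable_V_cip V_int cg)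
          fix y assume y: "y \<in> circ"
          have "norm (cip (g y) (V y *v g y)) \<le> norm (g y) * norm (V y *v g y)" by (rule norm_cip_le)
          also have "\<dots> \<le> norm (g y) * (norm (V y) * norm (g y) * B)" by (intro mult_left_mono B(2)) auto
          also have "\<dots> = (norm (g y))\<^sup>2 * (B * norm (V y))" by (simp add: power2_eq_square mult_ac)
          also have "\<dots> \<le> s * (B * norm (V y))" using s2[OF y] B(1) by (intro mult_right_mono) auto
          finally show "norm (cip (g y) (V y *v g y)) \<le> s * B * norm (V y)" by (simp add: mult_ac)
        qed
        finally show ?thesis by (simp add: v_def mult_ac)
      qed
      finally have W1: "W \<le> E' * G + s * v" by simp
      have "s * v \<le> (v\<^sup>2 * K\<^sup>2 * G + W) / 2"
      proof -
        have "0 \<le> (v * K * sqrt G - sqrt W)\<^sup>2" by simp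
        also have "\<dots> = (v * K)\<^sup>2 * (sqrt G)\<^sup>2 + (sqrt W)\<^sup>2 - 2 * (v * (K * (sqrt G * sqrt W)))"
          by (simp add: power2_eq_square algebra_simps)
        also have "\<dots> = v\<^sup>2 * K\<^sup>2 * G + W - 2 * (s * v)"
          using G0 W0 by (simp add: s_def real_sqrt_mult power_mult_distrib)
        finally show ?thesis by simp
      qed
      with W1 have WC: "W \<le> C * G" by (simp add: C_def algebra_simps)
      have "norm (g x) ^ 4 \<le> K\<^sup>2 * G * W" by (rule int4[OF x])
      also have "\<dots> \<le> K\<^sup>2 * G * (C * G)" using WC G0 by (intro mult_left_mono) auto
      also have "\<dots> = K\<^sup>2 * C * G\<^sup>2" by (simp add: power2_eq_square)
      finally show ?thesis by (simp add: g_def G_def)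
    qed
    have comp: "(\<Sum>k<n. (cmod (\<phi> k x $ i))\<^sup>2) \<le> D" if x: "x \<in> circ" for x i
    proof -
      define G where "G = (\<Sum>k<n. (cmod (\<phi> k x $ i))\<^sup>2)"
      have G0: "0 \<le> G" unfolding G_def by (intro sum_nonneg) auto
      have D0: "0 \<le> D" using K C by (simp add: D_def)
      let ?g = "\<Sum>k<n. cnj (\<phi> k x $ i) *s \<phi> k x"
      have "?g $ i = complex_of_real G"
        unfolding G_def of_real_sum complex_norm_square by (simp add: mult.commute)
      then have "G \<le> norm ?g" using G0 Finite_Cartesian_Product.norm_nth_le[of ?g i] by simp
      then have "G ^ 4 \<le> norm ?g ^ 4" using G0 by (intro power_mono) auto
      also have "\<dots> \<le> K\<^sup>2 * C * G\<^sup>2" using comb[OF x, of "\<lambda>k. cnj (\<phi> k x $ i)"] by (simp add: G_def)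
      also have "K\<^sup>2 * C = D\<^sup>2" using C by (simp add: D_def power_mult_distrib)
      finally have "(G\<^sup>2)\<^sup>2 \<le> (D * G)\<^sup>2" by (simp add: power_mult_distrib)
      then have "G\<^sup>2 \<le> D * G" using D0 G0 by (intro power2_le_imp_le[of "G\<^sup>2" "D * G"]) auto
      then show ?thesis using G0 D0 unfolding G_def[symmetric]
        by (cases "G = 0") (auto simp: power2_eq_square)
    qed
    have pt: "(\<Sum>k<n. (norm (\<phi> k x))\<^sup>2) \<le> CARD('m) * D" if x: "x \<in> circ" for x
    proof -
      have "(\<Sum>k<n. (norm (\<phi> k x))\<^sup>2) = (\<Sum>k<n. \<Sum>i\<in>UNIV. (cmod (\<phi> k x $ i))\<^sup>2)"
        by (simp add: norm_vec_def L2_set_def sum_nonneg)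
      also have "\<dots> = (\<Sum>i\<in>UNIV. \<Sum>k<n. (cmod (\<phi> k x $ i))\<^sup>2)" by (rule sum.swap)
      also have "\<dots> \<le> (\<Sum>i\<in>(UNIV::'m set). D)" by (intro sum_mono comp x)
      finally show ?thesis by simp
    qed
    have s1: "sqnorm (\<phi> k) = 1" if "k < n" for k
    proof -
      have "complex_of_real (sqnorm (\<phi> k)) = 1"
        using L2ip_self[OF eig_onbD(3)[OF o that]] eig_onbD(5)[OF o that that] by simp
      then show ?thesis by (simp only: of_real_eq_1_iff)
    qed
    have ik: "(\<lambda>x. (norm (\<phi> k x))\<^sup>2) integrable_on circ" if "k < n" for k
      using eig_onbD(3)[OF o that] by (intro integrable_continuous_real continuous_intros)
    \<comment> \<open>The number of functions is the integral of the sum of |phi_k|^2, whose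
      integrand \<open>pt\<close> bounds uniformly.\<close>
    have "real n = (\<Sum>k<n. sqnorm (\<phi> k))" by (simp add: s1)
    also have "\<dots> = integral circ (\<lambda>x. \<Sum>k<n. (norm (\<phi> k x))\<^sup>2)"
      using ik by (subst Henstock_Kurzweil_Integration.integral_sum) auto
    also have "\<dots> \<le> integral circ (\<lambda>x. CARD('m) * D)"
      using ik pt by (intro integral_le Henstock_Kurzweil_Integration.integrable_sum) auto
    finally show ?thesis by (simp add: mult_ac)
  qed
  show ?thesis
  proof (intro exI allI impI)
    fix n e \<phi> w assume h: "eig_onb n e \<phi> w \<and> (\<forall>k<n. e k \<le> E)"
    then have "real n \<le> 2 * pi * (CARD('m) * D)" using bound by blast
    then show "n \<le> nat \<lceil>2 * pi * (CARD('m) * D)\<rceil>" by linarith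
  qed
qed

text \<open>Eigenfunctions of distinct eigenvalues are orthogonal, so one normalised eigenfunction
  per eigenvalue gives an orthonormal system, whose size \<open>eig_onb_count_bound\<close>
  limits.\<close>

lemma finite_eigenvalues_below:
  "finite {\<mu>. (\<exists>u. eigenfun a V \<mu> u) \<and> Re \<mu> \<le> E}" (is "finite ?X")
proof (rule ccontr)
  assume inf: "infinite ?X"
  obtain N where N: "\<And>n e \<phi> w. eig_onb n e \<phi> w \<Longrightarrow> (\<forall>k<n. e k \<le> E) \<Longrightarrow> n \<le> N"
    using eig_onb_count_bound by metis
  obtain T where T: "T \<subseteq> ?X" "finite T" "card T = Suc N" using infinite_arbitrarily_large[OF inf] by metis
  obtain \<mu> where \<mu>: "bij_betw \<mu> {..<Suc N} T"
    using T by (metis bij_betw_iff_card card_lessThan finite_lessThan)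
  have "\<exists>\<phi> w. eig_pair a V (\<mu> k) \<phi> w \<and> L2ip \<phi> \<phi> = 1" if "k < Suc N" for k
  proof -
    have "\<mu> k \<in> ?X" using \<mu> T(1) that by (auto dest: bij_betwE)
    then obtain u where "eigenfun a V (\<mu> k) u" by auto
    then obtain w x where u: "eig_pair a V (\<mu> k) u w" and x: "x \<in> circ" "u x \<noteq> 0" unfolding eigenfun_iff by blast
    obtain c where "L2ip (\<lambda>x. c *s u x) (\<lambda>x. c *s u x) = 1" using eig_pair_normalise[OF u x] by metis
    then show ?thesis using eig_pair_smult[OF u] by blast
  qed
  then obtain \<phi> w where ep: "\<And>k. k < Suc N \<Longrightarrow> eig_pair a V (\<mu> k) (\<phi> k) (w k)"
     and n1: "\<And>k. k < Suc N \<Longrightarrow> L2ip (\<phi> k) (\<phi> k) = 1" by metis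
  have re: "\<mu> k = complex_of_real (Re (\<mu> k))" and le: "Re (\<mu> k) \<le> E" if "k < Suc N" for k
  proof -
    have "\<mu> k \<in> ?X" using \<mu> T(1) that by (auto dest: bij_betwE)
    then show "\<mu> k = complex_of_real (Re (\<mu> k))" "Re (\<mu> k) \<le> E" using eigenvalue_real by blast+
  qed
  have "eig_onb (Suc N) (\<lambda>k. Re (\<mu> k)) \<phi> w"
    unfolding eig_onb_def
  proof (intro conjI allI impI)
    fix k assume "k < Suc N" then show "eig_pair a V (complex_of_real (Re (\<mu> k))) (\<phi> k) (w k)"
      using ep[of k] re[of k] by simp
  next
    fix j k assume jk: "j < Suc N" "k < Suc N"
    show "L2ip (\<phi> j) (\<phi> k) = (if j = k then 1 else 0)"
    proof (cases "j = k")
      case False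
      then have "\<mu> j \<noteq> \<mu> k" using \<mu> jk by (auto simp: bij_betw_def inj_on_def)
      moreover have "cnj (\<mu> j) = \<mu> j" using re[OF jk(1)] by (metis complex_cnj_complex_of_real)
      ultimately show ?thesis using eig_pair_sesq[OF ep[OF jk(1)] ep[OF jk(2)]] False by auto
    qed (use n1 jk in simp)
  qed
  then have "Suc N \<le> N" using le by (intro N) auto
  then show False by simp
qed

lemma in_resolvent_if_no_eigenfun:
  assumes no: "\<not> (\<exists>u. eigenfun a V \<mu> u)"
  shows "in_resolvent a V \<mu>"
  unfolding in_resolvent_def
proof (intro allI impI)
  fix f :: "real \<Rightarrow> complex^'m" assume f: "sq_int f"
  have triv: "u x = 0" if "eig_pair a V \<mu> u w" "x \<in> circ" for u w x
    using no that eigenfun_iff by blast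
  \<comment> \<open>Absence of eigenfunctions makes \<open>u\<close> vanish; that its companion
    \<open>w\<close> vanishes too follows from the form identity, whose right-hand side is 0 for u =
    0.\<close>
  have triv2: "w x = 0" if p: "eig_pair a V \<mu> u w" and x: "x \<in> circ" for u w x
  proof -
    note c = eig_pair_continuous[OF p]
    have "Vform u u = integral circ (\<lambda>x. 0)" unfolding Vform_def
      by (intro integral_cong) (simp add: triv[OF p])
    moreover have "L2ip u u = integral circ (\<lambda>x. 0)" unfolding L2ip_def
      by (intro integral_cong) (simp add: triv[OF p])
    ultimately have "complex_of_real (sqnorm w) = 0"
      using eig_form[OF eig_pair_mag[OF p] p] L2ip_self[OF c(2)] by simp
    then have "sqnorm w = 0" by (simp only: of_real_eq_0_iff)
    then show ?thesis by (rule sqnorm_eq_0_imp[OF c(2) _ x])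
  qed
  have fi: "f absolutely_integrable_on circ"
  proof (rule measurable_bounded_by_integrable_imp_absolutely_integrable)
    show "f \<in> borel_measurable (lebesgue_on circ)" using f by (simp add: sq_int_def)
    have "(\<lambda>x. (norm (f x))\<^sup>2) integrable_on circ"
      using f by (intro integrable_on_lebesgue_on) (auto simp: sq_int_def)
    then show "(\<lambda>x. 1 + (norm (f x))\<^sup>2) integrable_on circ" by (intro integrable_add) auto
    show "norm (f x) \<le> 1 + (norm (f x))\<^sup>2" for x
    proof -
      have "0 \<le> (norm (f x) - 1)\<^sup>2" by simp
      moreover have "0 \<le> (norm (f x))\<^sup>2" by simp
      ultimately show ?thesis using norm_ge_zero[of "f x"] unfolding power2_diff by (simp del: norm_ge_zero)
    qed
  qed auto
  define B where "B t y = ((- \<i>) *s (snd y + a t *\<^sub>R fst y), (- \<i>) *s (\<mu> *s fst y + a t *\<^sub>R snd y + V t *v fst y))"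
    for t and y :: "(complex^'m) \<times> (complex^'m)"
  define F where "F t = (0 :: complex^'m, (- \<i>) *s f t)" for t
  obtain C where C: "C > 0" "\<And>x (y::complex^'m). norm (V x *v y) \<le> norm (V x) * norm y * C"
    using bounded_bilinear.pos_bounded[OF bounded_bilinear_matvec] by metis
  \<comment> \<open>An integrable majorant of the operator norm of \<open>B t\<close>; the factor 2
    is there because \<open>a\<close> enters both components.\<close>
  define g where "g t = (1 + cmod \<mu>) + (2 * \<bar>a t\<bar> + C * norm (V t))" for t
  have sys: "schr_pair a V u w h" if "ac_deriv Y (\<lambda>t. B t (Y t) + (0, (- \<i>) *s q t))" "Y 0 = Y (2*pi)"
     "u = (\<lambda>t. fst (Y t))" "w = (\<lambda>t. snd (Y t))" "h = (\<lambda>t. q t + \<mu> *s u t)" for Y q u w h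
  proof -
    have du: "ac_deriv u (\<lambda>t. (- \<i>) *s (w t + a t *\<^sub>R u t))"
      unfolding that(3,4) by (rule ac_deriv_eq[OF ac_deriv_linear[OF bounded_linear_fst that(1)]]) (simp add: B_def)
    moreover have dw: "ac_deriv w (\<lambda>t. (- \<i>) *s (h t + a t *\<^sub>R w t + V t *v u t))"
      unfolding that(3-5)
      by (rule ac_deriv_eq[OF ac_deriv_linear[OF bounded_linear_snd that(1)]]) (simp add: B_def vec.scale_right_distrib)
    ultimately show ?thesis
      using that(2) ac_deriv_continuous[OF dw] unfolding schr_pair_def mag_pair_def by (simp add: that(3,4))
  qed
  have "\<exists>Y. ac_deriv Y (\<lambda>t. B t (Y t) + F t) \<and> Y 0 = Y (2*pi)"
  proof (rule linear_ode_periodic[where g = g])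
    have "(\<lambda>t. norm (V t)) absolutely_integrable_on circ" "(\<lambda>t. \<bar>a t\<bar>) absolutely_integrable_on circ"
      using absolutely_integrable_norm[OF V_int] absolutely_integrable_norm[OF a_int] by (simp_all add: o_def)
    then show "g absolutely_integrable_on circ" unfolding g_def
      by (intro set_integral_add absolutely_integrable_scaleR_left[of _ _ 2, simplified real_scaleR_def]
            absolutely_integrable_scaleR_left[of _ _ C, simplified real_scaleR_def]) auto
    show "0 \<le> g t" for t using C(1) by (simp add: g_def)
    show "linear (B t)" for t
      by (rule linearI)
         (simp_all add: B_def scaleR_eq_smult matrix_vector_right_distrib matvec_smult, simp_all add: vec_eq_iff algebra_simps)
    show "norm (B t y) \<le> g t * norm y" for t y
    proof -
      have y: "norm (fst y) \<le> norm y" "norm (snd y) \<le> norm y" using norm_fst_le[of "fst y" "snd y"] norm_snd_le[of "snd y" "fst y"] by simp_all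
      have "norm (B t y) \<le> norm ((- \<i>) *s (snd y + a t *\<^sub>R fst y)) + norm ((- \<i>) *s (\<mu> *s fst y + a t *\<^sub>R snd y + V t *v fst y))"
        unfolding B_def by (rule norm_Pair_le)
      also have "\<dots> = norm (snd y + a t *\<^sub>R fst y) + norm (\<mu> *s fst y + a t *\<^sub>R snd y + V t *v fst y)"
        unfolding norm_smult by simp
      also have "\<dots> \<le> (norm (snd y) + \<bar>a t\<bar> * norm (fst y)) + ((cmod \<mu> * norm (fst y) + \<bar>a t\<bar> * norm (snd y)) + norm (V t) * norm (fst y) * C)"
        by (intro add_mono order_trans[OF norm_triangle_ineq] C(2)) (simp_all add: norm_smult)
      also have "\<dots> \<le> (norm y + \<bar>a t\<bar> * norm y) + ((cmod \<mu> * norm y + \<bar>a t\<bar> * norm y) + norm (V t) * norm y * C)"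
        using y C(1) by (intro add_mono mult_left_mono mult_right_mono) auto
      also have "\<dots> = g t * norm y" by (simp add: g_def algebra_simps)
      finally show ?thesis .
    qed
    show "(\<lambda>t. B t (Y t)) \<in> borel_measurable (lebesgue_on circ)" if Y: "continuous_on circ Y" for Y
    proof -
      have cY: "continuous_on circ (\<lambda>t. fst (Y t))" "continuous_on circ (\<lambda>t. snd (Y t))"
        using Y by (auto intro!: continuous_intros)
      have ci: "h absolutely_integrable_on circ" if "continuous_on circ h" for h :: "real \<Rightarrow> complex^'m"
        using that by (rule absolutely_integrable_continuous_real)
      have sm: "(\<lambda>t. c *s h t) absolutely_integrable_on circ" if "h absolutely_integrable_on circ" for h :: "real \<Rightarrow> complex^'m" and c
        using absolutely_integrable_linear[OF that bounded_linear_smult[of c]] by (simp add: o_def)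
      have "(\<lambda>t. (- \<i>) *s (snd (Y t) + a t *\<^sub>R fst (Y t))) absolutely_integrable_on circ"
        "(\<lambda>t. (- \<i>) *s (\<mu> *s fst (Y t) + a t *\<^sub>R snd (Y t) + V t *v fst (Y t))) absolutely_integrable_on circ"
        by (intro sm set_integral_add ci cY absint_bilinear_continuous(1)[OF bounded_bilinear_scaleR a_int]
            absint_bilinear_continuous(1)[OF bounded_bilinear_matvec V_int])+
      then show ?thesis unfolding B_def
        by (intro borel_measurable_Pair absolutely_integrable_imp_borel_measurable) auto
    qed
    have "bounded_linear (\<lambda>z. (0 :: complex^'m, (- \<i>) *s (z :: complex^'m)))"
      by (intro bounded_linear_Pair bounded_linear_zero bounded_linear_smult)
    from absolutely_integrable_linear[OF fi this] show "F absolutely_integrable_on circ"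
      by (simp add: F_def[abs_def] o_def)
    show "Y 0 = 0" if Y: "ac_deriv Y (\<lambda>t. B t (Y t))" "Y 0 = Y (2*pi)" for Y
    proof -
      have Y': "ac_deriv Y (\<lambda>t. B t (Y t) + (0, (- \<i>) *s (0 :: complex^'m)))"
        by (rule ac_deriv_eq[OF Y(1)]) (simp add: zero_prod_def[symmetric])
      have "eig_pair a V \<mu> (\<lambda>t. fst (Y t)) (\<lambda>t. snd (Y t))"
        by (rule sys[OF Y' Y(2) refl refl]) simp
      from triv[OF this, of 0] triv2[OF this, of 0] show ?thesis by (simp add: prod_eq_iff)
    qed
  qed
  then obtain Y where Y: "ac_deriv Y (\<lambda>t. B t (Y t) + (0, (- \<i>) *s f t))" "Y 0 = Y (2*pi)"
    unfolding F_def by blast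
  \<comment> \<open>Cut off outside [0, 2 pi] to meet the normalisation in
    \<open>in_resolvent\<close>, on which uniqueness depends.\<close>
  define u where "u t = (if t \<in> circ then fst (Y t) else 0)" for t
  have "schr_pair a V (\<lambda>t. fst (Y t)) (\<lambda>t. snd (Y t)) (\<lambda>t. f t + \<mu> *s fst (Y t))"
    by (rule sys[OF Y refl refl refl])
  then have su: "schr_pair a V u (\<lambda>t. snd (Y t)) (\<lambda>t. f t + \<mu> *s u t)"
    by (rule schr_pair_cong) (auto simp: u_def)
  show "\<exists>!u. (\<forall>x. x \<notin> circ \<longrightarrow> u x = 0) \<and> applyH a V u (\<lambda>x. f x + \<mu> *s u x)"
  proof (intro ex1I conjI)
    show "\<forall>x. x \<notin> circ \<longrightarrow> u x = 0" by (simp add: u_def)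
    show "applyH a V u (\<lambda>x. f x + \<mu> *s u x)" using su applyH_iff_schr_pair by blast
    fix v assume v: "(\<forall>x. x \<notin> circ \<longrightarrow> v x = 0) \<and> applyH a V v (\<lambda>x. f x + \<mu> *s v x)"
    then obtain z where sv: "schr_pair a V v z (\<lambda>x. f x + \<mu> *s v x)" using applyH_iff_schr_pair by blast
    \<comment> \<open>The difference of two solutions solves the homogeneous equation, so
      \<open>triv\<close> makes it vanish.\<close>
    have "eig_pair a V \<mu> (\<lambda>x. v x + (-1) *s u x) (\<lambda>x. z x + (-1) *s snd (Y x))"
      using schr_pair_add[OF sv schr_pair_smult[OF su, of "-1"]]
      by (rule schr_pair_cong) (simp_all add: vec_eq_iff algebra_simps)
    then have "v x + (-1) *s u x = 0" if "x \<in> circ" for x using triv that by blast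
    then have "v x = u x" if "x \<in> circ" for x using that by (simp add: vec_eq_iff)
    then show "v = u" using v by (intro ext) (metis u_def)
  qed
qed

text \<open>A spectral point within distance 1 of mu has real part at most Re mu + 1, and
  \<open>finite_eigenvalues_below\<close> leaves finitely many of these. The counting bound applied
  to a constant sequence of eigenvalues limits the multiplicity.\<close>

lemma discrete_spectrum_schrodinger: "discrete_spectrum a V"
  unfolding discrete_spectrum_def
proof (intro ballI conjI)
  have ev: "\<exists>u. eigenfun a V \<nu> u" if "\<nu> \<in> spectrumH a V" for \<nu>
    using that in_resolvent_if_no_eigenfun unfolding spectrumH_def by blast
  fix \<mu> assume \<mu>: "\<mu> \<in> spectrumH a V"
  show "\<exists>u. eigenfun a V \<mu> u" by (rule ev[OF \<mu>])
  define X where "X = {\<nu>. (\<exists>u. eigenfun a V \<nu> u) \<and> Re \<nu> \<le> Re \<mu> + 1} - {\<mu>}"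
  have "finite X" unfolding X_def using finite_eigenvalues_below by blast
  then obtain d where d: "d > 0" "\<forall>x\<in>X. x \<noteq> \<mu> \<longrightarrow> d \<le> dist \<mu> x" using finite_set_avoid by blast
  show "\<exists>e>0. \<forall>\<nu>\<in>spectrumH a V. \<nu> \<noteq> \<mu> \<longrightarrow> e \<le> cmod (\<nu> - \<mu>)"
  proof (intro exI[of _ "min d 1"] conjI ballI impI)
    fix \<nu> assume \<nu>: "\<nu> \<in> spectrumH a V" "\<nu> \<noteq> \<mu>"
    show "min d 1 \<le> cmod (\<nu> - \<mu>)"
    proof (cases "Re \<nu> \<le> Re \<mu> + 1")
      case True
      then have "\<nu> \<in> X" using ev[OF \<nu>(1)] \<nu>(2) by (simp add: X_def)
      then have "d \<le> dist \<mu> \<nu>" using d(2) \<nu>(2) by blast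
      then show ?thesis by (simp add: dist_norm norm_minus_commute min_le_iff_disj)
    next
      case False
      then have "1 \<le> \<bar>Re (\<nu> - \<mu>)\<bar>" by simp
      then show ?thesis using abs_Re_le_cmod[of "\<nu> - \<mu>"] by linarith
    qed
  qed (use d in simp)
  obtain N where N: "\<And>n e \<phi> w. eig_onb n e \<phi> w \<Longrightarrow> (\<forall>k<n. e k \<le> Re \<mu>) \<Longrightarrow> n \<le> N"
    using eig_onb_count_bound by metis
  have re: "\<mu> = complex_of_real (Re \<mu>)" using ev[OF \<mu>] eigenvalue_real by blast
  show "\<exists>N. \<forall>n u. (\<forall>k<n. eigenfun a V \<mu> (u k)) \<and> lin_indep n u \<longrightarrow> n \<le> N"
  proof (intro exI allI impI)
    fix n u assume h: "(\<forall>k<n. eigenfun a V \<mu> (u k)) \<and> lin_indep n u"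
    then obtain \<phi> w where "eig_onb n (\<lambda>k. Re \<mu>) \<phi> w"
      using eig_onb_exists[of n "\<lambda>k. Re \<mu>" u] re by metis
    then show "n \<le> N" by (rule N) simp
  qed
qed

end

section \<open>Integrability of V and the final theorem\<close>

lemma norm_le_sum_components: "norm x \<le> (\<Sum>i\<in>UNIV. norm (x $ i))"
  for x :: "'a::real_normed_vector^'n::finite"
  unfolding norm_vec_def by (rule L2_set_le_sum) simp

text \<open>Every entry of V is a component of V applied to a standard unit vector, so
  \<open>norm_matvec_le_tr32\<close> bounds it by M + \<open>tr32\<close>, which is integrable on a
  bounded interval.\<close>

lemma absolutely_integrable_psd:
  fixes V :: "real \<Rightarrow> complex^'m::finite^'m"
  assumes meas: "V \<in> borel_measurable (lebesgue_on circ)"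
    and h: "\<forall>x\<in>circ. herm (V x)" and p: "\<forall>x\<in>circ. psd (V x)"
    and tr: "(\<lambda>x. tr32 (V x)) integrable_on circ"
  shows "V absolutely_integrable_on circ"
proof (rule measurable_bounded_by_integrable_imp_absolutely_integrable[OF meas])
  let ?b = "\<lambda>x. \<Sum>i\<in>(UNIV::'m set). \<Sum>j\<in>(UNIV::'m set). CARD('m) + tr32 (V x)"
  show "?b integrable_on circ"
    using tr by (intro Henstock_Kurzweil_Integration.integrable_sum integrable_add) auto
  fix x assume x: "x \<in> circ"
  have "norm (V x) \<le> (\<Sum>i\<in>UNIV. norm (V x $ i))" by (rule norm_le_sum_components)
  also have "\<dots> \<le> (\<Sum>i\<in>UNIV. \<Sum>j\<in>UNIV. cmod (V x $ i $ j))"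
    by (intro sum_mono norm_le_sum_components)
  also have "\<dots> \<le> ?b x"
  proof (intro sum_mono)
    fix i j :: 'm
    have "V x $ i $ j = (V x *v axis j 1) $ i"
      by (simp add: matrix_vector_mult_def axis_def if_distrib cong: if_cong)
    then have "cmod (V x $ i $ j) \<le> norm (V x *v axis j 1)" by (metis Finite_Cartesian_Product.norm_nth_le)
    also have "\<dots> \<le> (CARD('m) + tr32 (V x)) * norm (axis j (1::complex))"
      using h p x by (intro norm_matvec_le_tr32) auto
    finally show "cmod (V x $ i $ j) \<le> CARD('m) + tr32 (V x)" by simp
  qed
  finally show "norm (V x) \<le> ?b x" .
qed auto

text \<open>The sum over eigenvalues with multiplicity is a supremum over finite linearly
  independent families of eigenfunctions. As every \<open>lam k\<close> is nonnegative, a bound on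
  all these finite sums bounds the series.\<close>

theorem theorem6p4:
  fixes a :: "real \<Rightarrow> real" and V :: "real \<Rightarrow> complex^'m::finite^'m"
  assumes a_L1: "a absolutely_integrable_on {0..2*pi}"
    and flux: "integral {0..2*pi} a / (2*pi) \<notin> \<int>"
    and V_meas: "V \<in> borel_measurable (lebesgue_on {0..2*pi})"
    and V_herm: "\<forall>x\<in>{0..2*pi}. herm (V x)"
    and V_nonneg: "\<forall>x\<in>{0..2*pi}. psd (V x)"
    and V_L32: "(\<lambda>x. tr32 (V x)) absolutely_integrable_on {0..2*pi}"
  shows "discrete_spectrum a V \<and>
    (\<forall>n (u :: nat \<Rightarrow> real \<Rightarrow> complex^'m) (lam :: nat \<Rightarrow> real).
       (\<forall>k<n. lam k \<ge> 0 \<and> eigenfun a V (complex_of_real (- lam k)) (u k)) \<and> lin_indep n u \<longrightarrow>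
       (\<Sum>k<n. lam k) \<le> 2 / (3 * sqrt 3) * Kconst (integral {0..2*pi} a / (2*pi))
                        * integral {0..2*pi} (\<lambda>x. tr32 (V x)))"
proof -
  have tr: "(\<lambda>x. tr32 (V x)) integrable_on circ" using V_L32 absolutely_integrable_on_def by blast
  interpret schrodinger a V "integral circ a / (2*pi)"
    by unfold_locales
       (use a_L1 flux V_herm absolutely_integrable_psd[OF V_meas V_herm V_nonneg tr] in blast)+
  show ?thesis
  proof (intro conjI allI impI)
    show "discrete_spectrum a V" by (rule discrete_spectrum_schrodinger)
    fix n and u :: "nat \<Rightarrow> real \<Rightarrow> complex^'m" and lam :: "nat \<Rightarrow> real"
    assume h: "(\<forall>k<n. lam k \<ge> 0 \<and> eigenfun a V (complex_of_real (- lam k)) (u k)) \<and> lin_indep n u"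
    obtain \<phi> w where o: "eig_onb n (\<lambda>k. - lam k) \<phi> w"
      using h by (elim conjE) (rule eig_onb_exists[of n "\<lambda>k. - lam k" u], auto)
    have "- (\<Sum>k<n. - lam k) \<le> 2 / (3 * sqrt 3) * Kconst (integral circ a / (2*pi)) * integral circ (\<lambda>x. tr32 (V x))"
      using V_nonneg by (intro lieb_thirring[OF o _ tr]) auto
    then show "(\<Sum>k<n. lam k) \<le> 2 / (3 * sqrt 3) * Kconst (integral {0..2*pi} a / (2*pi)) * integral {0..2*pi} (\<lambda>x. tr32 (V x))"
      by (simp add: sum_negf)
  qed
qed

end
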